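(* Let $(X,\mathcal{X},\mu)$ be a probability space and let $T_1,T_2$ be two commuting invertible measure preserving transformations of it. Assume that $(X,\mathcal{X},\mu,T_1,T_2)$ is ergodic. Let $A\in\mathcal{X}$ with $\mu(A)>0$. Then for every $\epsilon>0$, the set $$\{n\in\mathbb{Z}\colon\ \mu(A\cap T_1^nA\cap T_2^nA)>\mu(A)^4-\epsilon\}$$ is syndetic.
   Context: $(X,\mathcal{X},\mu,T_1,T_2)$ is ergodic if every measurable set invariant under both $T_1$ and $T_2$ has measure $0$ or $1$ (ergodicity of the joint $\mathbb{Z}^2$-action). A subset $E$ of $\mathbb{Z}$ is syndetic if there exists an integer $N>0$ such that $E\cap[M,M+N)\neq\emptyset$ for every $M\in\mathbb{Z}$. *)

theory Defs
  imports "HOL-Probability.Probability"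
begin

definition invertible_mpt :: "'a measure \<Rightarrow> ('a \<Rightarrow> 'a) \<Rightarrow> bool" where
  "invertible_mpt M T \<longleftrightarrow>
     T \<in> M \<rightarrow>\<^sub>M M \<and>
     bij_betw T (space M) (space M) \<and>
     inv_into (space M) T \<in> M \<rightarrow>\<^sub>M M \<and>
     (\<forall>B\<in>sets M. emeasure M (T -` B \<inter> space M) = emeasure M B)"

definition commuting_on :: "'a set \<Rightarrow> ('a \<Rightarrow> 'a) \<Rightarrow> ('a \<Rightarrow> 'a) \<Rightarrow> bool" where
  "commuting_on X S T \<longleftrightarrow> (\<forall>x\<in>X. S (T x) = T (S x))"

text \<open>
  Invariance is required under both maps, so this is ergodicity of the joint action of pairs of
  integers; neither map needs to be ergodic by itself.
\<close>

definition jointly_ergodic :: "'a measure \<Rightarrow> ('a \<Rightarrow> 'a) \<Rightarrow> ('a \<Rightarrow> 'a) \<Rightarrow> bool" where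
  "jointly_ergodic M S T \<longleftrightarrow>
     (\<forall>B\<in>sets M. S -` B \<inter> space M = B \<and> T -` B \<inter> space M = B \<longrightarrow>
        measure M B = 0 \<or> measure M B = 1)"

text \<open>
  The integer iterates of a bijection \<open>T\<close> of \<open>X\<close>. Since \<open>T\<close> is a total function on the
  ambient type, its inverse has to be taken relative to \<open>X\<close>; only values on \<open>X\<close> are meaningful.
\<close>

definition int_iterate :: "'a set \<Rightarrow> ('a \<Rightarrow> 'a) \<Rightarrow> int \<Rightarrow> 'a \<Rightarrow> 'a" where
  "int_iterate X T n = (if 0 \<le> n then T ^^ nat n else inv_into X T ^^ nat (- n))"

definition syndetic :: "int set \<Rightarrow> bool" where
  "syndetic E \<longleftrightarrow> (\<exists>N>0. \<forall>m. E \<inter> {m..<m + N} \<noteq> {})"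

end

theory Submission
  imports Defs
begin

text \<open>
  Code a point by the set of \<open>e \<in> \<int>\<^sup>2\<close> which move it into \<open>A\<close>. A corner then consists of the vertices
  of a triangle bounded by lines \<open>x = i\<close>, \<open>y = j\<close>, \<open>- x - y = l\<close> with \<open>i + j + l = n\<close>, and each vertex
  lies on two of the three lines. If the average of the corner counts detects a function \<open>g\<close> at a
  vertex, then \<open>g\<close> correlates on large boxes with a product of a function of \<open>i\<close> and a function of
  \<open>j\<close>. A weak limit turns these into new bits attached to lines, so that extensions of the
  system by line bits take the place of magic extensions; an extremality argument keeps the extension
  ergodic, and an energy increment shows that the process stops. What remains is
  \<open>E (h\<^sub>0\<^sub>1 h\<^sub>1\<^sub>2 h\<^sub>0\<^sub>2)\<close> with the conditional expectations of \<open>A\<close> on the line bits. Ergodicity makes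
  lines of different directions independent in pairs, hence this quantity is almost periodic in \<open>n\<close>, and
  at \<open>n = 0\<close> it is at least \<open>\<mu>(A)\<^sup>4\<close> by the inequality of arithmetic and geometric means. All limits are
  taken in the space of finitely additive means, where no measurability has to be checked.
\<close>

section \<open>Finitely additive means\<close>

text \<open>The exponent 4 comes from the inequality of the means for the four numbers
  \<open>x y z / a^3\<close>, \<open>a / x\<close>, \<open>a / y\<close>, \<open>a / z\<close>,
  where \<open>a\<close> is the measure of \<open>A\<close> and \<open>x\<close>, \<open>y\<close>,
  \<open>z\<close> are its three conditional expectations. Integrated over \<open>A\<close>, each of
  the last three contributes at most \<open>a\<close>, so that \<open>4 a - 3 a\<close> remains,
  times \<open>a^3\<close>. At \<open>n = 0\<close> the triangle degenerates and its three vertices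
  coincide; this is why the correlation at 0 is the mean of a product of three functions of one
  point. An extension must stay ergodic, because the independence of lines of different directions
  is applied to the added bits. Syndeticity asks for bounds that do not depend on the position of an
  interval. Therefore no limit in \<open>n\<close> is taken: each error estimate is a finite
  inequality valid on every interval, with boundary terms independent of its position. Return times
  enter through a weight that is a polynomial in finitely many translates of the correlation
  function of the line bits. Such a weight splits into averages of products of a function of
  \<open>i\<close> and a function of \<open>j\<close>, which does the work of Fourier
  analysis.\<close>

definition bddf :: "('a \<Rightarrow> real) \<Rightarrow> bool" where
  "bddf f \<longleftrightarrow> (\<exists>C. \<forall>x. \<bar>f x\<bar> \<le> C)"

lemma bddfI: "(\<And>x. \<bar>f x\<bar> \<le> C) \<Longrightarrow> bddf f"
  by (auto simp: bddf_def)

lemma bddfE: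
  assumes "bddf f" obtains C where "C > 0" "\<And>x. \<bar>f x\<bar> \<le> C"
proof -
  obtain C where C: "\<And>x. \<bar>f x\<bar> \<le> C" using assms by (auto simp: bddf_def)
  show thesis
  proof (rule that[of "\<bar>C\<bar> + 1"])
    show "\<bar>f x\<bar> \<le> \<bar>C\<bar> + 1" for x using C[of x] by linarith
  qed simp
qed

lemma bddf_const [simp, intro]: "bddf (\<lambda>_. c)"
  by (rule bddfI[of _ "\<bar>c\<bar>"]) simp

lemma bddf_of_bool [simp, intro]: "bddf (\<lambda>x. of_bool (P x))"
  by (rule bddfI[of _ 1]) simp

lemma bddf_add [intro]: "bddf f \<Longrightarrow> bddf g \<Longrightarrow> bddf (\<lambda>x. f x + g x)"
  by (elim bddfE) (rule bddfI, rule order_trans[OF abs_triangle_ineq add_mono], auto)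

lemma bddf_mult [intro]: "bddf f \<Longrightarrow> bddf g \<Longrightarrow> bddf (\<lambda>x. f x * g x)"
  by (elim bddfE) (rule bddfI, unfold abs_mult, rule mult_mono', auto)

lemma bddf_uminus [intro]: "bddf f \<Longrightarrow> bddf (\<lambda>x. - f x)"
  by (auto simp: bddf_def)

lemma bddf_diff [intro]: "bddf f \<Longrightarrow> bddf g \<Longrightarrow> bddf (\<lambda>x. f x - g x)"
  using bddf_add[of f "\<lambda>x. - g x"] by auto

lemma bddf_divide [intro]: "bddf f \<Longrightarrow> bddf (\<lambda>x. f x / c)"
  using bddf_mult[of f "\<lambda>_. 1 / c"] by simp

lemma bddf_power [intro]: "bddf f \<Longrightarrow> bddf (\<lambda>x. f x ^ n)"
  by (induction n) auto

lemma bddf_abs [intro]: "bddf f \<Longrightarrow> bddf (\<lambda>x. \<bar>f x\<bar>)"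
  by (auto simp: bddf_def)

lemma bddf_sum [intro]: "(\<And>i. i \<in> I \<Longrightarrow> bddf (f i)) \<Longrightarrow> bddf (\<lambda>x. \<Sum>i\<in>I. f i x)"
  by (induction I rule: infinite_finite_induct) auto

lemma bddf_comp: "bddf f \<Longrightarrow> bddf (\<lambda>x. f (g x))"
  by (auto simp: bddf_def)

lemma bddf_sum_list [intro]: "(\<And>i. i \<in> set xs \<Longrightarrow> bddf (f i)) \<Longrightarrow> bddf (\<lambda>x. \<Sum>i\<leftarrow>xs. f i x)"
  by (induction xs) auto

lemmas bddf_simps = bddf_add bddf_mult bddf_uminus bddf_diff bddf_divide bddf_power bddf_abs
  bddf_sum bddf_sum_list

text \<open>Only the values at bounded functions are constrained; at other functions a mean is
  arbitrary, which is why \<open>bddf\<close> premises accompany the rules.\<close>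

definition mean :: "(('a \<Rightarrow> real) \<Rightarrow> real) \<Rightarrow> bool" where
  "mean \<psi> \<longleftrightarrow>
     (\<forall>f g. bddf f \<longrightarrow> bddf g \<longrightarrow> \<psi> (\<lambda>x. f x + g x) = \<psi> f + \<psi> g) \<and>
     (\<forall>c f. bddf f \<longrightarrow> \<psi> (\<lambda>x. c * f x) = c * \<psi> f) \<and>
     (\<forall>f. bddf f \<longrightarrow> (\<forall>x. 0 \<le> f x) \<longrightarrow> 0 \<le> \<psi> f) \<and>
     \<psi> (\<lambda>_. 1) = 1"

lemma mean_add: "mean \<psi> \<Longrightarrow> bddf f \<Longrightarrow> bddf g \<Longrightarrow> \<psi> (\<lambda>x. f x + g x) = \<psi> f + \<psi> g"
  by (simp add: mean_def)

lemma mean_cmult: "mean \<psi> \<Longrightarrow> bddf f \<Longrightarrow> \<psi> (\<lambda>x. c * f x) = c * \<psi> f"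
  by (simp add: mean_def)

lemma mean_multc: "mean \<psi> \<Longrightarrow> bddf f \<Longrightarrow> \<psi> (\<lambda>x. f x * c) = \<psi> f * c"
  using mean_cmult[of \<psi> f c] by (simp add: mult.commute)

lemma mean_divide: "mean \<psi> \<Longrightarrow> bddf f \<Longrightarrow> \<psi> (\<lambda>x. f x / c) = \<psi> f / c"
  using mean_multc[of \<psi> f "1 / c"] by simp

lemma mean_nonneg: "mean \<psi> \<Longrightarrow> bddf f \<Longrightarrow> (\<And>x. 0 \<le> f x) \<Longrightarrow> 0 \<le> \<psi> f"
  by (simp add: mean_def)

lemma mean_const [simp]: "mean \<psi> \<Longrightarrow> \<psi> (\<lambda>_. c) = c"
  using mean_cmult[of \<psi> "\<lambda>_. 1" c] by (simp add: mean_def)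

lemma mean_uminus: "mean \<psi> \<Longrightarrow> bddf f \<Longrightarrow> \<psi> (\<lambda>x. - f x) = - \<psi> f"
  using mean_cmult[of \<psi> f "-1"] by simp

lemma mean_diff: "mean \<psi> \<Longrightarrow> bddf f \<Longrightarrow> bddf g \<Longrightarrow> \<psi> (\<lambda>x. f x - g x) = \<psi> f - \<psi> g"
  using mean_add[of \<psi> f "\<lambda>x. - g x"] mean_uminus[of \<psi> g] by (simp add: bddf_uminus)

lemma mean_mono: "mean \<psi> \<Longrightarrow> bddf f \<Longrightarrow> bddf g \<Longrightarrow> (\<And>x. f x \<le> g x) \<Longrightarrow> \<psi> f \<le> \<psi> g"
  using mean_nonneg[of \<psi> "\<lambda>x. g x - f x"] mean_diff[of \<psi> g f] by (auto intro: bddf_diff)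

lemma mean_sum:
  assumes "mean \<psi>" "\<And>i. i \<in> I \<Longrightarrow> bddf (f i)"
  shows "\<psi> (\<lambda>x. \<Sum>i\<in>I. f i x) = (\<Sum>i\<in>I. \<psi> (f i))"
  using assms(2)
proof (induction I rule: infinite_finite_induct)
  case (insert i I)
  then show ?case
    using mean_add[OF assms(1), of "f i" "\<lambda>x. \<Sum>i\<in>I. f i x"] by (simp add: bddf_sum)
qed (use assms(1) in auto)

lemma mean_sum_list:
  assumes "mean \<psi>" "\<And>i. i \<in> set xs \<Longrightarrow> bddf (f i)"
  shows "\<psi> (\<lambda>x. \<Sum>i\<leftarrow>xs. f i x) = (\<Sum>i\<leftarrow>xs. \<psi> (f i))"
  using assms(2)
proof (induction xs)
  case (Cons i I)
  then show ?case
    using mean_add[OF assms(1), of "f i" "\<lambda>x. \<Sum>i\<leftarrow>I. f i x"] by (simp add: bddf_sum_list)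
qed (use assms(1) in auto)

lemma mean_bound:
  assumes "mean \<psi>" "\<And>x. \<bar>f x\<bar> \<le> C"
  shows "\<bar>\<psi> f\<bar> \<le> C"
proof -
  have b: "bddf f" using assms(2) by (rule bddfI)
  have "\<psi> f \<le> C"
    using mean_mono[OF assms(1) b bddf_const[of C]] assms
    by (auto simp: abs_le_iff)
  moreover have "- C \<le> \<psi> f"
    using mean_mono[OF assms(1) bddf_const[of "-C"] b] assms
    by (auto simp: abs_le_iff minus_le_iff)
  ultimately show ?thesis by linarith
qed

lemma mean_abs: "mean \<psi> \<Longrightarrow> bddf f \<Longrightarrow> \<bar>\<psi> f\<bar> \<le> \<psi> (\<lambda>x. \<bar>f x\<bar>)"
  using mean_mono[of \<psi> f "\<lambda>x. \<bar>f x\<bar>"] mean_mono[of \<psi> "\<lambda>x. - f x" "\<lambda>x. \<bar>f x\<bar>"] mean_uminus[of \<psi> f]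
  by (auto simp: bddf_abs bddf_uminus abs_le_iff)

lemma mean_square:
  assumes m: "mean \<psi>" and f: "bddf f"
  shows "(\<psi> f)\<^sup>2 \<le> \<psi> (\<lambda>x. (f x)\<^sup>2)"
proof -
  have "0 \<le> \<psi> (\<lambda>x. (f x - \<psi> f)\<^sup>2)"
    using f by (intro mean_nonneg[OF m] bddf_power bddf_diff) auto
  also have "(\<lambda>x. (f x - \<psi> f)\<^sup>2) = (\<lambda>x. ((f x)\<^sup>2 + (\<psi> f)\<^sup>2) - 2 * \<psi> f * f x)"
    by (auto simp: power2_eq_square algebra_simps)
  also have "\<psi> \<dots> = \<psi> (\<lambda>x. (f x)\<^sup>2) + (\<psi> f)\<^sup>2 - 2 * \<psi> f * \<psi> f"
    using f by (subst mean_diff[OF m], auto simp: mean_add[OF m] mean_cmult[OF m] bddf_power m)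
  finally show ?thesis by (simp add: power2_eq_square)
qed

text \<open>The shape in which Cauchy-Schwarz is used below: a factor about which only a bound is
  known gets discarded.\<close>

lemma mean_cauchy_schwarz_le_one:
  assumes m: "mean \<psi>" and f: "bddf f" and g: "\<And>x. \<bar>g x\<bar> \<le> 1"
  shows "(\<psi> (\<lambda>x. f x * g x))\<^sup>2 \<le> \<psi> (\<lambda>x. (f x)\<^sup>2)"
proof -
  have bg: "bddf g" using g by (rule bddfI)
  have "(\<psi> (\<lambda>x. f x * g x))\<^sup>2 \<le> \<psi> (\<lambda>x. (f x * g x)\<^sup>2)"
    using f bg by (intro mean_square[OF m]) auto
  also have "\<dots> \<le> \<psi> (\<lambda>x. (f x)\<^sup>2)"
  proof (rule mean_mono[OF m])
    show "(f x * g x)\<^sup>2 \<le> (f x)\<^sup>2" for x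
      using g[of x] by (simp add: power_mult_distrib mult_left_le abs_square_le_1)
  qed (use f bg in auto)
  finally show ?thesis .
qed

lemma mean_eq_zero_of_support:
  assumes m: "mean \<psi>" and f: "bddf f" and z: "\<psi> (\<lambda>x. of_bool (P x)) = 0"
  shows "\<psi> (\<lambda>x. f x * of_bool (P x)) = 0"
proof -
  obtain C where C: "C > 0" "\<And>x. \<bar>f x\<bar> \<le> C" using bddfE[OF f] by blast
  have "\<bar>\<psi> (\<lambda>x. f x * of_bool (P x))\<bar> \<le> \<psi> (\<lambda>x. \<bar>f x * of_bool (P x)\<bar>)"
    using f by (intro mean_abs[OF m]) auto
  also have "\<dots> \<le> \<psi> (\<lambda>x. C * of_bool (P x))"
    using f C by (intro mean_mono[OF m]) (auto simp: abs_mult)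
  also have "\<dots> = 0" using z by (simp add: mean_cmult[OF m])
  finally show ?thesis by simp
qed

text \<open>Models two independent copies of a system. Fubini may fail for finitely additive means,
  so the order of integration is fixed; explicit values are computed only for products of a function
  of one copy and a function of the other, where the order is immaterial.\<close>

lemma mean_iterated:
  assumes "mean \<psi>" "mean \<phi>"
  shows "mean (\<lambda>f. \<psi> (\<lambda>x. \<phi> (\<lambda>y. f (x, y))))"
proof -
  have b: "bddf (\<lambda>x. \<phi> (\<lambda>y. f (x, y)))" if "bddf f" for f :: "'a \<times> 'b \<Rightarrow> real"
  proof -
    obtain C where "\<And>z. \<bar>f z\<bar> \<le> C" using bddfE[OF \<open>bddf f\<close>] by blast
    then show ?thesis by (intro bddfI[of _ C] mean_bound[OF assms(2)]) auto
  qed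
  have b': "bddf (\<lambda>y. f (x, y))" if "bddf f" for f :: "'a \<times> 'b \<Rightarrow> real" and x
    using bddf_comp[OF that] .
  show ?thesis
    unfolding mean_def
  proof (intro conjI allI impI)
    show "\<psi> (\<lambda>x. \<phi> (\<lambda>y. f (x, y) + g (x, y))) = \<psi> (\<lambda>x. \<phi> (\<lambda>y. f (x, y))) + \<psi> (\<lambda>x. \<phi> (\<lambda>y. g (x, y)))"
      if "bddf f" "bddf g" for f g
      using that b b' by (simp add: mean_add[OF assms(1), symmetric] mean_add[OF assms(2), symmetric])
    show "\<psi> (\<lambda>x. \<phi> (\<lambda>y. c * f (x, y))) = c * \<psi> (\<lambda>x. \<phi> (\<lambda>y. f (x, y)))" if "bddf f" for c f
      using that b b' by (simp add: mean_cmult[OF assms(1), symmetric] mean_cmult[OF assms(2), symmetric])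
    show "0 \<le> \<psi> (\<lambda>x. \<phi> (\<lambda>y. f (x, y)))" if "bddf f" "\<forall>z. 0 \<le> f z" for f
      using that b b' assms by (intro mean_nonneg[OF assms(1)] mean_nonneg[OF assms(2)]) auto
    show "\<psi> (\<lambda>x. \<phi> (\<lambda>y. 1)) = 1" using assms by simp
  qed
qed

lemma mean_average:
  assumes "finite I" "I \<noteq> {}" "\<And>i. i \<in> I \<Longrightarrow> mean (\<psi> i)"
  shows "mean (\<lambda>f. (\<Sum>i\<in>I. \<psi> i f) / card I)"
  unfolding mean_def
proof (intro conjI allI impI)
  show "(\<Sum>i\<in>I. \<psi> i (\<lambda>x. f x + g x)) / card I = (\<Sum>i\<in>I. \<psi> i f) / card I + (\<Sum>i\<in>I. \<psi> i g) / card I"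
    if "bddf f" "bddf g" for f g
    using that by (simp add: mean_add[OF assms(3)] sum.distrib add_divide_distrib)
  show "(\<Sum>i\<in>I. \<psi> i (\<lambda>x. c * f x)) / card I = c * ((\<Sum>i\<in>I. \<psi> i f) / card I)" if "bddf f" for c f
    using that by (simp add: mean_cmult[OF assms(3)] sum_distrib_left)
  show "0 \<le> (\<Sum>i\<in>I. \<psi> i f) / card I" if "bddf f" "\<forall>x. 0 \<le> f x" for f
    using that by (intro divide_nonneg_nonneg sum_nonneg mean_nonneg[OF assms(3)]) auto
qed (use assms in simp)

lemma mean_pushforward:
  assumes "mean \<psi>"
  shows "mean (\<lambda>f. \<psi> (\<lambda>x. f (g x)))"
proof -
  have "bddf (\<lambda>x. f (g x))" if "bddf f" for f :: "'b \<Rightarrow> real"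
    using bddf_comp[OF that] .
  then show ?thesis using assms unfolding mean_def by auto
qed

lemma mean_reweight:
  assumes m: "mean \<psi>" and f: "bddf w" "\<And>x. 0 \<le> w x" "\<psi> w = 1"
  shows "mean (\<lambda>f. \<psi> (\<lambda>x. f x * w x))"
  unfolding mean_def
proof (intro conjI allI impI)
  show "\<psi> (\<lambda>x. (f x + g x) * w x) = \<psi> (\<lambda>x. f x * w x) + \<psi> (\<lambda>x. g x * w x)" if "bddf f" "bddf g" for f g
    using that f by (simp add: mean_add[OF m, symmetric] bddf_mult distrib_right)
  show "\<psi> (\<lambda>x. c * f x * w x) = c * \<psi> (\<lambda>x. f x * w x)" if "bddf f" for c f
    using that f by (simp add: mean_cmult[OF m, symmetric] bddf_mult mult.assoc)
  show "0 \<le> \<psi> (\<lambda>x. f x * w x)" if "bddf f" "\<forall>x. 0 \<le> f x" for f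
    using that f by (intro mean_nonneg[OF m] bddf_mult) auto
qed (use f in simp)

text \<open>Tychonoff's theorem for the product of the intervals \<open>[-C f, C f]\<close>. The
  index type may be uncountable, so a cluster point need not be the limit of a subsequence; it is a
  limit along a filter finer than \<open>sequentially\<close>.\<close>

lemma pointwise_cluster:
  fixes X :: "nat \<Rightarrow> 'f \<Rightarrow> real"
  assumes "\<And>n f. \<bar>X n f\<bar> \<le> C f"
  obtains F Y where "F \<noteq> bot" "F \<le> sequentially" "\<And>f. ((\<lambda>n. X n f) \<longlongrightarrow> Y f) F"
proof -
  have "compactin (product_topology (\<lambda>_. euclidean) UNIV) (\<Pi>\<^sub>E f\<in>UNIV. {- C f..C f})"
    by (subst compactin_PiE) auto
  then have "compact (\<Pi>\<^sub>E f\<in>UNIV. {- C f..C f})"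
    by (simp add: euclidean_product_topology)
  moreover have "eventually (\<lambda>x. x \<in> (\<Pi>\<^sub>E f\<in>UNIV. {- C f..C f})) (filtermap X sequentially)"
  proof -
    have "- C f \<le> X n f \<and> X n f \<le> C f" for n f using assms[of n f] by linarith
    then show ?thesis by (simp add: eventually_filtermap PiE_def Pi_def)
  qed
  ultimately obtain Y where Y: "inf (nhds Y) (filtermap X sequentially) \<noteq> bot"
    unfolding compact_filter using filtermap_bot_iff[of X sequentially] sequentially_bot by blast
  \<comment> \<open>Refines \<open>sequentially\<close> by the pullback of the neighbourhoods of
    \<open>Y\<close>. It is a proper filter because \<open>Y\<close> is a cluster point.\<close>
  define F where "F = inf (filtercomap X (nhds Y)) sequentially"
  have F1: "F \<noteq> bot"
  proof
    assume "F = bot"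
    then have "eventually (\<lambda>_. False) F" by simp
    then obtain P' P Q where "\<And>n. P (X n) \<Longrightarrow> P' n"
      and P: "eventually P (nhds Y)" and Q: "eventually Q sequentially"
      and "\<And>n. P' n \<and> Q n \<Longrightarrow> False"
      unfolding F_def eventually_inf eventually_filtercomap by blast
    then have PQ: "\<And>n. P (X n) \<Longrightarrow> Q n \<Longrightarrow> False" by blast
    have "eventually (\<lambda>x. \<not> P x) (filtermap X sequentially)"
      unfolding eventually_filtermap by (rule eventually_mono[OF Q]) (use PQ in blast)
    then have "eventually (\<lambda>_. False) (inf (nhds Y) (filtermap X sequentially))"
      unfolding eventually_inf using P by blast
    then show False using Y by (simp add: trivial_limit_def)
  qed
  have F2: "F \<le> sequentially" by (simp add: F_def)
  have F3: "((\<lambda>n. X n f) \<longlongrightarrow> Y f) F" for f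
  proof -
    have "filterlim X (nhds Y) (filtercomap X (nhds Y))" by (rule filterlim_filtercomap)
    then have XY: "filterlim X (nhds Y) F" unfolding F_def
      by (rule filterlim_mono[OF _ order_refl inf.cobounded1])
    show ?thesis
      by (rule continuous_on_tendsto_compose[OF continuous_on_product_coordinates[of f] XY]) auto
  qed
  show thesis by (rule that[OF F1 F2 F3])
qed

lemma mean_cluster:
  fixes \<psi> :: "nat \<Rightarrow> ('a \<Rightarrow> real) \<Rightarrow> real"
  assumes m: "\<And>n. mean (\<psi> n)"
  obtains F \<phi> where "F \<noteq> bot" "F \<le> sequentially" "mean \<phi>"
    "\<And>f. bddf f \<Longrightarrow> ((\<lambda>n. \<psi> n f) \<longlongrightarrow> \<phi> f) F"
proof -
  define X where "X n f = (if bddf f then \<psi> n f else 0)" for n f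
  define C where "C f = (SOME C. 0 \<le> C \<and> (bddf f \<longrightarrow> (\<forall>x. \<bar>f x\<bar> \<le> C)))" for f :: "'a \<Rightarrow> real"
  have C: "0 \<le> C f \<and> (bddf f \<longrightarrow> (\<forall>x. \<bar>f x\<bar> \<le> C f))" for f
  proof -
    have "\<exists>C. 0 \<le> C \<and> (bddf f \<longrightarrow> (\<forall>x. \<bar>f x\<bar> \<le> C))"
    proof (cases "bddf f")
      case True
      then obtain C where "C > 0" "\<And>x. \<bar>f x\<bar> \<le> C" using bddfE by blast
      then show ?thesis by (intro exI[of _ C]) simp
    qed auto
    then show ?thesis unfolding C_def by (rule someI_ex)
  qed
  have "\<bar>X n f\<bar> \<le> C f" for n f
    using C[of f] mean_bound[OF m[of n], of f "C f"] by (auto simp: X_def)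
  then obtain F \<phi> where F: "F \<noteq> bot" "F \<le> sequentially"
    and lim: "\<And>f. ((\<lambda>n. X n f) \<longlongrightarrow> \<phi> f) F"
    using pointwise_cluster[of X C] by metis
  have L: "((\<lambda>n. \<psi> n f) \<longlongrightarrow> \<phi> f) F" if "bddf f" for f
    using lim[of f] that by (simp add: X_def)
  note u = tendsto_unique[OF F(1)]
  have "mean \<phi>"
    unfolding mean_def
  proof (intro conjI allI impI)
    fix f g :: "'a \<Rightarrow> real" assume fg: "bddf f" "bddf g"
    have "((\<lambda>n. \<psi> n f + \<psi> n g) \<longlongrightarrow> \<phi> f + \<phi> g) F" using L fg by (intro tendsto_add) auto
    moreover have "((\<lambda>n. \<psi> n f + \<psi> n g) \<longlongrightarrow> \<phi> (\<lambda>x. f x + g x)) F"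
      using L[of "\<lambda>x. f x + g x"] fg by (simp add: mean_add[OF m] bddf_add)
    ultimately show "\<phi> (\<lambda>x. f x + g x) = \<phi> f + \<phi> g" using u by blast
  next
    fix c and f :: "'a \<Rightarrow> real" assume f: "bddf f"
    have "((\<lambda>n. c * \<psi> n f) \<longlongrightarrow> c * \<phi> f) F" using L f by (intro tendsto_mult) auto
    moreover have "((\<lambda>n. c * \<psi> n f) \<longlongrightarrow> \<phi> (\<lambda>x. c * f x)) F"
      using L[of "\<lambda>x. c * f x"] f by (simp add: mean_cmult[OF m] bddf_mult)
    ultimately show "\<phi> (\<lambda>x. c * f x) = c * \<phi> f" using u by blast
  next
    fix f :: "'a \<Rightarrow> real" assume f: "bddf f" "\<forall>x. 0 \<le> f x"
    show "0 \<le> \<phi> f"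
      by (rule tendsto_lowerbound[OF L[OF f(1)] _ F(1)])
        (intro always_eventually allI mean_nonneg[OF m] f(1) f(2)[rule_format])
  next
    have "((\<lambda>n. 1) \<longlongrightarrow> \<phi> (\<lambda>_. 1)) F" using L[of "\<lambda>_. 1"] m by simp
    then show "\<phi> (\<lambda>_. 1) = 1" using u[of "\<lambda>_. 1"] tendsto_const by blast
  qed
  then show thesis by (rule that[OF F _ L])
qed

section \<open>Configurations of points and lines\<close>

lemma abs_sum_interval_shift_nat:
  fixes G :: "int \<Rightarrow> real"
  assumes G: "\<And>j. \<bar>G j\<bar> \<le> C"
  shows "\<bar>(\<Sum>j\<in>{a..<b}. G (j + int n)) - (\<Sum>j\<in>{a..<b}. G j)\<bar> \<le> 2 * C * real n"
proof (induction n)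
  case (Suc n)
  let ?H = "\<lambda>j. G (j + int n)"
  have "\<bar>(\<Sum>j\<in>{a..<b}. ?H (j + 1)) - (\<Sum>j\<in>{a..<b}. ?H j)\<bar> \<le> 2 * C"
  proof (cases "a < b")
    case True
    have "(\<Sum>j\<in>{a..<b}. ?H (j + 1)) = (\<Sum>j\<in>{a+1..<b+1}. ?H j)"
      by (rule sum.reindex_bij_witness[of _ "\<lambda>j. j - 1" "\<lambda>j. j + 1"]) auto
    moreover have "{a+1..<b+1} = insert b {a+1..<b}" "{a..<b} = insert a {a+1..<b}" using True by auto
    ultimately have "(\<Sum>j\<in>{a..<b}. ?H (j + 1)) - (\<Sum>j\<in>{a..<b}. ?H j) = ?H b - ?H a" by simp
    then show ?thesis using G[of "b + int n"] G[of "a + int n"] by linarith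
  next
    case False
    then show ?thesis using G[of 0] by simp
  qed
  then show ?case using Suc by (simp add: algebra_simps)
qed simp

lemma abs_sum_interval_shift:
  fixes G :: "int \<Rightarrow> real"
  assumes G: "\<And>j. \<bar>G j\<bar> \<le> C"
  shows "\<bar>(\<Sum>j\<in>{a..<b}. G (j + e)) - (\<Sum>j\<in>{a..<b}. G j)\<bar> \<le> 2 * C * real_of_int \<bar>e\<bar>"
proof (cases "e \<ge> 0")
  case True
  then show ?thesis using abs_sum_interval_shift_nat[where n="nat e" and G=G and C=C and a=a and b=b, OF G] by simp
next
  case False
  then show ?thesis
    using abs_sum_interval_shift_nat[where n="nat (- e)" and G="\<lambda>j. G (j + e)" and C=C and a=a and b=b, OF G]
    by (simp add: abs_minus_commute)
qed

definition grid :: "nat \<Rightarrow> (int \<times> int) set" where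
  "grid K = {0..<int K} \<times> {0..<int K}"

lemma finite_grid [simp]: "finite (grid K)"
  by (simp add: grid_def)

lemma card_grid [simp]: "card (grid K) = K\<^sup>2"
  by (simp add: grid_def power2_eq_square)

lemma grid_nonempty: "K > 0 \<Longrightarrow> grid K \<noteq> {}"
  by (auto simp: grid_def)

text \<open>Shift one coordinate at a time; each shift costs the end terms of \<open>K\<close>
  intervals. The bound is linear in \<open>K\<close> against \<open>K^2\<close> points, so box
  averages are asymptotically invariant.\<close>

lemma abs_sum_grid_shift:
  fixes G :: "int \<times> int \<Rightarrow> real"
  assumes G: "\<And>j. \<bar>G j\<bar> \<le> C"
  shows "\<bar>(\<Sum>j\<in>grid K. G (j + e)) - (\<Sum>j\<in>grid K. G j)\<bar>
    \<le> 2 * C * real K * real_of_int (\<bar>fst e\<bar> + \<bar>snd e\<bar>)"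
proof -
  let ?I = "{0..<int K}"
  obtain e1 e2 where e: "e = (e1, e2)" by (cases e)
  have "\<bar>(\<Sum>x\<in>?I. \<Sum>y\<in>?I. G (x + e1, y + e2)) - (\<Sum>x\<in>?I. \<Sum>y\<in>?I. G (x + e1, y))\<bar>
      \<le> (\<Sum>x\<in>?I. 2 * C * \<bar>e2\<bar>)"
    unfolding sum_subtractf[symmetric]
    by (rule order_trans[OF sum_abs])
      (intro sum_mono, unfold sum_subtractf,
       rule abs_sum_interval_shift[of "\<lambda>y. G (_ + e1, y)"], rule G)
  moreover have "\<bar>(\<Sum>y\<in>?I. \<Sum>x\<in>?I. G (x + e1, y)) - (\<Sum>y\<in>?I. \<Sum>x\<in>?I. G (x, y))\<bar>
      \<le> (\<Sum>y\<in>?I. 2 * C * \<bar>e1\<bar>)"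
    unfolding sum_subtractf[symmetric]
    by (rule order_trans[OF sum_abs])
      (intro sum_mono, unfold sum_subtractf,
       rule abs_sum_interval_shift[of "\<lambda>x. G (x, _)"], rule G)
  moreover have "(\<Sum>y\<in>?I. \<Sum>x\<in>?I. G (x + e1, y)) = (\<Sum>x\<in>?I. \<Sum>y\<in>?I. G (x + e1, y))"
    "(\<Sum>y\<in>?I. \<Sum>x\<in>?I. G (x, y)) = (\<Sum>x\<in>?I. \<Sum>y\<in>?I. G (x, y))"
    by (rule sum.swap)+
  moreover have "(\<Sum>j\<in>grid K. G (j + e)) = (\<Sum>x\<in>?I. \<Sum>y\<in>?I. G (x + e1, y + e2))"
    "(\<Sum>j\<in>grid K. G j) = (\<Sum>x\<in>?I. \<Sum>y\<in>?I. G (x, y))"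
    by (auto simp: grid_def sum.cartesian_product e intro!: sum.cong)
  ultimately show ?thesis by (simp add: e algebra_simps)
qed

datatype site = Pt "int \<times> int" | Ln nat nat int

text \<open>Countability lets the finite patterns of sites be enumerated in \<open>pat\<close> and
  weighted by a convergent series.\<close>

instance site :: countable by countable_datatype

text \<open>A configuration is a set of sites. Besides the points of the plane there are lines:
  \<^term>\<open>Ln k j i\<close> carries the bit number \<open>j\<close> attached to the line where the \<open>k\<close>-th of the
  coordinates \<open>x\<close>, \<open>y\<close>, \<open>- x - y\<close> equals \<open>i\<close>.\<close>

fun co :: "nat \<Rightarrow> int \<times> int \<Rightarrow> int" where
  "co k (x, y) = (if k = 0 then x else if k = 1 then y else - x - y)"

fun sh :: "int \<times> int \<Rightarrow> site \<Rightarrow> site" where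
  "sh e (Pt v) = Pt (v + e)"
| "sh e (Ln k j i) = Ln k j (i + co k e)"

text \<open>Points have level 0 and bit \<open>j\<close> has level \<open>Suc j\<close>. Hence
  functions of level \<open>m\<close> see exactly the bits numbered below \<open>m\<close>, level 0
  is the original system, and bit \<open>m\<close> is the next one free to be added.\<close>

fun lev :: "site \<Rightarrow> nat" where
  "lev (Pt v) = 0"
| "lev (Ln k j i) = Suc j"

definition tau :: "int \<times> int \<Rightarrow> site set \<Rightarrow> site set" where
  "tau e \<omega> = {s. sh e s \<in> \<omega>}"

lemma co_add [simp]: "co k (e + e') = co k e + co k e'"
  by (cases e; cases e') auto

lemma co_zero [simp]: "co k 0 = 0"
  by (simp add: zero_prod_def)

lemma sh_sh: "sh e (sh e' s) = sh (e + e') s"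
  by (cases s) (auto simp: algebra_simps)

lemma sh_zero [simp]: "sh 0 s = s"
  by (cases s) auto

lemma lev_sh [simp]: "lev (sh e s) = lev s"
  by (cases s) auto

lemma mem_tau [simp]: "s \<in> tau e \<omega> \<longleftrightarrow> sh e s \<in> \<omega>"
  by (simp add: tau_def)

lemma tau_tau [simp]: "tau e (tau e' \<omega>) = tau (e + e') \<omega>"
  by (auto simp: sh_sh add.commute)

lemma tau_zero [simp]: "tau 0 \<omega> = \<omega>"
  by auto

section \<open>Cylinder functions\<close>

definition cyl :: "nat \<Rightarrow> (site set \<Rightarrow> 'b) \<Rightarrow> bool" where
  "cyl m f \<longleftrightarrow> (\<exists>D. finite D \<and> (\<forall>s\<in>D. lev s \<le> m) \<and> (\<forall>\<omega>. f \<omega> = f (\<omega> \<inter> D)))"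

lemma cylI: "finite D \<Longrightarrow> (\<And>s. s \<in> D \<Longrightarrow> lev s \<le> m) \<Longrightarrow> (\<And>\<omega>. f \<omega> = f (\<omega> \<inter> D)) \<Longrightarrow> cyl m f"
  unfolding cyl_def by blast

lemma cylE:
  assumes "cyl m f"
  obtains D where "finite D" "\<And>s. s \<in> D \<Longrightarrow> lev s \<le> m" "\<And>\<omega>. f \<omega> = f (\<omega> \<inter> D)"
  using assms unfolding cyl_def by blast

lemma cylE_superset:
  assumes "cyl m f"
  obtains D where "finite D" "\<And>s. s \<in> D \<Longrightarrow> lev s \<le> m" "\<And>\<omega> D'. D \<subseteq> D' \<Longrightarrow> f (\<omega> \<inter> D') = f \<omega>"
proof -
  obtain D where D: "finite D" "\<And>s. s \<in> D \<Longrightarrow> lev s \<le> m" "\<And>\<omega>. f \<omega> = f (\<omega> \<inter> D)"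
    using assms by (rule cylE) blast
  have "f (\<omega> \<inter> D') = f \<omega>" if "D \<subseteq> D'" for \<omega> D'
    using D(3)[of "\<omega> \<inter> D'"] D(3)[of \<omega>] that by (simp add: inf_assoc inf_absorb2)
  then show thesis using that[OF D(1,2)] by simp
qed

lemma cyl_mono: "cyl m f \<Longrightarrow> m \<le> n \<Longrightarrow> cyl n f"
  unfolding cyl_def by (meson order_trans)

lemma cyl_const [simp, intro]: "cyl m (\<lambda>_. c)"
  by (rule cylI[of "{}"]) auto

lemma cyl_mem [intro]: "lev s \<le> m \<Longrightarrow> cyl m (\<lambda>\<omega>. s \<in> \<omega>)"
  by (rule cylI[of "{s}"]) auto

lemma cyl_comp: "cyl m f \<Longrightarrow> cyl m (\<lambda>\<omega>. h (f \<omega>))"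
  unfolding cyl_def by metis

lemma cyl_comp2:
  assumes "cyl m f" "cyl m g"
  shows "cyl m (\<lambda>\<omega>. h (f \<omega>) (g \<omega>))"
proof -
  obtain D where D: "finite D" "\<And>s. s \<in> D \<Longrightarrow> lev s \<le> m" "\<And>\<omega> D'. D \<subseteq> D' \<Longrightarrow> f (\<omega> \<inter> D') = f \<omega>"
    using assms(1) by (rule cylE_superset) blast
  obtain E where E: "finite E" "\<And>s. s \<in> E \<Longrightarrow> lev s \<le> m" "\<And>\<omega> D'. E \<subseteq> D' \<Longrightarrow> g (\<omega> \<inter> D') = g \<omega>"
    using assms(2) by (rule cylE_superset) blast
  show ?thesis
    by (rule cylI[of "D \<union> E"]) (use D E in auto)
qed

lemma cyl_add [intro]: "cyl m f \<Longrightarrow> cyl m g \<Longrightarrow> cyl m (\<lambda>\<omega>. f \<omega> + g \<omega>)"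
  by (rule cyl_comp2)

lemma cyl_mult [intro]: "cyl m f \<Longrightarrow> cyl m g \<Longrightarrow> cyl m (\<lambda>\<omega>. f \<omega> * g \<omega>)"
  by (rule cyl_comp2)

lemma cyl_diff [intro]: "cyl m f \<Longrightarrow> cyl m g \<Longrightarrow> cyl m (\<lambda>\<omega>. f \<omega> - g \<omega>)"
  by (rule cyl_comp2)

lemma cyl_power [intro]: "cyl m f \<Longrightarrow> cyl m (\<lambda>\<omega>. f \<omega> ^ n)"
  by (rule cyl_comp)

lemma cyl_divide [intro]: "cyl m f \<Longrightarrow> cyl m (\<lambda>\<omega>. f \<omega> / c)"
  by (rule cyl_comp)

lemma cyl_of_bool [intro]: "cyl m P \<Longrightarrow> cyl m (\<lambda>\<omega>. of_bool (P \<omega>))"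
  by (rule cyl_comp)

lemma cyl_eq [intro]: "cyl m f \<Longrightarrow> cyl m g \<Longrightarrow> cyl m (\<lambda>\<omega>. f \<omega> = g \<omega>)"
  by (rule cyl_comp2)

lemma cyl_tau:
  assumes "cyl m f"
  shows "cyl m (\<lambda>\<omega>. f (tau e \<omega>))"
proof -
  obtain D where D: "finite D" "\<And>s. s \<in> D \<Longrightarrow> lev s \<le> m" "\<And>\<omega>. f \<omega> = f (\<omega> \<inter> D)"
    using assms by (rule cylE) blast
  show ?thesis
  proof (rule cylI[of "sh e ` D"])
    fix \<omega>
    have "tau e \<omega> \<inter> D = tau e (\<omega> \<inter> sh e ` D) \<inter> D" by auto
    then show "f (tau e \<omega>) = f (tau e (\<omega> \<inter> sh e ` D))" by (metis D(3))
  qed (use D in auto)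
qed

lemma cyl_expand:
  assumes "finite D" "\<And>\<omega>. f \<omega> = f (\<omega> \<inter> D)"
  shows "f \<omega> = (\<Sum>\<sigma>\<in>Pow D. f \<sigma> * of_bool (\<omega> \<inter> D = \<sigma>) :: real)"
proof -
  have "(\<Sum>\<sigma>\<in>Pow D. f \<sigma> * of_bool (\<omega> \<inter> D = \<sigma>)) = (\<Sum>\<sigma>\<in>Pow D. if \<omega> \<inter> D = \<sigma> then f \<sigma> else 0)"
    by (rule sum.cong) auto
  then show ?thesis using assms by (simp add: sum.delta)
qed

lemma cyl_bddf [intro]:
  assumes "cyl m f"
  shows "bddf f"
proof -
  obtain D where D: "finite D" "\<And>\<omega>. f \<omega> = f (\<omega> \<inter> D)"
    using assms by (rule cylE) blast
  have "\<bar>f \<omega>\<bar> \<le> (\<Sum>\<sigma>\<in>Pow D. \<bar>f \<sigma>\<bar>)" for \<omega>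
    unfolding D(2)[of \<omega>] using D(1) by (intro member_le_sum[where f = "\<lambda>\<sigma>. \<bar>f \<sigma>\<bar>"]) auto
  then show ?thesis by (rule bddfI)
qed

text \<open>Read as: \<theta> is an extension of \<psi>. All systems live on the same configuration
  space, and the bits beyond level \<open>m\<close> may be filled in anew, so restriction to low
  levels takes the place of a factor map.\<close>

definition agree :: "nat \<Rightarrow> ((site set \<Rightarrow> real) \<Rightarrow> real) \<Rightarrow> ((site set \<Rightarrow> real) \<Rightarrow> real) \<Rightarrow> bool" where
  "agree m \<psi> \<theta> \<longleftrightarrow> (\<forall>f. cyl m f \<longrightarrow> \<psi> f = \<theta> f)"

definition imean :: "((site set \<Rightarrow> real) \<Rightarrow> real) \<Rightarrow> bool" where
  "imean \<psi> \<longleftrightarrow> mean \<psi> \<and> (\<forall>e f. bddf f \<longrightarrow> \<psi> (\<lambda>\<omega>. f (tau e \<omega>)) = \<psi> f)"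

text \<open>The conclusion of the mean ergodic theorem serves as the definition, since invariant
  sets are in general not cylinder sets and only cylinder functions are under control. Uniformity
  over the position \<open>s\<close> of the box is what later bounds second moments of box
  averages.\<close>

definition erg :: "((site set \<Rightarrow> real) \<Rightarrow> real) \<Rightarrow> bool" where
  "erg \<psi> \<longleftrightarrow> (\<forall>m f v \<epsilon>. cyl m f \<longrightarrow> cyl m v \<longrightarrow> \<epsilon> > 0 \<longrightarrow>
     (\<exists>K0>0. \<forall>K\<ge>K0. \<forall>s.
        \<bar>(\<Sum>j\<in>grid K. \<psi> (\<lambda>\<omega>. f \<omega> * v (tau (s + j) \<omega>))) / (real K)\<^sup>2 - \<psi> f * \<psi> v\<bar> \<le> \<epsilon>))"

lemma ergD:
  assumes "erg \<psi>" "cyl m f" "cyl m v" "\<epsilon> > 0"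
  obtains K0 where "K0 > 0" "\<And>K s. K \<ge> K0 \<Longrightarrow>
    \<bar>(\<Sum>j\<in>grid K. \<psi> (\<lambda>\<omega>. f \<omega> * v (tau (s + j) \<omega>))) / (real K)\<^sup>2 - \<psi> f * \<psi> v\<bar> \<le> \<epsilon>"
proof -
  have "\<exists>K0>0. \<forall>K\<ge>K0. \<forall>s.
    \<bar>(\<Sum>j\<in>grid K. \<psi> (\<lambda>\<omega>. f \<omega> * v (tau (s + j) \<omega>))) / (real K)\<^sup>2 - \<psi> f * \<psi> v\<bar> \<le> \<epsilon>"
    by (rule assms(1)[unfolded erg_def, rule_format, OF assms(2-4)])
  then show thesis by (elim exE conjE) (rule that, auto)
qed

lemma not_ergE:
  assumes "\<not> erg \<psi>"
  obtains m f v \<epsilon> where "cyl m f" "cyl m v" "\<epsilon> > 0" "\<And>K0. K0 > 0 \<Longrightarrow> \<exists>K\<ge>K0. \<exists>s.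
    \<bar>(\<Sum>j\<in>grid K. \<psi> (\<lambda>\<omega>. f \<omega> * v (tau (s + j) \<omega>))) / (real K)\<^sup>2 - \<psi> f * \<psi> v\<bar> > \<epsilon>"
proof (rule ccontr)
  assume c: "\<not> thesis"
  have "erg \<psi>"
    unfolding erg_def
  proof (intro allI impI, rule ccontr)
    fix m f v and \<epsilon> :: real
    assume a: "cyl m f" "cyl m v" "\<epsilon> > 0"
      and n: "\<not> (\<exists>K0>0. \<forall>K\<ge>K0. \<forall>s.
        \<bar>(\<Sum>j\<in>grid K. \<psi> (\<lambda>\<omega>. f \<omega> * v (tau (s + j) \<omega>))) / (real K)\<^sup>2 - \<psi> f * \<psi> v\<bar> \<le> \<epsilon>)"
    have thesis
      using that[OF a] n unfolding not_le[symmetric] by meson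
    then show False using c by simp
  qed
  then show False using assms by simp
qed

lemma imean_mean [simp]: "imean \<psi> \<Longrightarrow> mean \<psi>"
  by (simp add: imean_def)

lemma imean_tau: "imean \<psi> \<Longrightarrow> bddf f \<Longrightarrow> \<psi> (\<lambda>\<omega>. f (tau e \<omega>)) = \<psi> f"
  unfolding imean_def by blast

lemma agree_refl [simp]: "agree m \<psi> \<psi>"
  by (simp add: agree_def)

lemma agreeD: "agree m \<psi> \<theta> \<Longrightarrow> cyl m f \<Longrightarrow> \<psi> f = \<theta> f"
  by (simp add: agree_def)

lemma agree_trans: "agree m \<psi> \<theta> \<Longrightarrow> agree n \<theta> \<phi> \<Longrightarrow> m \<le> n \<Longrightarrow> agree m \<psi> \<phi>"
  unfolding agree_def using cyl_mono by metis

lemma bddf_tau: "bddf f \<Longrightarrow> bddf (\<lambda>\<omega>. f (tau e \<omega>))"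
  by (auto simp: bddf_def)

text \<open>Box averages of translates are invariant only up to boundary terms. The limit removes
  them, since convergence to 0 along \<open>sequentially\<close> persists along the finer filter
  \<open>F\<close>.\<close>

lemma imean_cluster:
  assumes m: "\<And>n. mean (\<psi> n)"
    and inv: "\<And>f e. bddf f \<Longrightarrow> (\<lambda>n. \<psi> n (\<lambda>\<omega>. f (tau e \<omega>)) - \<psi> n f) \<longlonglongrightarrow> 0"
  obtains F \<phi> where "F \<noteq> bot" "F \<le> sequentially" "imean \<phi>"
    "\<And>f. bddf f \<Longrightarrow> ((\<lambda>n. \<psi> n f) \<longlongrightarrow> \<phi> f) F"
proof -
  obtain F \<phi> where F: "F \<noteq> bot" "F \<le> sequentially" "mean \<phi>"
    and L: "\<And>f. bddf f \<Longrightarrow> ((\<lambda>n. \<psi> n f) \<longlongrightarrow> \<phi> f) F"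
    using mean_cluster[of \<psi>, OF m] by blast
  have "\<phi> (\<lambda>\<omega>. f (tau e \<omega>)) = \<phi> f" if f: "bddf f" for e f
  proof -
    have "((\<lambda>n. \<psi> n (\<lambda>\<omega>. f (tau e \<omega>)) - \<psi> n f) \<longlongrightarrow> \<phi> (\<lambda>\<omega>. f (tau e \<omega>)) - \<phi> f) F"
      by (intro tendsto_diff L bddf_tau[OF f] f)
    moreover have "((\<lambda>n. \<psi> n (\<lambda>\<omega>. f (tau e \<omega>)) - \<psi> n f) \<longlongrightarrow> 0) F"
      by (rule tendsto_mono[OF F(2) inv[OF f]])
    ultimately have "\<phi> (\<lambda>\<omega>. f (tau e \<omega>)) - \<phi> f = 0" by (rule tendsto_unique[OF F(1)])
    then show ?thesis by simp
  qed
  then have "imean \<phi>" using F(3) by (simp add: imean_def)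
  then show thesis by (rule that[OF F(1,2) _ L])
qed

lemma shifted_grid_average_tendsto:
  assumes C: "\<And>i j. \<bar>G i j\<bar> \<le> C"
    and K: "\<And>n. n < K n"
  shows "(\<lambda>n. ((\<Sum>j\<in>grid (K n). G n (j + e)) - (\<Sum>j\<in>grid (K n). G n j)) / (real (K n))\<^sup>2) \<longlonglongrightarrow> (0::real)"
proof (rule Lim_null_comparison)
  let ?c = "2 * C * real_of_int (\<bar>fst e\<bar> + \<bar>snd e\<bar>)"
  have C0: "C \<ge> 0" using C[of 0 0] by linarith
  have "norm (((\<Sum>j\<in>grid (K n). G n (j + e)) - (\<Sum>j\<in>grid (K n). G n j)) / (real (K n))\<^sup>2) \<le> ?c / real (Suc n)" for n
  proof -
    have "norm (((\<Sum>j\<in>grid (K n). G n (j + e)) - (\<Sum>j\<in>grid (K n). G n j)) / (real (K n))\<^sup>2)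
       \<le> (2 * C * real (K n) * real_of_int (\<bar>fst e\<bar> + \<bar>snd e\<bar>)) / (real (K n))\<^sup>2"
      using abs_sum_grid_shift[where G = "G n" and C = C and K = "K n" and e = e] C by (simp add: divide_right_mono)
    also have "\<dots> = ?c / real (K n)" using K[of n] by (simp add: power2_eq_square field_simps)
    also have "\<dots> \<le> ?c / real (Suc n)" using K[of n] C0
      by (intro divide_left_mono) auto
    finally show ?thesis .
  qed
  then show "\<forall>\<^sub>F n in sequentially. norm (((\<Sum>j\<in>grid (K n). G n (j + e)) - (\<Sum>j\<in>grid (K n). G n j)) / (real (K n))\<^sup>2) \<le> ?c / real (Suc n)"
    by simp
  show "(\<lambda>n. ?c / real (Suc n)) \<longlonglongrightarrow> 0"
    using LIMSEQ_inverse_real_of_nat[THEN tendsto_mult_left, of ?c] by (simp add: divide_inverse)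
qed

section \<open>Ergodic refinements\<close>

lemma mean_shift_pair:
  assumes "imean \<theta>" "bddf f" "bddf g"
  shows "\<theta> (\<lambda>\<omega>. f (tau a \<omega>) * g (tau b \<omega>)) = \<theta> (\<lambda>\<omega>. f \<omega> * g (tau (b - a) \<omega>))"
proof -
  have "bddf (\<lambda>\<omega>. f \<omega> * g (tau (b - a) \<omega>))"
    by (intro bddf_mult bddf_tau[OF assms(3)] assms(2))
  then have "\<theta> (\<lambda>\<omega>. f (tau a \<omega>) * g (tau (b - a) (tau a \<omega>))) = \<theta> (\<lambda>\<omega>. f \<omega> * g (tau (b - a) \<omega>))"
    by (rule imean_tau[OF assms(1)])
  then show ?thesis unfolding tau_tau diff_add_cancel .
qed

text \<open>For a fixed \<open>j\<close> the inner average runs over the box shifted by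
  \<open>- j\<close>; the uniformity in \<open>s\<close> of \<open>erg\<close> bounds all these
  inner averages at once.\<close>

lemma erg_grid_average_variance:
  assumes \<psi>: "imean \<psi>" "erg \<psi>" and h: "cyl m h" and "\<epsilon> > 0"
  obtains K0 where "K0 > 0"
    "\<And>K s. K \<ge> K0 \<Longrightarrow> (\<Sum>j\<in>grid K. \<Sum>j'\<in>grid K. \<psi> (\<lambda>\<omega>. h \<omega> * h (tau (j' - j) \<omega>))) / (real K)\<^sup>2 / (real K)\<^sup>2
       \<le> (\<psi> h)\<^sup>2 + \<epsilon>"
proof -
  obtain K0 where K0: "K0 > 0" and *: "\<And>K s. K \<ge> K0 \<Longrightarrow>
      \<bar>(\<Sum>j\<in>grid K. \<psi> (\<lambda>\<omega>. h \<omega> * h (tau (s + j) \<omega>))) / (real K)\<^sup>2 - \<psi> h * \<psi> h\<bar> \<le> \<epsilon>"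
    by (rule ergD[OF \<psi>(2) h h \<open>\<epsilon> > 0\<close>]) blast
  have "(\<Sum>j\<in>grid K. \<Sum>j'\<in>grid K. \<psi> (\<lambda>\<omega>. h \<omega> * h (tau (j' - j) \<omega>))) / (real K)\<^sup>2 / (real K)\<^sup>2
       \<le> (\<psi> h)\<^sup>2 + \<epsilon>" if K: "K \<ge> K0" for K
  proof -
    have Kp: "real K > 0" using K K0 by simp
    have "(\<Sum>j'\<in>grid K. \<psi> (\<lambda>\<omega>. h \<omega> * h (tau (j' - j) \<omega>))) / (real K)\<^sup>2 \<le> (\<psi> h)\<^sup>2 + \<epsilon>" for j
      using *[OF K, of "- j"] by (simp add: power2_eq_square)
    then have "(\<Sum>j\<in>grid K. (\<Sum>j'\<in>grid K. \<psi> (\<lambda>\<omega>. h \<omega> * h (tau (j' - j) \<omega>))) / (real K)\<^sup>2)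
        \<le> (\<Sum>j\<in>grid K. (\<psi> h)\<^sup>2 + \<epsilon>)"
      by (intro sum_mono)
    also have "\<dots> = (real K)\<^sup>2 * ((\<psi> h)\<^sup>2 + \<epsilon>)" by simp
    finally show ?thesis
      unfolding sum_divide_distrib[symmetric] using Kp by (simp add: divide_le_eq mult.commute)
  qed
  then show thesis using that[OF K0] by simp
qed

lemma mean_square_average_minus_const:
  assumes m: "mean \<psi>" and "finite I" "I \<noteq> {}" and f: "\<And>i. i \<in> I \<Longrightarrow> bddf (f i)"
    and c: "\<And>i. i \<in> I \<Longrightarrow> \<psi> (f i) = c"
  shows "\<psi> (\<lambda>\<omega>. ((\<Sum>i\<in>I. f i \<omega>) / card I - c)\<^sup>2)
    = (\<Sum>i\<in>I. \<Sum>j\<in>I. \<psi> (\<lambda>\<omega>. f i \<omega> * f j \<omega>)) / card I / card I - c\<^sup>2"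
proof -
  let ?n = "real (card I)"
  have n: "?n > 0" using assms by (simp add: card_gt_0_iff)
  have b: "bddf (\<lambda>\<omega>. \<Sum>i\<in>I. f i \<omega>)" using f by auto
  have eq: "(\<lambda>\<omega>. ((\<Sum>i\<in>I. f i \<omega>) / ?n - c)\<^sup>2)
     = (\<lambda>\<omega>. ((\<Sum>i\<in>I. \<Sum>j\<in>I. f i \<omega> * f j \<omega>) / ?n / ?n + c\<^sup>2) - (2 * c / ?n) * (\<Sum>i\<in>I. f i \<omega>))"
  proof
    fix \<omega>
    have "(S / ?n - c)\<^sup>2 = (S * S / ?n / ?n + c\<^sup>2) - (2 * c / ?n) * S" for S
      using n by (simp add: power2_eq_square field_simps)
    then show "((\<Sum>i\<in>I. f i \<omega>) / ?n - c)\<^sup>2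
       = ((\<Sum>i\<in>I. \<Sum>j\<in>I. f i \<omega> * f j \<omega>) / ?n / ?n + c\<^sup>2) - (2 * c / ?n) * (\<Sum>i\<in>I. f i \<omega>)"
      by (simp only: sum_product)
  qed
  have "\<psi> (\<lambda>\<omega>. ((\<Sum>i\<in>I. f i \<omega>) / ?n - c)\<^sup>2) = (\<Sum>i\<in>I. \<Sum>j\<in>I. \<psi> (\<lambda>\<omega>. f i \<omega> * f j \<omega>)) / ?n / ?n + c\<^sup>2 - (2 * c / ?n) * (\<Sum>i\<in>I. \<psi> (f i))"
    unfolding eq using f by (simp add: m bddf_simps mean_diff[OF m] mean_add[OF m] mean_cmult[OF m] mean_divide[OF m]
        mean_sum[OF m] del: divide_divide_eq_left times_divide_eq_left times_divide_eq_right)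
  also have "(\<Sum>i\<in>I. \<psi> (f i)) = ?n * c" using c by simp
  finally show ?thesis using n by (simp add: power2_eq_square)
qed

text \<open>If the box averages of \<open>v\<close> had a nontrivial limit correlation, reweighting by
  \<open>1 \<plusminus> (average of v - mean)/2\<close> and passing to a limit would exhibit \<open>\<theta>\<close> as a nontrivial
  midpoint. Old cylinder functions do not notice the weights because \<open>\<psi>\<close> is ergodic.\<close>

lemma erg_of_extremal:
  assumes \<psi>: "imean \<psi>" "erg \<psi>" and \<theta>: "imean \<theta>" and ag: "agree m \<psi> \<theta>"
    and ext: "\<And>\<theta>' n f. imean \<theta>' \<Longrightarrow> agree m \<psi> \<theta>' \<Longrightarrow> imean (\<lambda>f. 2 * \<theta> f - \<theta>' f) \<Longrightarrow>
      agree m \<psi> (\<lambda>f. 2 * \<theta> f - \<theta>' f) \<Longrightarrow> cyl n f \<Longrightarrow> \<theta>' f = \<theta> f"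
  shows "erg \<theta>"
proof (rule ccontr)
  note M = imean_mean[OF \<theta>]
  assume "\<not> erg \<theta>"
  then obtain n f v0 \<epsilon>0 where f: "cyl n f" and v0: "cyl n v0" and "\<epsilon>0 > 0"
    and bad: "\<And>K0. K0 > 0 \<Longrightarrow> \<exists>K\<ge>K0. \<exists>s.
        \<bar>(\<Sum>j\<in>grid K. \<theta> (\<lambda>\<omega>. f \<omega> * v0 (tau (s + j) \<omega>))) / (real K)\<^sup>2 - \<theta> f * \<theta> v0\<bar> > \<epsilon>0"
    by (rule not_ergE) blast
  obtain C where C: "C > 0" "\<And>\<omega>. \<bar>v0 \<omega>\<bar> \<le> C" using bddfE[OF cyl_bddf[OF v0]] by blast
  \<comment> \<open>Normalised so that the centred box averages \<open>c k\<close> are bounded by 2,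
    which makes both densities \<open>1 + c k / 2\<close> and \<open>1 - c k / 2\<close>
    nonnegative.\<close>
  define v where "v \<omega> = v0 \<omega> / C" for \<omega>
  define \<epsilon> where "\<epsilon> = \<epsilon>0 / C"
  have \<epsilon>: "\<epsilon> > 0" using C \<open>\<epsilon>0 > 0\<close> by (simp add: \<epsilon>_def)
  have v: "cyl n v" unfolding v_def using v0 by (rule cyl_divide)
  have v1: "\<bar>v \<omega>\<bar> \<le> 1" for \<omega> using C(1) C(2)[of \<omega>] by (simp add: v_def)
  have bv: "bddf v" and bf: "bddf f" using v f by auto
  define B where "B K s \<longleftrightarrow> \<bar>(\<Sum>j\<in>grid K. \<theta> (\<lambda>\<omega>. f \<omega> * v (tau (s + j) \<omega>))) / (real K)\<^sup>2 - \<theta> f * \<theta> v\<bar> > \<epsilon>" for K s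
  have ex: "\<exists>K. Suc k \<le> K \<and> (\<exists>s. B K s)" for k
  proof -
    obtain K s where K: "K \<ge> Suc k"
      and *: "\<bar>(\<Sum>j\<in>grid K. \<theta> (\<lambda>\<omega>. f \<omega> * v0 (tau (s + j) \<omega>))) / (real K)\<^sup>2 - \<theta> f * \<theta> v0\<bar> > \<epsilon>0"
      using bad[of "Suc k"] by blast
    have b0: "bddf v0" using v0 by auto
    have "\<theta> (\<lambda>\<omega>. f \<omega> * v (tau (s + j) \<omega>)) = \<theta> (\<lambda>\<omega>. f \<omega> * v0 (tau (s + j) \<omega>)) / C" for j
      unfolding v_def times_divide_eq_right by (intro mean_divide[OF M] bddf_mult bddf_tau[OF b0] bf)
    moreover have "\<theta> v = \<theta> v0 / C" unfolding v_def by (rule mean_divide[OF M b0])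
    ultimately have "(\<Sum>j\<in>grid K. \<theta> (\<lambda>\<omega>. f \<omega> * v (tau (s + j) \<omega>))) / (real K)\<^sup>2 - \<theta> f * \<theta> v
       = ((\<Sum>j\<in>grid K. \<theta> (\<lambda>\<omega>. f \<omega> * v0 (tau (s + j) \<omega>))) / (real K)\<^sup>2 - \<theta> f * \<theta> v0) / C"
      by (simp add: sum_divide_distrib[symmetric] diff_divide_distrib)
    then have "B K s"
      unfolding B_def using * C(1) by (simp add: \<epsilon>_def divide_strict_right_mono)
    then show ?thesis using K by blast
  qed
  obtain K where K: "\<And>k. Suc k \<le> K k" and "\<And>k. \<exists>s. B (K k) s"
    using choice[of "\<lambda>k K. Suc k \<le> K \<and> (\<exists>s. B K s)"] ex by blast
  then obtain s where bad: "\<And>k. B (K k) (s k)"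
    using choice[of "\<lambda>k. B (K k)"] by blast
  have Kp: "real (K k) > 0" for k using K[of k] by simp
  define c where "c k \<omega> = (\<Sum>j\<in>grid (K k). v (tau (s k + j) \<omega>)) / (real (K k))\<^sup>2 - \<theta> v" for k \<omega>
  have c2: "\<bar>c k \<omega>\<bar> \<le> 2" for k \<omega>
  proof -
    have "\<bar>\<Sum>j\<in>grid (K k). v (tau (s k + j) \<omega>)\<bar> \<le> (\<Sum>j\<in>grid (K k). 1)"
      by (rule order_trans[OF sum_abs]) (intro sum_mono v1)
    then have "\<bar>(\<Sum>j\<in>grid (K k). v (tau (s k + j) \<omega>)) / (real (K k))\<^sup>2\<bar> \<le> 1"
      using Kp[of k] by (simp add: divide_le_eq)
    moreover have "\<bar>\<theta> v\<bar> \<le> 1" by (rule mean_bound[OF M v1])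
    ultimately show ?thesis unfolding c_def by linarith
  qed
  have bc: "bddf (c k)" for k using c2 by (rule bddfI)
  have \<theta>c: "\<theta> (\<lambda>\<omega>. h \<omega> * c k \<omega>) = (\<Sum>j\<in>grid (K k). \<theta> (\<lambda>\<omega>. h \<omega> * v (tau (s k + j) \<omega>))) / (real (K k))\<^sup>2 - \<theta> h * \<theta> v"
    if h: "bddf h" for h k
  proof -
    have eq: "(\<lambda>\<omega>. h \<omega> * c k \<omega>) = (\<lambda>\<omega>. (\<Sum>j\<in>grid (K k). h \<omega> * v (tau (s k + j) \<omega>)) / (real (K k))\<^sup>2 - h \<omega> * \<theta> v)"
      by (simp add: c_def sum_distrib_left right_diff_distrib)
    show ?thesis
      unfolding eq using h bv by (simp add: bddf_simps bddf_tau[OF bv] mean_diff[OF M] mean_divide[OF M] mean_sum[OF M] mean_multc[OF M])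
  qed
  have c0: "\<theta> (c k) = 0" for k
    using \<theta>c[of "\<lambda>_. 1" k] M bv Kp[of k] by (simp add: imean_tau[OF \<theta>])
  define \<Theta> where "\<Theta> k h = \<theta> (\<lambda>\<omega>. h \<omega> * (1 + c k \<omega> / 2))" for k and h :: "site set \<Rightarrow> real"
  have \<Theta>_eq: "\<Theta> k h = \<theta> h + \<theta> (\<lambda>\<omega>. h \<omega> * c k \<omega>) / 2" if "bddf h" for k h
    unfolding \<Theta>_def using that bc
    by (simp add: distrib_left mean_add[OF M] mean_divide[OF M] bddf_mult bddf_divide)
  \<comment> \<open>This domination survives the limit and makes
    \<open>2 * \<theta> f - \<theta>' f\<close> a positive functional of \<open>f\<close>.\<close>
  have \<Theta>_le: "\<Theta> k h \<le> 2 * \<theta> h" if "bddf h" "\<And>\<omega>. 0 \<le> h \<omega>" for k h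
  proof -
    have "0 \<le> \<theta> (\<lambda>\<omega>. h \<omega> * (1 - c k \<omega> / 2))"
      using that bc c2[of k] by (intro mean_nonneg[OF M] mult_nonneg_nonneg bddf_mult bddf_diff bddf_divide)
        (auto simp: abs_le_iff)
    also have "\<dots> = \<theta> h - \<theta> (\<lambda>\<omega>. h \<omega> * c k \<omega>) / 2"
      using that bc by (simp add: right_diff_distrib mean_diff[OF M] mean_divide[OF M] bddf_mult bddf_divide)
    finally show ?thesis using \<Theta>_eq[OF that(1)] by simp
  qed
  have \<Theta>_mean: "mean (\<Theta> k)" for k
    unfolding \<Theta>_def
  proof (rule mean_reweight[OF M])
    show "bddf (\<lambda>\<omega>. 1 + c k \<omega> / 2)" by (intro bddf_add bddf_const bddf_divide bc)
    show "0 \<le> 1 + c k \<omega> / 2" for \<omega> using c2[of k \<omega>] by (simp add: abs_le_iff)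
    show "\<theta> (\<lambda>\<omega>. 1 + c k \<omega> / 2) = 1"
      using bc c0 M by (simp add: mean_add[OF M] mean_divide[OF M] bddf_divide)
  qed
  have \<Theta>_inv: "(\<lambda>k. \<Theta> k (\<lambda>\<omega>. h (tau e \<omega>)) - \<Theta> k h) \<longlonglongrightarrow> 0" if h: "bddf h" for h e
  proof -
    define G where "G k j = \<theta> (\<lambda>\<omega>. h \<omega> * v (tau (s k + j) \<omega>))" for k j
    obtain H where H: "\<And>\<omega>. \<bar>h \<omega>\<bar> \<le> H" using bddfE[OF h] by blast
    have G: "\<bar>G k j\<bar> \<le> H" for k j
      unfolding G_def
    proof (rule mean_bound[OF M])
      show "\<bar>h \<omega> * v (tau (s k + j) \<omega>)\<bar> \<le> H" for \<omega>
        using mult_mono'[OF H[of \<omega>] v1[of "tau (s k + j) \<omega>"]] by (simp add: abs_mult)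
    qed
    have shift: "\<theta> (\<lambda>\<omega>. h (tau e \<omega>) * v (tau (s k + j) \<omega>)) = G k (j + - e)" for k j
      unfolding G_def using mean_shift_pair[OF \<theta> h bv, of e "s k + j"] by (simp add: algebra_simps)
    have "\<Theta> k (\<lambda>\<omega>. h (tau e \<omega>)) - \<Theta> k h
        = ((\<Sum>j\<in>grid (K k). G k (j + - e)) - (\<Sum>j\<in>grid (K k). G k j)) / (real (K k))\<^sup>2 * (1 / 2)" for k
      unfolding \<Theta>_eq[OF h] \<Theta>_eq[OF bddf_tau[OF h]] \<theta>c[OF h] \<theta>c[OF bddf_tau[OF h]] imean_tau[OF \<theta> h] shift
      by (simp add: G_def diff_divide_distrib)
    moreover have "(\<lambda>k. ((\<Sum>j\<in>grid (K k). G k (j + - e)) - (\<Sum>j\<in>grid (K k). G k j)) / (real (K k))\<^sup>2 * (1 / 2)) \<longlonglongrightarrow> 0 * (1 / 2)"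
      using K by (intro tendsto_mult tendsto_const shifted_grid_average_tendsto[of G H K, OF G]) (simp add: Suc_le_lessD)
    ultimately show ?thesis by simp
  qed
  \<comment> \<open>Invariance moves the box average from \<open>v\<close> to \<open>h\<close>, and
    Cauchy-Schwarz discards \<open>v\<close>. The variance of the average of \<open>h\<close>
    involves only functions of level \<open>m\<close>, where \<theta> equals \<psi>, and it is small
    because \<psi> is ergodic.\<close>
  have old: "(\<lambda>k. \<theta> (\<lambda>\<omega>. h \<omega> * c k \<omega>)) \<longlonglongrightarrow> 0" if h: "cyl m h" for h
  proof (rule LIMSEQ_I)
    fix r :: real assume "r > 0"
    have bh: "bddf h" using h by auto
    obtain K0 where K0: "K0 > 0"
      "\<And>K. K \<ge> K0 \<Longrightarrow> (\<Sum>j\<in>grid K. \<Sum>j'\<in>grid K. \<psi> (\<lambda>\<omega>. h \<omega> * h (tau (j' - j) \<omega>))) / (real K)\<^sup>2 / (real K)\<^sup>2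
         \<le> (\<psi> h)\<^sup>2 + (r / 2)\<^sup>2"
      using erg_grid_average_variance[OF \<psi> h, of "(r / 2)\<^sup>2"] \<open>r > 0\<close> by auto
    have "\<bar>\<theta> (\<lambda>\<omega>. h \<omega> * c k \<omega>)\<bar> < r" if "k \<ge> K0" for k
    proof -
      let ?B = "grid (K k)" and ?n = "(real (K k))\<^sup>2"
      define H where "H \<omega> = (\<Sum>j\<in>?B. h (tau (- s k - j) \<omega>)) / ?n - \<theta> h" for \<omega>
      have bH: "bddf H" unfolding H_def by (intro bddf_diff bddf_divide bddf_sum bddf_tau[OF bh] bddf_const)
      have "\<theta> (\<lambda>\<omega>. h \<omega> * v (tau (s k + j) \<omega>)) = \<theta> (\<lambda>\<omega>. h (tau (- s k - j) \<omega>) * v \<omega>)" for j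
        using mean_shift_pair[OF \<theta> bh bv, of "- s k - j" 0] by (simp add: algebra_simps)
      then have "\<theta> (\<lambda>\<omega>. h \<omega> * c k \<omega>) = (\<Sum>j\<in>?B. \<theta> (\<lambda>\<omega>. h (tau (- s k - j) \<omega>) * v \<omega>)) / ?n - \<theta> h * \<theta> v"
        unfolding \<theta>c[OF bh] by simp
      also have "\<dots> = \<theta> (\<lambda>\<omega>. (\<Sum>j\<in>?B. h (tau (- s k - j) \<omega>) * v \<omega>) / ?n - \<theta> h * v \<omega>)"
        using bh bv by (simp add: bddf_simps bddf_tau[OF bh] mean_diff[OF M] mean_divide[OF M] mean_sum[OF M] mean_cmult[OF M])
      also have "(\<lambda>\<omega>. (\<Sum>j\<in>?B. h (tau (- s k - j) \<omega>) * v \<omega>) / ?n - \<theta> h * v \<omega>) = (\<lambda>\<omega>. H \<omega> * v \<omega>)"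
        by (simp add: H_def left_diff_distrib sum_distrib_right)
      finally have "(\<theta> (\<lambda>\<omega>. h \<omega> * c k \<omega>))\<^sup>2 \<le> \<theta> (\<lambda>\<omega>. (H \<omega>)\<^sup>2)"
        using mean_cauchy_schwarz_le_one[OF M bH v1] by simp
      also have "\<dots> = (\<Sum>j\<in>?B. \<Sum>j'\<in>?B. \<theta> (\<lambda>\<omega>. h (tau (- s k - j) \<omega>) * h (tau (- s k - j') \<omega>))) / ?n / ?n - (\<theta> h)\<^sup>2"
        using mean_square_average_minus_const[OF M, of ?B "\<lambda>j \<omega>. h (tau (- s k - j) \<omega>)" "\<theta> h"]
          grid_nonempty[of "K k"] Kp[of k] bh
        by (simp add: H_def imean_tau[OF \<theta> bh] bddf_tau[OF bh])
      also have "(\<Sum>j\<in>?B. \<Sum>j'\<in>?B. \<theta> (\<lambda>\<omega>. h (tau (- s k - j) \<omega>) * h (tau (- s k - j') \<omega>)))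
          = (\<Sum>j\<in>?B. \<Sum>j'\<in>?B. \<theta> (\<lambda>\<omega>. h \<omega> * h (tau (j - j') \<omega>)))"
        using mean_shift_pair[OF \<theta> bh bh] by (simp add: algebra_simps)
      also have "\<dots> = (\<Sum>j\<in>?B. \<Sum>j'\<in>?B. \<psi> (\<lambda>\<omega>. h \<omega> * h (tau (j - j') \<omega>)))"
        by (simp add: agreeD[OF ag] cyl_mult[OF h cyl_tau[OF h]])
      also have "\<dots> = (\<Sum>j\<in>?B. \<Sum>j'\<in>?B. \<psi> (\<lambda>\<omega>. h \<omega> * h (tau (j' - j) \<omega>)))"
        by (rule sum.swap)
      also have "\<dots> / ?n / ?n - (\<theta> h)\<^sup>2 \<le> (r / 2)\<^sup>2"
        using K0(2)[of "K k"] K[of k] \<open>k \<ge> K0\<close> agreeD[OF ag h] by simp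
      finally have "\<bar>\<theta> (\<lambda>\<omega>. h \<omega> * c k \<omega>)\<bar> \<le> r / 2"
        using \<open>r > 0\<close> by (simp add: abs_le_square_iff[symmetric])
      then show ?thesis using \<open>r > 0\<close> by simp
    qed
    then show "\<exists>k0. \<forall>k\<ge>k0. norm (\<theta> (\<lambda>\<omega>. h \<omega> * c k \<omega>) - 0) < r" by auto
  qed
  obtain F \<theta>' where F: "F \<noteq> bot" "F \<le> sequentially" and \<theta>': "imean \<theta>'"
    and L: "\<And>f. bddf f \<Longrightarrow> ((\<lambda>k. \<Theta> k f) \<longlongrightarrow> \<theta>' f) F"
    using imean_cluster[of \<Theta>, OF \<Theta>_mean \<Theta>_inv] by blast
  note M' = imean_mean[OF \<theta>']
  have ag': "agree m \<psi> \<theta>'"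
    unfolding agree_def
  proof (intro allI impI)
    fix h :: "site set \<Rightarrow> real" assume h: "cyl m h"
    have bh: "bddf h" using h by auto
    have "((\<lambda>k. \<theta> h + \<theta> (\<lambda>\<omega>. h \<omega> * c k \<omega>) / 2) \<longlongrightarrow> \<theta> h + 0 / 2) F"
      by (intro tendsto_intros tendsto_mono[OF F(2) old[OF h]]) simp
    then have "((\<lambda>k. \<Theta> k h) \<longlongrightarrow> \<theta> h) F" using bh by (simp add: \<Theta>_eq)
    then have "\<theta>' h = \<theta> h" using L[OF bh] F(1) tendsto_unique by blast
    then show "\<psi> h = \<theta>' h" using agreeD[OF ag h] by simp
  qed
  have "\<theta>' f = \<theta> f"
  proof (rule ext[OF \<theta>' ag' _ _ f])
    show "agree m \<psi> (\<lambda>f. 2 * \<theta> f - \<theta>' f)"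
      using ag ag' by (simp add: agree_def)
    show "imean (\<lambda>f. 2 * \<theta> f - \<theta>' f)"
      unfolding imean_def
    proof (intro conjI allI impI)
      show "mean (\<lambda>f. 2 * \<theta> f - \<theta>' f)"
        unfolding mean_def
      proof (intro conjI allI impI)
        fix h :: "site set \<Rightarrow> real" assume h: "bddf h" "\<forall>x. 0 \<le> h x"
        have "\<theta>' h \<le> 2 * \<theta> h"
          by (rule tendsto_upperbound[OF L[OF h(1)] _ F(1)]) (use \<Theta>_le h in auto)
        then show "0 \<le> 2 * \<theta> h - \<theta>' h" by simp
      qed (use M M' in \<open>simp_all add: mean_add mean_cmult algebra_simps\<close>)
      show "2 * \<theta> (\<lambda>\<omega>. h (tau e \<omega>)) - \<theta>' (\<lambda>\<omega>. h (tau e \<omega>)) = 2 * \<theta> h - \<theta>' h" if "bddf h" for e h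
        using imean_tau[OF \<theta> that] imean_tau[OF \<theta>' that] by simp
    qed
  qed
  \<comment> \<open>Along \<open>F\<close> the correlation of \<open>f\<close> with
    \<open>c k\<close> tends to 0, whereas \<open>bad\<close> keeps its absolute value above
    \<epsilon> for every \<open>k\<close>.\<close>
  then have "((\<lambda>k. \<theta> f + \<theta> (\<lambda>\<omega>. f \<omega> * c k \<omega>) / 2) \<longlongrightarrow> \<theta> f) F"
    using L[OF bf] by (simp add: \<Theta>_eq[OF bf])
  then have "eventually (\<lambda>k. dist (\<theta> f + \<theta> (\<lambda>\<omega>. f \<omega> * c k \<omega>) / 2) (\<theta> f) < \<epsilon> / 2) F"
    using \<epsilon> by (intro tendstoD) auto
  then obtain k where "\<bar>\<theta> (\<lambda>\<omega>. f \<omega> * c k \<omega>)\<bar> < \<epsilon>"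
    using eventually_happens'[OF F(1)] by (fastforce simp: dist_real_def)
  then show False using bad[of k] unfolding B_def by (simp add: \<theta>c[OF bf])
qed

text \<open>The first list is a finite window, the second the pattern seen in it. Every window and
  every pattern occurs for some \<open>i\<close>, so the values at all \<open>pat i\<close>
  determine a mean on cylinder functions.\<close>

definition pat :: "nat \<Rightarrow> site set \<Rightarrow> real" where
  "pat i \<omega> = (case from_nat i of (l :: site list, l' :: site list) \<Rightarrow> of_bool (\<omega> \<inter> set l = set l'))"

lemma pat_le_one: "\<bar>pat i \<omega>\<bar> \<le> 1"
  by (simp add: pat_def split: prod.split)

lemma mean_eq_on_cyl:
  assumes m: "mean \<psi>" "mean \<theta>" and eq: "\<And>i. \<psi> (pat i) = \<theta> (pat i)" and f: "cyl n f"
  shows "\<psi> f = \<theta> f"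
proof -
  obtain D where D: "finite D" "\<And>\<omega>. f \<omega> = f (\<omega> \<inter> D)" using f by (rule cylE) blast
  have F: "f = (\<lambda>\<omega>. \<Sum>\<sigma>\<in>Pow D. f \<sigma> * of_bool (\<omega> \<inter> D = \<sigma>))"
    using cyl_expand[where f = f and D = D, OF D] by blast
  have P: "\<psi> (\<lambda>\<omega>. of_bool (\<omega> \<inter> D = \<sigma>)) = \<theta> (\<lambda>\<omega>. of_bool (\<omega> \<inter> D = \<sigma>))" if \<sigma>: "\<sigma> \<in> Pow D" for \<sigma>
  proof -
    obtain l where l: "set l = D" using finite_list[OF D(1)] by blast
    obtain l' where l': "set l' = \<sigma>" using finite_list[of \<sigma>] finite_subset[OF PowD[OF \<sigma>] D(1)] by blast
    have "pat (to_nat (l, l')) = (\<lambda>\<omega>. of_bool (\<omega> \<inter> D = \<sigma>))"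
      by (rule ext) (simp add: pat_def l l')
    then show ?thesis using eq[of "to_nat (l, l')"] by simp
  qed
  have "\<psi> (\<lambda>\<omega>. \<Sum>\<sigma>\<in>Pow D. f \<sigma> * of_bool (\<omega> \<inter> D = \<sigma>)) = \<theta> (\<lambda>\<omega>. \<Sum>\<sigma>\<in>Pow D. f \<sigma> * of_bool (\<omega> \<inter> D = \<sigma>))"
    using P by (simp add: mean_sum[OF m(1)] mean_sum[OF m(2)] bddf_simps mean_cmult[OF m(1)] mean_cmult[OF m(2)])
  then show ?thesis using F by simp
qed

text \<open>The square supplies strict convexity. The factor bounds the whole series by 1 and its
  tail by \<open>(1/2) ^ n\<close>, uniformly over all means.\<close>

definition pat_weight :: "((site set \<Rightarrow> real) \<Rightarrow> real) \<Rightarrow> nat \<Rightarrow> real" where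
  "pat_weight \<theta> i = (1/2) ^ Suc i * (\<theta> (pat i))\<^sup>2"

lemma pat_weight_nonneg: "0 \<le> pat_weight \<theta> i"
  by (simp add: pat_weight_def)

lemma pat_weight_le: "mean \<theta> \<Longrightarrow> pat_weight \<theta> i \<le> (1/2) ^ Suc i"
  using mean_bound[of \<theta> "pat i" 1, OF _ pat_le_one]
  by (simp add: pat_weight_def abs_square_le_1)

lemma summable_pat_weight: "mean \<theta> \<Longrightarrow> summable (pat_weight \<theta>)"
  by (rule summable_comparison_test'[where g = "\<lambda>i. (1/2) ^ Suc i" and N = 0])
    (use pat_weight_le pat_weight_nonneg in \<open>auto simp: summable_geometric\<close>)

lemma suminf_pat_weight_le:
  assumes "mean \<theta>"
  shows "suminf (pat_weight \<theta>) \<le> (\<Sum>i<n. pat_weight \<theta> i) + (1/2) ^ n"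
proof -
  have s: "summable (\<lambda>i. (1/2::real) ^ Suc (i + n))"
    using summable_geometric[of "1/2 :: real"] by (simp add: power_add summable_mult summable_mult2)
  have "(\<Sum>i. pat_weight \<theta> (i + n)) \<le> (\<Sum>i. (1/2) ^ Suc (i + n))"
    by (intro suminf_le pat_weight_le assms s summable_ignore_initial_segment summable_pat_weight)
  also have "\<dots> = (\<Sum>i. (1/2) ^ n * (1/2) ^ Suc i)"
    by (simp add: power_add mult_ac)
  also have "\<dots> = (1/2) ^ n"
    using power_half_series by (subst suminf_mult) (auto simp: sums_iff)
  finally show ?thesis
    using suminf_split_initial_segment[OF summable_pat_weight[OF assms], of n] by simp
qed

text \<open>A maximiser of the given functional plus a small strictly convex function of the pattern
  probabilities is extremal among the invariant extensions, hence ergodic.\<close>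

lemma ergodic_refinement:
  assumes \<psi>: "imean \<psi>" "erg \<psi>" and \<theta>0: "imean \<theta>0" and ag: "agree m \<psi> \<theta>0"
    and g: "bddf g" and \<eta>: "\<eta> > 0"
  obtains \<theta> where "imean \<theta>" "erg \<theta>" "agree m \<psi> \<theta>" "\<theta> g \<ge> \<theta>0 g - \<eta>"
proof -
  define \<K> where "\<K> = {\<theta>. imean \<theta> \<and> agree m \<psi> \<theta>}"
  \<comment> \<open>The series lies between 0 and 1, so a maximiser of \<open>J\<close> falls short
    of \<open>\<theta>0\<close> at \<open>g\<close> by at most \<eta>; this loss is the price of
    strict convexity.\<close>
  define J where "J \<theta> = \<theta> g + \<eta> * suminf (pat_weight \<theta>)" for \<theta>
  have \<K>m: "mean \<theta>" if "\<theta> \<in> \<K>" for \<theta> using that by (simp add: \<K>_def)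
  have e0: "0 \<le> suminf (pat_weight \<theta>)" if "mean \<theta>" for \<theta>
    by (intro suminf_nonneg summable_pat_weight that pat_weight_nonneg)
  have e1: "suminf (pat_weight \<theta>) \<le> 1" if "mean \<theta>" for \<theta>
    using suminf_pat_weight_le[OF that, of 0] by simp
  obtain C where C: "\<And>\<omega>. \<bar>g \<omega>\<bar> \<le> C" using bddfE[OF g] by blast
  have J_le: "J \<theta> \<le> C + \<eta>" if "\<theta> \<in> \<K>" for \<theta>
  proof -
    have "\<theta> g \<le> C" using mean_bound[OF \<K>m[OF that] C] by (simp add: abs_le_iff)
    moreover have "\<eta> * suminf (pat_weight \<theta>) \<le> \<eta>" using e1[OF \<K>m[OF that]] \<eta> by (simp add: mult_left_le)
    ultimately show ?thesis by (simp add: J_def)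
  qed
  have bdd: "bdd_above (J ` \<K>)" using J_le by (auto intro!: bdd_aboveI[of _ "C + \<eta>"])
  have \<theta>0K: "\<theta>0 \<in> \<K>" using \<theta>0 ag by (simp add: \<K>_def)
  define S where "S = Sup (J ` \<K>)"
  have J_S: "J \<theta> \<le> S" if "\<theta> \<in> \<K>" for \<theta> unfolding S_def using that bdd by (intro cSup_upper) auto
  have "\<exists>\<theta>. \<theta> \<in> \<K> \<and> J \<theta> > S - 1 / real (Suc n)" for n
  proof -
    have "S - 1 / real (Suc n) < Sup (J ` \<K>)" by (simp add: S_def)
    then show ?thesis using less_cSup_iff[OF _ bdd, of "S - 1 / real (Suc n)"] \<theta>0K by auto
  qed
  then obtain \<Theta> where \<Theta>: "\<And>n. \<Theta> n \<in> \<K>" and \<Theta>S: "\<And>n. J (\<Theta> n) > S - 1 / real (Suc n)"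
    using choice[of "\<lambda>n \<theta>. \<theta> \<in> \<K> \<and> J \<theta> > S - 1 / real (Suc n)"] by blast
  have \<Theta>i: "imean (\<Theta> n)" and \<Theta>a: "agree m \<psi> (\<Theta> n)" for n using \<Theta>[of n] by (auto simp: \<K>_def)
  have "(\<lambda>n. \<Theta> n (\<lambda>\<omega>. f (tau e \<omega>)) - \<Theta> n f) \<longlonglongrightarrow> 0" if "bddf f" for f e
    using imean_tau[OF \<Theta>i that] by simp
  then obtain F \<theta> where F: "F \<noteq> bot" "F \<le> sequentially" and \<theta>: "imean \<theta>"
    and L: "\<And>f. bddf f \<Longrightarrow> ((\<lambda>n. \<Theta> n f) \<longlongrightarrow> \<theta> f) F"
    using imean_cluster[of \<Theta>, OF imean_mean[OF \<Theta>i]] by blast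
  note M = imean_mean[OF \<theta>]
  have ag': "agree m \<psi> \<theta>"
    unfolding agree_def
  proof (intro allI impI)
    fix h :: "site set \<Rightarrow> real" assume h: "cyl m h"
    have "((\<lambda>n. \<psi> h) \<longlongrightarrow> \<theta> h) F" using L[OF cyl_bddf[OF h]] by (simp add: agreeD[OF \<Theta>a h, symmetric])
    then show "\<psi> h = \<theta> h" using tendsto_unique[OF F(1)] tendsto_const by blast
  qed
  have \<theta>K: "\<theta> \<in> \<K>" using \<theta> ag' by (simp add: \<K>_def)
  \<comment> \<open>Limits along \<open>F\<close> commute with finite sums of pattern weights; the
    tail beyond \<open>n\<close> is at most \<open>(1/2) ^ n\<close> for every mean, and
    \<open>n\<close> is arbitrary.\<close>
  have "S \<le> J \<theta> + \<eta> * (1/2) ^ n" for n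
  proof -
    have "((\<lambda>k. S - 1 / real (Suc k)) \<longlongrightarrow> S - 0) F"
      by (intro tendsto_intros tendsto_mono[OF F(2)] LIMSEQ_inverse_real_of_nat[unfolded inverse_eq_divide])
    moreover have "((\<lambda>k. \<Theta> k g + \<eta> * ((\<Sum>i<n. pat_weight (\<Theta> k) i) + (1/2) ^ n)) \<longlongrightarrow>
        \<theta> g + \<eta> * ((\<Sum>i<n. pat_weight \<theta> i) + (1/2) ^ n)) F"
      unfolding pat_weight_def
      by (intro tendsto_intros L g bddfI[OF pat_le_one])
    moreover have "S - 1 / real (Suc k) \<le> \<Theta> k g + \<eta> * ((\<Sum>i<n. pat_weight (\<Theta> k) i) + (1/2) ^ n)" for k
    proof -
      have "J (\<Theta> k) \<le> \<Theta> k g + \<eta> * ((\<Sum>i<n. pat_weight (\<Theta> k) i) + (1/2) ^ n)"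
        unfolding J_def using \<eta> suminf_pat_weight_le[OF imean_mean[OF \<Theta>i], of k n] by simp
      then show ?thesis using \<Theta>S[of k] by linarith
    qed
    ultimately have "S - 0 \<le> \<theta> g + \<eta> * ((\<Sum>i<n. pat_weight \<theta> i) + (1/2) ^ n)"
      by (intro tendsto_le[OF F(1)]) (auto intro: always_eventually)
    also have "\<dots> \<le> J \<theta> + \<eta> * (1/2) ^ n"
      unfolding J_def using \<eta> sum_le_suminf[OF summable_pat_weight[OF M], of "{..<n}"] pat_weight_nonneg
      by (simp add: distrib_left)
    finally show ?thesis by simp
  qed
  moreover have "(\<lambda>n. J \<theta> + \<eta> * (1/2) ^ n) \<longlonglongrightarrow> J \<theta> + \<eta> * 0"
    by (intro tendsto_intros LIMSEQ_power_zero) simp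
  ultimately have "S \<le> J \<theta>" by (intro LIMSEQ_le_const) auto
  then have max: "J \<theta>' \<le> J \<theta>" if "\<theta>' \<in> \<K>" for \<theta>' using J_S[OF that] by linarith
  have "erg \<theta>"
  proof (rule erg_of_extremal[OF \<psi> \<theta> ag'])
    fix \<theta>' n and f :: "site set \<Rightarrow> real"
    define \<theta>'' where "\<theta>'' f = 2 * \<theta> f - \<theta>' f" for f
    assume A: "imean \<theta>'" "agree m \<psi> \<theta>'" "imean (\<lambda>f. 2 * \<theta> f - \<theta>' f)" "agree m \<psi> (\<lambda>f. 2 * \<theta> f - \<theta>' f)"
      and f: "cyl n f"
    have \<theta>'': "imean \<theta>''" "agree m \<psi> \<theta>''" using A(3,4) by (simp_all add: \<theta>''_def[abs_def])
    have K: "\<theta>' \<in> \<K>" "\<theta>'' \<in> \<K>" using A \<theta>'' by (simp_all add: \<K>_def)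
    define d where "d i = (1/2) ^ Suc i * (\<theta>' (pat i) - \<theta> (pat i))\<^sup>2" for i
    \<comment> \<open>Parallelogram law, \<theta> being the midpoint of \<open>\<theta>'\<close> and
      \<open>\<theta>''\<close>. Maximality at \<theta> then forces every \<open>d i\<close> to
      vanish.\<close>
    have dw: "pat_weight \<theta>' i + pat_weight \<theta>'' i = 2 * pat_weight \<theta> i + 2 * d i" for i
      by (simp add: pat_weight_def d_def \<theta>''_def power2_eq_square algebra_simps)
    note sm = summable_pat_weight[OF imean_mean[OF A(1)]] summable_pat_weight[OF imean_mean[OF \<theta>''(1)]]
      summable_pat_weight[OF M]
    have d_eq: "d = (\<lambda>i. ((pat_weight \<theta>' i + pat_weight \<theta>'' i) - 2 * pat_weight \<theta> i) / 2)"
      by (rule ext) (simp add: dw)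
    have sd: "summable d"
      unfolding d_eq by (intro summable_divide summable_diff summable_add summable_mult sm)
    have "suminf d = ((suminf (pat_weight \<theta>') + suminf (pat_weight \<theta>'')) - 2 * suminf (pat_weight \<theta>)) / 2"
      unfolding d_eq using sm
      by (simp add: suminf_divide suminf_diff[symmetric] suminf_add[symmetric] suminf_mult summable_diff summable_add summable_mult)
    moreover have "J \<theta>' + J \<theta>'' \<le> 2 * J \<theta>" using max[OF K(1)] max[OF K(2)] by linarith
    then have "\<eta> * (suminf (pat_weight \<theta>') + suminf (pat_weight \<theta>'') - 2 * suminf (pat_weight \<theta>)) \<le> 0"
      unfolding J_def by (simp add: \<theta>''_def algebra_simps)
    ultimately have "suminf d \<le> 0" using \<eta> by (simp add: mult_le_0_iff)
    moreover have d0: "0 \<le> d i" for i by (simp add: d_def)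
    ultimately have "suminf d = 0" using suminf_nonneg[OF sd] by force
    then have "d i = 0" for i using suminf_eq_zero_iff[OF sd d0] by blast
    then have "\<theta>' (pat i) = \<theta> (pat i)" for i by (simp add: d_def)
    then show "\<theta>' f = \<theta> f" by (intro mean_eq_on_cyl[OF _ M _ f] imean_mean A)
  qed
  moreover have "\<theta> g \<ge> \<theta>0 g - \<eta>"
  proof -
    have "\<eta> * suminf (pat_weight \<theta>0) \<ge> 0" "\<eta> * suminf (pat_weight \<theta>) \<le> \<eta>"
      using e0[OF imean_mean[OF \<theta>0]] e1[OF M] \<eta> by (simp_all add: mult_left_le)
    then show ?thesis using max[OF \<theta>0K] unfolding J_def by linarith
  qed
  ultimately show thesis by (intro that[OF \<theta> _ ag'])
qed

section \<open>Triangles, the cut norm and extensions by new lines\<close>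

text \<open>The lines on which the coordinates \<open>x\<close>, \<open>y\<close>, \<open>- x - y\<close> equal \<open>L 0\<close>, \<open>L 1\<close>, \<open>L 2\<close> bound a
  triangle; \<open>vt q L\<close> is its vertex off the line number \<open>q\<close>, and \<open>corner\<close> belongs to the triangle
  with vertices \<open>(- n, 0)\<close>, \<open>(0, - n)\<close>, \<open>(0, 0)\<close>. A corner is thus symmetric in the three
  coordinates, and only \<open>L 0 + L 1 + L 2\<close> matters.\<close>

definition vt :: "nat \<Rightarrow> (nat \<Rightarrow> int) \<Rightarrow> int \<times> int" where
  "vt q L = (if q = 0 then (- L 1 - L 2, L 1) else if q = 1 then (L 0, - L 0 - L 2) else (L 0, L 1))"

definition trip :: "((site set \<Rightarrow> real) \<Rightarrow> real) \<Rightarrow> (nat \<Rightarrow> site set \<Rightarrow> real) \<Rightarrow> (nat \<Rightarrow> int) \<Rightarrow> real" where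
  "trip \<psi> f L = \<psi> (\<lambda>\<omega>. f 0 (tau (vt 0 L) \<omega>) * f 1 (tau (vt 1 L) \<omega>) * f 2 (tau (vt 2 L) \<omega>))"

definition corner :: "((site set \<Rightarrow> real) \<Rightarrow> real) \<Rightarrow> (nat \<Rightarrow> site set \<Rightarrow> real) \<Rightarrow> int \<Rightarrow> real" where
  "corner \<psi> f n = trip \<psi> f (\<lambda>k. if k = 2 then n else 0)"

lemma co_vt: "k < 3 \<Longrightarrow> q < 3 \<Longrightarrow> k \<noteq> q \<Longrightarrow> co k (vt q L) = L k"
  by (auto simp: vt_def less_Suc_eq numeral_3_eq_3 numeral_2_eq_2)

text \<open>Translation by \<open>(L 0, L 1)\<close> moves the three lines by \<open>L 0\<close>,
  \<open>L 1\<close> and \<open>- L 0 - L 1\<close>. It carries the triangle with lines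
  \<open>0, 0, L 0 + L 1 + L 2\<close> to the given one.\<close>

lemma trip_eq_corner:
  assumes \<psi>: "imean \<psi>" and f: "\<And>q. bddf (f q)"
  shows "trip \<psi> f L = corner \<psi> f (L 0 + L 1 + L 2)"
proof -
  define e where "e = (L 0, L 1)"
  let ?L = "\<lambda>k. if k = 2 then L 0 + L 1 + L 2 else 0 :: int"
  have v: "vt 0 L = vt 0 ?L + e" "vt 1 L = vt 1 ?L + e" "vt 2 L = vt 2 ?L + e"
    by (simp_all add: vt_def e_def)
  let ?h = "\<lambda>\<omega>. f 0 (tau (vt 0 ?L) \<omega>) * f 1 (tau (vt 1 ?L) \<omega>) * f 2 (tau (vt 2 ?L) \<omega>)"
  have "bddf ?h"
    by (intro bddf_mult bddf_tau[OF f])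
  then have "\<psi> (\<lambda>\<omega>. ?h (tau e \<omega>)) = \<psi> ?h" by (rule imean_tau[OF \<psi>])
  then show ?thesis unfolding trip_def corner_def v tau_tau .
qed

section \<open>The cut norm on boxes and its Schur multipliers\<close>

definition sg :: "int set \<Rightarrow> int \<Rightarrow> real" where
  "sg U i = (if i \<in> U then 1 else -1)"

lemma abs_sg [simp]: "\<bar>sg U i\<bar> = 1"
  by (simp add: sg_def)

definition bil :: "nat \<Rightarrow> (int \<Rightarrow> int \<Rightarrow> real) \<Rightarrow> (int \<Rightarrow> real) \<Rightarrow> (int \<Rightarrow> real) \<Rightarrow> real" where
  "bil I G u v = (\<Sum>i\<in>{0..<int I}. \<Sum>j\<in>{0..<int I}. G i j * u i * v j)"

text \<open>The norm of an \<open>I\<close> by \<open>I\<close> matrix as an operator from sup norm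
  to sum norm, equivalent to the cut norm up to a constant. Sign vectors are the extreme points of
  the cube, and there are finitely many, so the maximum is attained.\<close>

definition cut :: "nat \<Rightarrow> (int \<Rightarrow> int \<Rightarrow> real) \<Rightarrow> real" where
  "cut I G = Max ((\<lambda>(U, V). bil I G (sg U) (sg V)) ` (Pow {0..<int I} \<times> Pow {0..<int I}))"

lemma cut_attained:
  obtains U V where "U \<subseteq> {0..<int I}" "V \<subseteq> {0..<int I}" "cut I G = bil I G (sg U) (sg V)"
proof -
  have "cut I G \<in> (\<lambda>(U, V). bil I G (sg U) (sg V)) ` (Pow {0..<int I} \<times> Pow {0..<int I})"
    unfolding cut_def by (rule Max_in) auto
  then obtain p where p: "p \<in> Pow {0..<int I} \<times> Pow {0..<int I}"
    and c: "cut I G = (\<lambda>(U, V). bil I G (sg U) (sg V)) p"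
    by blast
  show thesis
    by (rule that[of "fst p" "snd p"]) (use p c in \<open>auto simp: split_def\<close>)
qed

lemma sum_mult_le_sum_sg:
  assumes "\<And>i. \<bar>u i\<bar> \<le> 1"
  shows "(\<Sum>i\<in>{0..<int I}. H i * u i) \<le> (\<Sum>i\<in>{0..<int I}. H i * sg {i \<in> {0..<int I}. H i \<ge> 0} i)"
proof (rule sum_mono)
  fix i assume i: "i \<in> {0..<int I}"
  have "H i * u i \<le> \<bar>H i * u i\<bar>" by simp
  also have "\<dots> \<le> \<bar>H i\<bar> * 1" unfolding abs_mult by (intro mult_left_mono assms) simp
  also have "\<dots> = H i * sg {i \<in> {0..<int I}. H i \<ge> 0} i" using i by (simp add: sg_def)
  finally show "H i * u i \<le> H i * sg {i \<in> {0..<int I}. H i \<ge> 0} i" .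
qed

text \<open>The form is linear in each argument: for a fixed \<open>v\<close> the best
  \<open>u\<close> is the sign vector of its coefficients, and then \<open>v\<close> is replaced in
  the same way.\<close>

lemma bil_le_cut:
  assumes u: "\<And>i. \<bar>u i\<bar> \<le> 1" and v: "\<And>j. \<bar>v j\<bar> \<le> 1"
  shows "bil I G u v \<le> cut I G"
proof -
  let ?I = "{0..<int I}"
  define U where "U = {i \<in> ?I. (\<Sum>j\<in>?I. G i j * v j) \<ge> 0}"
  define V where "V = {j \<in> ?I. (\<Sum>i\<in>?I. G i j * sg U i) \<ge> 0}"
  have "bil I G u v = (\<Sum>i\<in>?I. (\<Sum>j\<in>?I. G i j * v j) * u i)"
    by (simp add: bil_def sum_distrib_left mult_ac)
  also have "\<dots> \<le> (\<Sum>i\<in>?I. (\<Sum>j\<in>?I. G i j * v j) * sg U i)"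
    unfolding U_def by (rule sum_mult_le_sum_sg[OF u])
  also have "\<dots> = (\<Sum>j\<in>?I. (\<Sum>i\<in>?I. G i j * sg U i) * v j)"
    unfolding sum_distrib_right by (subst sum.swap) (simp add: mult_ac)
  also have "\<dots> \<le> (\<Sum>j\<in>?I. (\<Sum>i\<in>?I. G i j * sg U i) * sg V j)"
    unfolding V_def by (rule sum_mult_le_sum_sg[OF v])
  also have "\<dots> = bil I G (sg U) (sg V)"
    unfolding bil_def sum_distrib_right by (rule sum.swap)
  also have "\<dots> \<le> cut I G"
    unfolding cut_def by (rule Max_ge) (auto simp: U_def V_def)
  finally show ?thesis .
qed

lemma bil_uminus: "bil I G (\<lambda>i. - u i) v = - bil I G u v"
  by (simp add: bil_def sum_negf)

lemma abs_bil_le_cut: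
  assumes u: "\<And>i. \<bar>u i\<bar> \<le> 1" and v: "\<And>j. \<bar>v j\<bar> \<le> 1"
  shows "\<bar>bil I G u v\<bar> \<le> cut I G"
  using bil_le_cut[of u v I G] bil_le_cut[of "\<lambda>i. - u i" v I G] u v by (simp add: bil_uminus abs_le_iff)

lemma cut_nonneg: "0 \<le> cut I G"
  using abs_bil_le_cut[of "\<lambda>_. 0" "\<lambda>_. 0" I G] by simp

lemma cut_le:
  assumes "\<And>i j. \<bar>G i j\<bar> \<le> C"
  shows "cut I G \<le> C * (real I)\<^sup>2"
proof -
  obtain U V where "cut I G = bil I G (sg U) (sg V)" by (rule cut_attained)
  also have "\<dots> \<le> (\<Sum>i\<in>{0..<int I}. \<Sum>j\<in>{0..<int I}. C)"
    unfolding bil_def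
  proof (intro sum_mono)
    fix i j
    have "G i j * sg U i * sg V j \<le> \<bar>G i j * sg U i * sg V j\<bar>" by simp
    also have "\<dots> \<le> C" using assms[of i j] by (simp add: abs_mult)
    finally show "G i j * sg U i * sg V j \<le> C" .
  qed
  also have "\<dots> = C * (real I)\<^sup>2" by (simp add: power2_eq_square)
  finally show ?thesis .
qed

text \<open>The weights concentrated on return times have to be removed before the cut norm can be used.
  This is possible because they are Schur multipliers of the cut norm.\<close>

definition schur :: "real \<Rightarrow> (int \<Rightarrow> real) \<Rightarrow> bool" where
  "schur C w \<longleftrightarrow> 0 \<le> C \<and> (\<forall>l I G u v. (\<forall>i. \<bar>u i\<bar> \<le> 1) \<longrightarrow> (\<forall>j. \<bar>v j\<bar> \<le> 1) \<longrightarrow>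
     bil I (\<lambda>i j. G i j * w (i + j + l)) u v \<le> C * cut I G)"

lemma schurI:
  assumes "0 \<le> C"
    and "\<And>l I G u v. (\<And>i. \<bar>u i\<bar> \<le> 1) \<Longrightarrow> (\<And>j. \<bar>v j\<bar> \<le> 1) \<Longrightarrow>
      bil I (\<lambda>i j. G i j * w (i + j + l)) u v \<le> C * cut I G"
  shows "schur C w"
  using assms by (simp add: schur_def)

lemma schurD:
  "schur C w \<Longrightarrow> (\<And>i. \<bar>u i\<bar> \<le> 1) \<Longrightarrow> (\<And>j. \<bar>v j\<bar> \<le> 1) \<Longrightarrow>
    bil I (\<lambda>i j. G i j * w (i + j + l)) u v \<le> C * cut I G"
  by (simp add: schur_def)

lemma schur_nonneg: "schur C w \<Longrightarrow> 0 \<le> C"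
  by (simp add: schur_def)

lemma schur_const: "schur \<bar>c\<bar> (\<lambda>_. c)"
proof (rule schurI)
  fix l :: int and I G and u v :: "int \<Rightarrow> real"
  assume uv: "\<And>i. \<bar>u i\<bar> \<le> 1" "\<And>j. \<bar>v j\<bar> \<le> 1"
  have "bil I (\<lambda>i j. G i j * c) u v = c * bil I G u v"
    by (simp add: bil_def sum_distrib_left mult_ac)
  also have "\<dots> \<le> \<bar>c\<bar> * \<bar>bil I G u v\<bar>" by (metis abs_ge_self abs_mult)
  also have "\<dots> \<le> \<bar>c\<bar> * cut I G" by (intro mult_left_mono abs_bil_le_cut uv) simp
  finally show "bil I (\<lambda>i j. G i j * c) u v \<le> \<bar>c\<bar> * cut I G" .
qed simp

lemma schur_add:
  assumes w: "schur C w" and w': "schur C' w'"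
  shows "schur (C + C') (\<lambda>n. w n + w' n)"
proof (rule schurI)
  fix l :: int and I G and u v :: "int \<Rightarrow> real"
  assume uv: "\<And>i. \<bar>u i\<bar> \<le> 1" "\<And>j. \<bar>v j\<bar> \<le> 1"
  have "bil I (\<lambda>i j. G i j * (w (i + j + l) + w' (i + j + l))) u v
     = bil I (\<lambda>i j. G i j * w (i + j + l)) u v + bil I (\<lambda>i j. G i j * w' (i + j + l)) u v"
    by (simp add: bil_def sum.distrib[symmetric] algebra_simps)
  also have "\<dots> \<le> C * cut I G + C' * cut I G"
    by (intro add_mono schurD[OF w] schurD[OF w'] uv)
  finally show "bil I (\<lambda>i j. G i j * (w (i + j + l) + w' (i + j + l))) u v \<le> (C + C') * cut I G"
    by (simp add: distrib_right)
qed (use schur_nonneg[OF w] schur_nonneg[OF w'] in simp)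

lemma schur_mult:
  assumes w: "schur C w" and w': "schur C' w'"
  shows "schur (C' * C) (\<lambda>n. w n * w' n)"
proof (rule schurI)
  fix l :: int and I G and u v :: "int \<Rightarrow> real"
  assume uv: "\<And>i. \<bar>u i\<bar> \<le> 1" "\<And>j. \<bar>v j\<bar> \<le> 1"
  let ?G = "\<lambda>i j. G i j * w (i + j + l)"
  obtain U V where "cut I ?G = bil I ?G (sg U) (sg V)" by (rule cut_attained)
  also have "\<dots> \<le> C * cut I G" by (rule schurD[OF w]) auto
  finally have *: "cut I ?G \<le> C * cut I G" .
  have "bil I (\<lambda>i j. G i j * (w (i + j + l) * w' (i + j + l))) u v = bil I (\<lambda>i j. ?G i j * w' (i + j + l)) u v"
    by (simp add: mult_ac)
  also have "\<dots> \<le> C' * cut I ?G" by (rule schurD[OF w' uv])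
  also have "\<dots> \<le> C' * (C * cut I G)" by (intro mult_left_mono * schur_nonneg[OF w'])
  finally show "bil I (\<lambda>i j. G i j * (w (i + j + l) * w' (i + j + l))) u v \<le> C' * C * cut I G"
    by (simp add: mult_ac)
qed (use schur_nonneg[OF w] schur_nonneg[OF w'] in simp)

lemma schur_shift:
  assumes w: "schur C w"
  shows "schur C (\<lambda>n. w (h + n))"
proof (rule schurI)
  fix l :: int and I G and u v :: "int \<Rightarrow> real"
  assume uv: "\<And>i. \<bar>u i\<bar> \<le> 1" "\<And>j. \<bar>v j\<bar> \<le> 1"
  show "bil I (\<lambda>i j. G i j * w (h + (i + j + l))) u v \<le> C * cut I G"
    using schurD[OF w uv, of I G "h + l"] by (simp add: add_ac)
qed (rule schur_nonneg[OF w])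

lemma schur_power: "schur C w \<Longrightarrow> \<exists>C'. schur C' (\<lambda>n. w n ^ D)"
proof (induction D)
  case 0
  then show ?case using schur_const[of 1] by auto
next
  case (Suc D)
  then obtain C' where "schur C' (\<lambda>n. w n ^ D)" by blast
  from schur_mult[OF this Suc.prems] show ?case by (auto simp: mult.commute)
qed

lemma schur_sum_list:
  "(\<And>i. i \<in> set xs \<Longrightarrow> \<exists>C. schur C (w i)) \<Longrightarrow> \<exists>C. schur C (\<lambda>n. \<Sum>i\<leftarrow>xs. w i n)"
proof (induction xs)
  case Nil
  then show ?case using schur_const[of 0] by auto
next
  case (Cons x xs)
  obtain C where "schur C (w x)" using Cons.prems by auto
  moreover obtain C' where "schur C' (\<lambda>n. \<Sum>i\<leftarrow>xs. w i n)" using Cons by auto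
  ultimately show ?case using schur_add by fastforce
qed

text \<open>\<open>k1 q\<close> and \<open>k2 q\<close> are the two coordinates other than \<open>q\<close>, and \<open>pos q i j\<close> is the point
  at which they take the values \<open>i\<close> and \<open>j\<close>.\<close>

definition k1 :: "nat \<Rightarrow> nat" where "k1 q = (if q = 0 then 1 else 0)"

definition k2 :: "nat \<Rightarrow> nat" where "k2 q = (if q = 2 then 1 else 2)"

definition pos :: "nat \<Rightarrow> int \<Rightarrow> int \<Rightarrow> int \<times> int" where
  "pos q i j = (if q = 0 then (- i - j, i) else if q = 1 then (i, - i - j) else (i, j))"

lemma less_3_cases: "q < 3 \<Longrightarrow> (q = 0 \<Longrightarrow> P) \<Longrightarrow> (q = 1 \<Longrightarrow> P) \<Longrightarrow> (q = (2::nat) \<Longrightarrow> P) \<Longrightarrow> P"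
  by linarith

lemma co_k1_pos [simp]: "q < 3 \<Longrightarrow> co (k1 q) (pos q i j) = i"
  and co_k2_pos [simp]: "q < 3 \<Longrightarrow> co (k2 q) (pos q i j) = j"
  by (auto simp: k1_def k2_def pos_def elim!: less_3_cases)

lemma pos_add: "q < 3 \<Longrightarrow> pos q (i + co (k1 q) e) (j + co (k2 q) e) = pos q i j + e"
  by (cases e) (auto simp: k1_def k2_def pos_def elim!: less_3_cases)

text \<open>The best correlation of \<open>g\<close>, seen from \<omega>, with a sign for each line
  of type \<open>k1 q\<close> times a sign for each line of type \<open>k2 q\<close>. The optimal
  signs may vary with \<omega>.\<close>

definition cutat :: "nat \<Rightarrow> (site set \<Rightarrow> real) \<Rightarrow> nat \<Rightarrow> site set \<Rightarrow> real" where
  "cutat q g I \<omega> = cut I (\<lambda>i j. g (tau (pos q i j) \<omega>))"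

lemma bddf_cutat:
  assumes "\<And>\<omega>. \<bar>g \<omega>\<bar> \<le> 1"
  shows "bddf (cutat q g I)"
  using cut_nonneg cut_le[of "\<lambda>i j. g (tau (pos q i j) _)" 1 I] assms
  by (intro bddfI[of _ "(real I)\<^sup>2"]) (simp add: cutat_def)

text \<open>An inequality of von Neumann type. Replacing \<open>n\<close> by
  \<open>i + j + n\<close> and averaging over a box costs only boundary terms. With the three lines
  at \<open>i\<close>, \<open>j\<close>, \<open>n\<close>, the vertex \<open>q\<close> sees
  \<open>i\<close> and \<open>j\<close>, while each other vertex sees \<open>n\<close> and only one
  of them; so for fixed \<open>n\<close> the other two factors are admissible in the cut norm, and
  the weight is absorbed by the Schur bound. The estimate is independent of
  \<open>M\<close>.\<close>

lemma abs_sum_corner_le_cut: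
  assumes \<psi>: "imean \<psi>" and f: "\<And>k \<omega>. \<bar>f k \<omega>\<bar> \<le> 1" and q: "q < 3"
    and w: "schur C w" and W: "\<And>n. \<bar>w n\<bar> \<le> W" and I: "I > 0"
  shows "\<bar>\<Sum>n\<in>{M..<M + int N}. w n * corner \<psi> f n\<bar>
    \<le> real N * C * \<psi> (cutat q (f q) I) / (real I)\<^sup>2 + 4 * real I * W"
proof -
  note m = imean_mean[OF \<psi>]
  let ?J = "{M..<M + int N}" and ?I = "{0..<int I}"
  have bf: "bddf (f k)" for k using f by (rule bddfI)
  define L where "L i j n = (\<lambda>k::nat. if k = q then n else if k = k1 q then i else j :: int)" for i j n
  \<comment> \<open>The vertex off the line of type \<open>k2 q\<close> does not depend on
    \<open>j\<close>, so 0 stands in for it; likewise for \<open>i\<close> in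
    \<open>v\<close>.\<close>
  define u where "u n \<omega> i = f (k2 q) (tau (vt (k2 q) (L i 0 n)) \<omega>)" for n \<omega> i
  define v where "v n \<omega> j = f (k1 q) (tau (vt (k1 q) (L 0 j n)) \<omega>)" for n \<omega> j
  define G where "G \<omega> = (\<lambda>i j. f q (tau (pos q i j) \<omega>))" for \<omega>
  \<comment> \<open>The sum to be bounded is \<open>S 0\<close>. It is compared with the average of
    \<open>S (i + j)\<close> over the box, where \<open>i + j\<close> is below \<open>2 * I\<close>;
    this produces the error \<open>4 * real I * W\<close>.\<close>
  define S where "S t = (\<Sum>n\<in>?J. w (n + t) * corner \<psi> f (n + t))" for t
  have uv: "\<bar>u n \<omega> i\<bar> \<le> 1" "\<bar>v n \<omega> j\<bar> \<le> 1" for n \<omega> i j by (simp_all add: u_def v_def f)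
  have W0: "W \<ge> 0" using W[of 0] by linarith
  have corner1: "\<bar>corner \<psi> f n\<bar> \<le> 1" for n
    unfolding corner_def trip_def
  proof (rule mean_bound[OF m])
    fix \<omega>
    show "\<bar>f 0 (tau a \<omega>) * f 1 (tau b \<omega>) * f 2 (tau c \<omega>)\<bar> \<le> 1" for a b c
      using f by (simp add: abs_mult mult_le_one)
  qed
  have wb: "\<bar>w n * corner \<psi> f n\<bar> \<le> W" for n
    using mult_mono'[OF W[of n] corner1[of n]] by (simp add: abs_mult)
  have St: "\<bar>S t - S 0\<bar> \<le> 2 * W * real_of_int \<bar>t\<bar>" for t
    unfolding S_def add_0_right
    by (rule abs_sum_interval_shift[where G = "\<lambda>n. w n * corner \<psi> f n"]) (rule wb)
  have corner_eq: "corner \<psi> f (i + j + n) = \<psi> (\<lambda>\<omega>. G \<omega> i j * u n \<omega> i * v n \<omega> j)" for i j n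
  proof -
    have "corner \<psi> f (i + j + n) = trip \<psi> f (L i j n)"
      unfolding trip_eq_corner[OF \<psi> bf] by (rule less_3_cases[OF q]; simp add: L_def k1_def add_ac)
    also have "\<dots> = \<psi> (\<lambda>\<omega>. G \<omega> i j * u n \<omega> i * v n \<omega> j)"
      by (rule less_3_cases[OF q];
          simp add: trip_def G_def u_def v_def L_def k1_def k2_def vt_def pos_def mult_ac)
    finally show ?thesis .
  qed
  have b: "bddf (\<lambda>\<omega>. G \<omega> i j * u n \<omega> i * v n \<omega> j)" for i j n
    unfolding G_def u_def v_def by (intro bddf_mult bddf_tau[OF bf])
  have sumS: "(\<Sum>i\<in>?I. \<Sum>j\<in>?I. S (i + j)) = (\<Sum>n\<in>?J. \<psi> (\<lambda>\<omega>. bil I (\<lambda>i j. G \<omega> i j * w (i + j + n)) (u n \<omega>) (v n \<omega>)))"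
  proof -
    have "(\<Sum>i\<in>?I. \<Sum>j\<in>?I. S (i + j)) = (\<Sum>n\<in>?J. \<Sum>i\<in>?I. \<Sum>j\<in>?I. w (i + j + n) * corner \<psi> f (i + j + n))"
    proof -
      have "(\<Sum>i\<in>?I. \<Sum>j\<in>?I. S (i + j)) = (\<Sum>i\<in>?I. \<Sum>j\<in>?I. \<Sum>n\<in>?J. w (i + j + n) * corner \<psi> f (i + j + n))"
        unfolding S_def by (simp only: add.commute[of _ "_ + _"])
      also have "\<dots> = (\<Sum>i\<in>?I. \<Sum>n\<in>?J. \<Sum>j\<in>?I. w (i + j + n) * corner \<psi> f (i + j + n))"
        by (intro sum.cong refl sum.swap)
      also have "\<dots> = (\<Sum>n\<in>?J. \<Sum>i\<in>?I. \<Sum>j\<in>?I. w (i + j + n) * corner \<psi> f (i + j + n))"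
        by (rule sum.swap)
      finally show ?thesis .
    qed
    also have "\<dots> = (\<Sum>n\<in>?J. \<psi> (\<lambda>\<omega>. bil I (\<lambda>i j. G \<omega> i j * w (i + j + n)) (u n \<omega>) (v n \<omega>)))"
    proof (rule sum.cong[OF refl])
      fix n
      have "(\<lambda>\<omega>. bil I (\<lambda>i j. G \<omega> i j * w (i + j + n)) (u n \<omega>) (v n \<omega>))
          = (\<lambda>\<omega>. \<Sum>i\<in>?I. \<Sum>j\<in>?I. w (i + j + n) * (G \<omega> i j * u n \<omega> i * v n \<omega> j))"
        by (simp add: bil_def mult_ac)
      then show "(\<Sum>i\<in>?I. \<Sum>j\<in>?I. w (i + j + n) * corner \<psi> f (i + j + n))
        = \<psi> (\<lambda>\<omega>. bil I (\<lambda>i j. G \<omega> i j * w (i + j + n)) (u n \<omega>) (v n \<omega>))"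
        using b by (simp add: mean_sum[OF m] mean_cmult[OF m] corner_eq bddf_simps)
    qed
    finally show ?thesis .
  qed
  have "\<bar>\<psi> (\<lambda>\<omega>. bil I (\<lambda>i j. G \<omega> i j * w (i + j + n)) (u n \<omega>) (v n \<omega>))\<bar> \<le> C * \<psi> (cutat q (f q) I)" for n
  proof -
    let ?b = "\<lambda>\<omega>. bil I (\<lambda>i j. G \<omega> i j * w (i + j + n)) (u n \<omega>) (v n \<omega>)"
    have bb: "\<bar>?b \<omega>\<bar> \<le> C * cutat q (f q) I \<omega>" for \<omega>
      using schurD[OF w, of "u n \<omega>" "v n \<omega>" I "G \<omega>" n] schurD[OF w, of "\<lambda>i. - u n \<omega> i" "v n \<omega>" I "G \<omega>" n] uv
      by (simp add: bil_uminus cutat_def G_def abs_le_iff)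
    have "?b = (\<lambda>\<omega>. \<Sum>i\<in>?I. \<Sum>j\<in>?I. w (i + j + n) * (G \<omega> i j * u n \<omega> i * v n \<omega> j))"
      by (simp add: bil_def mult_ac)
    then have "bddf ?b" using b by (simp add: bddf_simps)
    then have "\<bar>\<psi> ?b\<bar> \<le> \<psi> (\<lambda>\<omega>. \<bar>?b \<omega>\<bar>)" by (rule mean_abs[OF m])
    also have "\<dots> \<le> \<psi> (\<lambda>\<omega>. C * cutat q (f q) I \<omega>)"
      by (intro mean_mono[OF m] bb bddf_abs \<open>bddf ?b\<close> bddf_mult bddf_const bddf_cutat f)
    also have "\<dots> = C * \<psi> (cutat q (f q) I)" by (rule mean_cmult[OF m bddf_cutat[OF f]])
    finally show ?thesis .
  qed
  then have "\<bar>\<Sum>i\<in>?I. \<Sum>j\<in>?I. S (i + j)\<bar> \<le> (\<Sum>n\<in>?J. C * \<psi> (cutat q (f q) I))"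
    unfolding sumS by (intro order_trans[OF sum_abs] sum_mono)
  then have 1: "\<bar>\<Sum>i\<in>?I. \<Sum>j\<in>?I. S (i + j)\<bar> \<le> real N * C * \<psi> (cutat q (f q) I)" by simp
  have "\<bar>(\<Sum>i\<in>?I. \<Sum>j\<in>?I. S (i + j)) - (\<Sum>i\<in>?I. \<Sum>j\<in>?I. S 0)\<bar> \<le> (\<Sum>i\<in>?I. \<Sum>j\<in>?I. 4 * real I * W)"
    unfolding sum_subtractf[symmetric]
  proof (rule order_trans[OF sum_abs], rule sum_mono, rule order_trans[OF sum_abs], rule sum_mono)
    fix i j assume "i \<in> ?I" "j \<in> ?I"
    then have "real_of_int \<bar>i + j\<bar> \<le> 2 * real I" by simp
    then have "2 * W * real_of_int \<bar>i + j\<bar> \<le> 2 * W * (2 * real I)" using W0 by (intro mult_left_mono) auto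
    then show "\<bar>S (i + j) - S 0\<bar> \<le> 4 * real I * W" using St[of "i + j"] by (simp add: mult_ac)
  qed
  then have 2: "\<bar>(\<Sum>i\<in>?I. \<Sum>j\<in>?I. S (i + j)) - (real I)\<^sup>2 * S 0\<bar> \<le> (real I)\<^sup>2 * (4 * real I * W)"
    by (simp add: power2_eq_square mult_ac)
  have "(real I)\<^sup>2 * \<bar>S 0\<bar> = \<bar>(real I)\<^sup>2 * S 0\<bar>" by (simp add: abs_mult)
  also have "\<dots> \<le> real N * C * \<psi> (cutat q (f q) I) + (real I)\<^sup>2 * (4 * real I * W)" using 1 2 by linarith
  finally have "\<bar>S 0\<bar> \<le> (real N * C * \<psi> (cutat q (f q) I) + (real I)\<^sup>2 * (4 * real I * W)) / (real I)\<^sup>2"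
    using I by (simp add: pos_le_divide_eq mult.commute)
  also have "\<dots> = real N * C * \<psi> (cutat q (f q) I) / (real I)\<^sup>2 + 4 * real I * W"
    using I by (simp add: add_divide_distrib)
  finally show ?thesis by (simp add: S_def)
qed

section \<open>Adding one bit to the lines\<close>

definition lbit :: "nat \<Rightarrow> nat \<Rightarrow> site set \<Rightarrow> real" where
  "lbit k m \<omega> = (if Ln k m 0 \<in> \<omega> then 1 else -1)"

lemma abs_lbit [simp]: "\<bar>lbit k m \<omega>\<bar> = 1"
  by (simp add: lbit_def)

text \<open>Replaces the bits of level \<open>m\<close> by the pattern of \<open>U\<close> on the lines of type \<open>k1 q\<close> and by the
  pattern of \<open>V\<close> on the lines of type \<open>k2 q\<close>, then recentres at \<open>pos q (fst p) (snd p)\<close>.\<close>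

definition implant :: "nat \<Rightarrow> nat \<Rightarrow> int set \<Rightarrow> int set \<Rightarrow> int \<times> int \<Rightarrow> site set \<Rightarrow> site set" where
  "implant q m U V p \<omega> = {s. case s of
     Pt v \<Rightarrow> Pt v \<in> tau (pos q (fst p) (snd p)) \<omega>
   | Ln k l t \<Rightarrow> if l \<noteq> m then Ln k l t \<in> tau (pos q (fst p) (snd p)) \<omega>
       else if k = k1 q then fst p + t \<in> U else if k = k2 q then snd p + t \<in> V else False}"

lemma tau_implant:
  assumes q: "q < 3"
  shows "tau e (implant q m U V p \<omega>) = implant q m U V (p + (co (k1 q) e, co (k2 q) e)) \<omega>"
proof (rule set_eqI)
  fix s
  have p: "pos q (fst p + co (k1 q) e) (snd p + co (k2 q) e) = pos q (fst p) (snd p) + e"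
    by (rule pos_add[OF q])
  show "s \<in> tau e (implant q m U V p \<omega>) \<longleftrightarrow> s \<in> implant q m U V (p + (co (k1 q) e, co (k2 q) e)) \<omega>"
    by (cases s) (auto simp: implant_def p add_ac)
qed

lemma implant_old:
  assumes "cyl m f"
  shows "f (implant q m U V p \<omega>) = f (tau (pos q (fst p) (snd p)) \<omega>)"
proof -
  obtain D where D: "\<And>s. s \<in> D \<Longrightarrow> lev s \<le> m" "\<And>\<omega>. f \<omega> = f (\<omega> \<inter> D)"
    using assms by (rule cylE) blast
  have "implant q m U V p \<omega> \<inter> D = tau (pos q (fst p) (snd p)) \<omega> \<inter> D"
    using D(1) by (fastforce simp: implant_def split: site.splits)
  then show ?thesis using D(2) by metis
qed

text \<open>For each \<omega> the optimal sign patterns of its window become the bits number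
  \<open>m\<close>, and the configuration is recentred at every point of the window. The average
  correlation of \<open>g\<close> with the two new bits is then exactly the normalised cut norm, and
  growing windows give an invariant limit. Half of \<eta> is given up in making the limit
  ergodic.\<close>

lemma cut_extension:
  assumes \<psi>: "imean \<psi>" "erg \<psi>" and q: "q < 3" and g: "cyl m g" "\<And>\<omega>. \<bar>g \<omega>\<bar> \<le> 1"
    and \<eta>: "\<eta> > 0" and cut: "\<And>I. I > 0 \<Longrightarrow> \<psi> (cutat q g I) \<ge> \<eta> * (real I)\<^sup>2"
  obtains \<theta> where "imean \<theta>" "erg \<theta>" "agree m \<psi> \<theta>"
    "\<theta> (\<lambda>\<omega>. g \<omega> * lbit (k1 q) m \<omega> * lbit (k2 q) m \<omega>) \<ge> \<eta> / 2"
proof -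
  note M = imean_mean[OF \<psi>(1)]
  let ?g = "\<lambda>\<omega>. g \<omega> * lbit (k1 q) m \<omega> * lbit (k2 q) m \<omega>"
  have bg: "bddf ?g" using g(2) by (intro bddfI[of _ 1]) (simp add: abs_mult)
  define UV where "UV I G = (SOME p. cut I G = bil I G (sg (fst p)) (sg (snd p)))" for I G
  have UV: "cut I G = bil I G (sg (fst (UV I G))) (sg (snd (UV I G)))" for I G
  proof -
    obtain U V where "cut I G = bil I G (sg U) (sg V)" by (rule cut_attained)
    then have "\<exists>p. cut I G = bil I G (sg (fst p)) (sg (snd p))" by (intro exI[of _ "(U, V)"]) simp
    then show ?thesis unfolding UV_def by (rule someI_ex)
  qed
  define G where "G \<omega> = (\<lambda>i j. g (tau (pos q i j) \<omega>))" for \<omega>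
  define U where "U I \<omega> = fst (UV I (G \<omega>))" for I \<omega>
  define V where "V I \<omega> = snd (UV I (G \<omega>))" for I \<omega>
  have cutat: "cutat q g I \<omega> = bil I (G \<omega>) (sg (U I \<omega>)) (sg (V I \<omega>))" for I \<omega>
    using UV[of I "G \<omega>"] by (simp add: cutat_def U_def V_def G_def)
  define P where "P I f p = \<psi> (\<lambda>\<omega>. f (implant q m (U I \<omega>) (V I \<omega>) p \<omega>))" for I and f :: "site set \<Rightarrow> real" and p
  define \<Theta> where "\<Theta> n f = (\<Sum>p\<in>grid (Suc n). P (Suc n) f p) / (real (Suc n))\<^sup>2" for n f
  have Pm: "mean (\<lambda>f. P I f p)" for I p
    unfolding P_def by (rule mean_pushforward[OF M])
  have \<Theta>m: "mean (\<Theta> n)" for n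
  proof -
    have "mean (\<lambda>f. (\<Sum>p\<in>grid (Suc n). P (Suc n) f p) / real (card (grid (Suc n))))"
      by (rule mean_average) (simp_all add: Pm grid_nonempty)
    then show ?thesis by (simp add: \<Theta>_def[abs_def])
  qed
  have \<Theta>_inv: "(\<lambda>n. \<Theta> n (\<lambda>\<omega>. f (tau e \<omega>)) - \<Theta> n f) \<longlonglongrightarrow> 0" if f: "bddf f" for f e
  proof -
    obtain C where C: "\<And>\<omega>. \<bar>f \<omega>\<bar> \<le> C" using bddfE[OF f] by blast
    have b: "\<bar>P (Suc n) f p\<bar> \<le> C" for n p unfolding P_def by (rule mean_bound[OF M C])
    have "P (Suc n) (\<lambda>\<omega>. f (tau e \<omega>)) p = P (Suc n) f (p + (co (k1 q) e, co (k2 q) e))" for n p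
      unfolding P_def tau_implant[OF q] ..
    then have "\<Theta> n (\<lambda>\<omega>. f (tau e \<omega>)) - \<Theta> n f = ((\<Sum>p\<in>grid (Suc n). P (Suc n) f (p + (co (k1 q) e, co (k2 q) e)))
        - (\<Sum>p\<in>grid (Suc n). P (Suc n) f p)) / (real (Suc n))\<^sup>2" for n
      by (simp add: \<Theta>_def diff_divide_distrib)
    then show ?thesis
      using shifted_grid_average_tendsto[of "\<lambda>n. P (Suc n) f" C Suc, OF b] by simp
  qed
  obtain F \<theta> where F: "F \<noteq> bot" "F \<le> sequentially" and \<theta>: "imean \<theta>"
    and L: "\<And>f. bddf f \<Longrightarrow> ((\<lambda>n. \<Theta> n f) \<longlongrightarrow> \<theta> f) F"
    using imean_cluster[of \<Theta>, OF \<Theta>m \<Theta>_inv] by blast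
  \<comment> \<open>Functions of level \<open>m\<close> notice only the recentring, under which
    \<psi> is invariant, so they keep their mean already before the limit.\<close>
  have old: "\<Theta> n f = \<psi> f" if f: "cyl m f" for n f
    using imean_tau[OF \<psi>(1) cyl_bddf[OF f]] by (simp add: \<Theta>_def P_def implant_old[OF f])
  have ag: "agree m \<psi> \<theta>"
    unfolding agree_def
  proof (intro allI impI)
    fix f :: "site set \<Rightarrow> real" assume f: "cyl m f"
    have "((\<lambda>n. \<psi> f) \<longlongrightarrow> \<theta> f) F" using L[OF cyl_bddf[OF f]] by (simp add: old[OF f])
    then show "\<psi> f = \<theta> f" using tendsto_unique[OF F(1)] tendsto_const by blast
  qed
  have "\<eta> \<le> \<Theta> n ?g" for n
  proof -
    let ?I = "{0..<int (Suc n)}"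
    have k12: "k1 q \<noteq> k2 q" using q by (auto simp: k1_def k2_def)
    have "P (Suc n) ?g p = \<psi> (\<lambda>\<omega>. G \<omega> (fst p) (snd p) * sg (U (Suc n) \<omega>) (fst p) * sg (V (Suc n) \<omega>) (snd p))" for p
      unfolding P_def implant_old[OF g(1)] using k12 by (simp add: lbit_def implant_def sg_def G_def)
    then have "(\<Sum>p\<in>grid (Suc n). P (Suc n) ?g p)
        = (\<Sum>i\<in>?I. \<Sum>j\<in>?I. \<psi> (\<lambda>\<omega>. G \<omega> i j * sg (U (Suc n) \<omega>) i * sg (V (Suc n) \<omega>) j))"
      by (simp only: grid_def sum.cartesian_product split_def)
    also have "\<dots> = \<psi> (cutat q g (Suc n))"
    proof -
      have b: "bddf (\<lambda>\<omega>. G \<omega> i j * sg (U (Suc n) \<omega>) i * sg (V (Suc n) \<omega>) j)" for i j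
        using g(2) by (intro bddfI[of _ 1]) (simp add: abs_mult G_def)
      have "cutat q g (Suc n) = (\<lambda>\<omega>. \<Sum>i\<in>?I. \<Sum>j\<in>?I. G \<omega> i j * sg (U (Suc n) \<omega>) i * sg (V (Suc n) \<omega>) j)"
        by (rule ext) (simp only: cutat bil_def)
      then show ?thesis using b by (simp add: mean_sum[OF M] bddf_simps)
    qed
    finally have "\<Theta> n ?g = \<psi> (cutat q g (Suc n)) / (real (Suc n))\<^sup>2" by (simp add: \<Theta>_def)
    moreover have "\<eta> * (real (Suc n))\<^sup>2 \<le> \<psi> (cutat q g (Suc n))" by (rule cut) simp
    ultimately show ?thesis by (simp add: pos_le_divide_eq del: of_nat_Suc)
  qed
  then have "\<eta> \<le> \<theta> ?g"
    by (intro tendsto_lowerbound[OF L[OF bg] _ F(1)] always_eventually allI)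
  moreover obtain \<theta>' where "imean \<theta>'" "erg \<theta>'" "agree m \<psi> \<theta>'" "\<theta>' ?g \<ge> \<theta> ?g - \<eta> / 2"
    using ergodic_refinement[OF \<psi> \<theta> ag bg, of "\<eta> / 2"] \<eta> by auto
  ultimately show thesis by (intro that[of \<theta>']) auto
qed

section \<open>Energy of the line partitions\<close>

text \<open>Conditional expectation on the partition into fibres of \<pi>; a fibre of mean 0 gets
  the value 0 by division by zero.\<close>

definition ce :: "(('a \<Rightarrow> real) \<Rightarrow> real) \<Rightarrow> ('a \<Rightarrow> 'b) \<Rightarrow> ('a \<Rightarrow> real) \<Rightarrow> 'a \<Rightarrow> real" where
  "ce \<psi> \<pi> f \<omega> = \<psi> (\<lambda>x. f x * of_bool (\<pi> x = \<pi> \<omega>)) / \<psi> (\<lambda>x. of_bool (\<pi> x = \<pi> \<omega>))"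

lemma sum_over_range:
  assumes "finite (range \<pi>)"
  shows "(f \<omega> :: real) = (\<Sum>b\<in>range \<pi>. f \<omega> * of_bool (\<pi> \<omega> = b))"
proof -
  have "(\<Sum>b\<in>range \<pi>. f \<omega> * of_bool (\<pi> \<omega> = b)) = (\<Sum>b\<in>range \<pi>. if \<pi> \<omega> = b then f \<omega> else 0)"
    by (rule sum.cong) auto
  then show ?thesis using assms by simp
qed

lemma ce_integral:
  assumes m: "mean \<psi>" and fin: "finite (range \<pi>)" and f: "bddf f"
  shows "\<psi> (\<lambda>\<omega>. h (\<pi> \<omega>) * ce \<psi> \<pi> f \<omega>) = \<psi> (\<lambda>\<omega>. h (\<pi> \<omega>) * f \<omega>)"
proof -
  define c where "c b = \<psi> (\<lambda>x. f x * of_bool (\<pi> x = b)) / \<psi> (\<lambda>x. of_bool (\<pi> x = b))" for b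
  \<comment> \<open>On a fibre of mean 0 the right side vanishes as well, so the default value of
    the quotient does no harm.\<close>
  have c: "c b * \<psi> (\<lambda>x. of_bool (\<pi> x = b)) = \<psi> (\<lambda>x. f x * of_bool (\<pi> x = b))" for b
    using mean_eq_zero_of_support[OF m f, of "\<lambda>x. \<pi> x = b"] by (simp add: c_def)
  have 1: "(\<lambda>\<omega>. h (\<pi> \<omega>) * ce \<psi> \<pi> f \<omega>) = (\<lambda>\<omega>. \<Sum>b\<in>range \<pi>. h b * (c b * of_bool (\<pi> \<omega> = b)))"
  proof
    fix \<omega>
    show "h (\<pi> \<omega>) * ce \<psi> \<pi> f \<omega> = (\<Sum>b\<in>range \<pi>. h b * (c b * of_bool (\<pi> \<omega> = b)))"
      by (subst sum_over_range[OF fin, of "\<lambda>\<omega>. h (\<pi> \<omega>) * ce \<psi> \<pi> f \<omega>"], rule sum.cong)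
        (auto simp: ce_def c_def)
  qed
  have 2: "(\<lambda>\<omega>. h (\<pi> \<omega>) * f \<omega>) = (\<lambda>\<omega>. \<Sum>b\<in>range \<pi>. h b * (f \<omega> * of_bool (\<pi> \<omega> = b)))"
  proof
    fix \<omega>
    show "h (\<pi> \<omega>) * f \<omega> = (\<Sum>b\<in>range \<pi>. h b * (f \<omega> * of_bool (\<pi> \<omega> = b)))"
      by (subst sum_over_range[OF fin, of "\<lambda>\<omega>. h (\<pi> \<omega>) * f \<omega>"], rule sum.cong) auto
  qed
  have "\<psi> (\<lambda>\<omega>. \<Sum>b\<in>range \<pi>. h b * (c b * of_bool (\<pi> \<omega> = b))) = (\<Sum>b\<in>range \<pi>. h b * (c b * \<psi> (\<lambda>\<omega>. of_bool (\<pi> \<omega> = b))))"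
    by (simp add: mean_sum[OF m] mean_cmult[OF m] bddf_simps)
  moreover have "\<psi> (\<lambda>\<omega>. \<Sum>b\<in>range \<pi>. h b * (f \<omega> * of_bool (\<pi> \<omega> = b))) = (\<Sum>b\<in>range \<pi>. h b * \<psi> (\<lambda>\<omega>. f \<omega> * of_bool (\<pi> \<omega> = b)))"
    using f by (simp add: mean_sum[OF m] mean_cmult[OF m] bddf_simps)
  ultimately show ?thesis unfolding 1 2 by (simp add: c)
qed

lemma ce_nonneg:
  assumes m: "mean \<psi>" and f: "bddf f" "\<And>\<omega>. 0 \<le> f \<omega>"
  shows "0 \<le> ce \<psi> \<pi> f \<omega>"
  unfolding ce_def using f
  by (intro divide_nonneg_nonneg mean_nonneg[OF m]) (auto simp: bddf_simps)

lemma ce_le_one: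
  assumes m: "mean \<psi>" and f: "bddf f" "\<And>\<omega>. f \<omega> \<le> 1"
  shows "ce \<psi> \<pi> f \<omega> \<le> 1"
proof -
  have "\<psi> (\<lambda>x. f x * of_bool (\<pi> x = \<pi> \<omega>)) \<le> \<psi> (\<lambda>x. of_bool (\<pi> x = \<pi> \<omega>))"
    using f by (intro mean_mono[OF m]) (auto simp: bddf_simps)
  moreover have "0 \<le> \<psi> (\<lambda>x. of_bool (\<pi> x = \<pi> \<omega>))" by (intro mean_nonneg[OF m]) auto
  ultimately show ?thesis unfolding ce_def by (simp add: divide_le_eq)
qed

text \<open>The vertex number \<open>q\<close> of a triangle lies on the two lines of types other
  than \<open>q\<close>; the partition records the bits below \<open>m\<close> on these two
  lines.\<close>

definition lpart :: "nat \<Rightarrow> nat \<Rightarrow> site set \<Rightarrow> (nat \<times> nat) set" where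
  "lpart q m \<omega> = {(k, j). k < 3 \<and> k \<noteq> q \<and> j < m \<and> Ln k j 0 \<in> \<omega>}"

definition base :: "site set \<Rightarrow> real" where
  "base \<omega> = of_bool (Pt 0 \<in> \<omega>)"

definition proj :: "((site set \<Rightarrow> real) \<Rightarrow> real) \<Rightarrow> nat \<Rightarrow> nat \<Rightarrow> site set \<Rightarrow> real" where
  "proj \<psi> q m = ce \<psi> (lpart q m) base"

definition energy :: "((site set \<Rightarrow> real) \<Rightarrow> real) \<Rightarrow> nat \<Rightarrow> nat \<Rightarrow> real" where
  "energy \<psi> q m = \<psi> (\<lambda>\<omega>. (proj \<psi> q m \<omega>)\<^sup>2)"

lemma finite_range_lpart [simp]: "finite (range (lpart q m))"
  by (rule finite_subset[of _ "Pow ({..<3} \<times> {..<m})"]) (auto simp: lpart_def)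

lemma cyl_lpart [simp]: "cyl m (lpart q m)"
proof (rule cylI)
  let ?D = "(\<lambda>(k, j). Ln k j 0) ` ({..<3} \<times> {..<m})"
  show "finite ?D" by simp
  show "\<And>s. s \<in> ?D \<Longrightarrow> lev s \<le> m" by auto
  show "\<And>\<omega>. lpart q m \<omega> = lpart q m (\<omega> \<inter> ?D)" by (auto simp: lpart_def)
qed

lemma cyl_base [simp]: "cyl m base"
  unfolding base_def by (intro cyl_of_bool cyl_mem) simp

lemma bddf_base [simp]: "bddf base"
  by (rule cyl_bddf[OF cyl_base[of 0]])

lemma base_nonneg [simp]: "0 \<le> base \<omega>" and base_le_one [simp]: "base \<omega> \<le> 1"
  by (simp_all add: base_def)

lemma proj_nonneg: "mean \<psi> \<Longrightarrow> 0 \<le> proj \<psi> q m \<omega>"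
  unfolding proj_def by (rule ce_nonneg) auto

lemma proj_le_one: "mean \<psi> \<Longrightarrow> proj \<psi> q m \<omega> \<le> 1"
  unfolding proj_def by (rule ce_le_one) auto

lemma abs_proj: "mean \<psi> \<Longrightarrow> \<bar>proj \<psi> q m \<omega>\<bar> \<le> 1"
  using proj_nonneg proj_le_one by (metis abs_of_nonneg)

lemma bddf_proj: "mean \<psi> \<Longrightarrow> bddf (proj \<psi> q m)"
  using abs_proj by (rule bddfI)

lemma cyl_proj [simp]: "cyl m (proj \<psi> q m)"
  unfolding proj_def ce_def
  by (rule cyl_comp[of m "lpart q m" "\<lambda>b. \<psi> (\<lambda>x. base x * of_bool (lpart q m x = b)) / \<psi> (\<lambda>x. of_bool (lpart q m x = b))"]) simp

lemma proj_function:
  obtains h where "\<And>\<omega>. proj \<psi> q m \<omega> = h (lpart q m \<omega>)"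
  by (rule that[of "\<lambda>b. \<psi> (\<lambda>x. base x * of_bool (lpart q m x = b)) / \<psi> (\<lambda>x. of_bool (lpart q m x = b))"]) (simp add: proj_def ce_def)

lemma proj_agree:
  assumes "agree m \<psi> \<theta>"
  shows "proj \<psi> q m = proj \<theta> q m"
proof
  fix \<omega>
  have "cyl m (\<lambda>x. of_bool (lpart q m x = lpart q m \<omega>) :: real)" by (intro cyl_of_bool cyl_eq cyl_const cyl_lpart)
  moreover from this have "cyl m (\<lambda>x. base x * of_bool (lpart q m x = lpart q m \<omega>))" by (intro cyl_mult cyl_base)
  ultimately show "proj \<psi> q m \<omega> = proj \<theta> q m \<omega>"
    unfolding proj_def ce_def by (simp add: agreeD[OF assms])
qed

lemma energy_agree:
  assumes "agree m \<psi> \<theta>"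
  shows "energy \<psi> q m = energy \<theta> q m"
  unfolding energy_def proj_agree[OF assms]
  by (rule agreeD[OF assms]) (intro cyl_power cyl_proj)

lemma energy_le_one:
  assumes "mean \<psi>"
  shows "energy \<psi> q m \<le> 1"
proof -
  have "\<bar>(proj \<psi> q m \<omega>)\<^sup>2\<bar> \<le> 1" for \<omega> using abs_proj[OF assms] by (simp add: abs_square_le_1)
  from mean_bound[OF assms this] show ?thesis unfolding energy_def by (simp add: abs_le_iff)
qed

lemma lpart_refine: "m \<le> m' \<Longrightarrow> lpart q m \<omega> = {(k, j) \<in> lpart q m' \<omega>. j < m}"
  by (auto simp: lpart_def)

lemma proj_orthogonal:
  assumes m: "mean \<theta>" and "m \<le> m'" and h: "\<And>\<omega>. g \<omega> = h (lpart q m \<omega>)"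
  shows "\<theta> (\<lambda>\<omega>. g \<omega> * proj \<theta> q m' \<omega>) = \<theta> (\<lambda>\<omega>. g \<omega> * base \<omega>)"
  unfolding proj_def h lpart_refine[OF \<open>m \<le> m'\<close>]
  by (rule ce_integral[OF m, where h = "\<lambda>b. h {(k, j) \<in> b. j < m}"]) simp_all

text \<open>Pythagoras: the coarser projection is orthogonal to the increment.\<close>

lemma energy_diff:
  assumes m: "mean \<theta>" and le: "m \<le> m'"
  shows "\<theta> (\<lambda>\<omega>. (proj \<theta> q m' \<omega> - proj \<theta> q m \<omega>)\<^sup>2) = energy \<theta> q m' - energy \<theta> q m"
proof -
  let ?P = "proj \<theta> q m" and ?P' = "proj \<theta> q m'"
  note b = bddf_proj[OF m, of q m] bddf_proj[OF m, of q m']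
  obtain h where h: "\<And>\<omega>. ?P \<omega> = h (lpart q m \<omega>)" using proj_function by blast
  have "\<theta> (\<lambda>\<omega>. ?P \<omega> * ?P' \<omega>) = energy \<theta> q m"
    unfolding energy_def power2_eq_square
    using proj_orthogonal[where h = h and g = ?P, OF m le h]
      proj_orthogonal[where h = h and g = ?P, OF m order_refl h] by simp
  moreover have "\<theta> (\<lambda>\<omega>. (?P' \<omega> - ?P \<omega>)\<^sup>2) = \<theta> (\<lambda>\<omega>. ((?P' \<omega>)\<^sup>2 + (?P \<omega>)\<^sup>2) - 2 * (?P \<omega> * ?P' \<omega>))"
    by (rule arg_cong[where f = \<theta>]) (auto simp: power2_eq_square algebra_simps)
  ultimately show ?thesis
    using b by (simp add: mean_diff[OF m] mean_add[OF m] mean_cmult[OF m] bddf_simps energy_def)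
qed

lemma energy_mono:
  assumes m: "mean \<theta>" and le: "m \<le> m'"
  shows "energy \<theta> q m \<le> energy \<theta> q m'"
proof -
  have "0 \<le> \<theta> (\<lambda>\<omega>. (proj \<theta> q m' \<omega> - proj \<theta> q m \<omega>)\<^sup>2)"
    by (intro mean_nonneg[OF m] bddf_power bddf_diff bddf_proj m) simp
  then show ?thesis using energy_diff[OF assms] by simp
qed

text \<open>The product \<open>B\<close> of the two new bits is a function of
  \<open>lpart q (Suc m)\<close>, so \<open>base\<close> may be replaced by its finer projection in
  the correlation with \<open>B\<close>. What remains is a correlation with the increment of
  projections, bounded by Cauchy-Schwarz.\<close>

lemma energy_increment:
  assumes m: "mean \<theta>" and q: "q < 3" and \<eta>: "0 \<le> \<eta>"
    and cor: "\<eta> \<le> \<theta> (\<lambda>\<omega>. (base \<omega> - proj \<theta> q m \<omega>) * lbit (k1 q) m \<omega> * lbit (k2 q) m \<omega>)"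
  shows "energy \<theta> q m + \<eta>\<^sup>2 \<le> energy \<theta> q (Suc m)"
proof -
  let ?P = "proj \<theta> q m" and ?P' = "proj \<theta> q (Suc m)"
  note b = bddf_proj[OF m, of q m] bddf_proj[OF m, of q "Suc m"]
  define B where "B \<omega> = lbit (k1 q) m \<omega> * lbit (k2 q) m \<omega>" for \<omega>
  have B1: "\<bar>B \<omega>\<bar> \<le> 1" for \<omega> by (simp add: B_def abs_mult)
  have bB: "bddf B" using B1 by (rule bddfI)
  define h where "h b = (if (k1 q, m) \<in> b then 1 else -1) * (if (k2 q, m) \<in> b then 1 else -1 :: real)" for b
  have "k1 q < 3" "k2 q < 3" "k1 q \<noteq> q" "k2 q \<noteq> q" using q by (auto simp: k1_def k2_def)
  then have h: "B \<omega> = h (lpart q (Suc m) \<omega>)" for \<omega>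
    by (auto simp: B_def h_def lbit_def lpart_def)
  have "\<theta> (\<lambda>\<omega>. (base \<omega> - ?P \<omega>) * B \<omega>) = \<theta> (\<lambda>\<omega>. B \<omega> * base \<omega>) - \<theta> (\<lambda>\<omega>. B \<omega> * ?P \<omega>)"
    using bB b by (simp add: mean_diff[OF m, symmetric] bddf_simps algebra_simps)
  also have "\<theta> (\<lambda>\<omega>. B \<omega> * base \<omega>) = \<theta> (\<lambda>\<omega>. B \<omega> * ?P' \<omega>)"
    using proj_orthogonal[where h = h and g = B, OF m order_refl h] by simp
  also have "\<dots> - \<theta> (\<lambda>\<omega>. B \<omega> * ?P \<omega>) = \<theta> (\<lambda>\<omega>. (?P' \<omega> - ?P \<omega>) * B \<omega>)"
    using bB b by (simp add: mean_diff[OF m, symmetric] bddf_simps algebra_simps)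
  finally have "\<eta> \<le> \<theta> (\<lambda>\<omega>. (?P' \<omega> - ?P \<omega>) * B \<omega>)" using cor by (simp add: B_def mult.assoc)
  then have "\<eta>\<^sup>2 \<le> (\<theta> (\<lambda>\<omega>. (?P' \<omega> - ?P \<omega>) * B \<omega>))\<^sup>2" using \<eta> by (intro power_mono)
  also have "\<dots> \<le> \<theta> (\<lambda>\<omega>. (?P' \<omega> - ?P \<omega>)\<^sup>2)"
    by (intro mean_cauchy_schwarz_le_one[OF m _ B1] bddf_diff b)
  also have "\<dots> = energy \<theta> q (Suc m) - energy \<theta> q m" by (rule energy_diff[OF m]) simp
  finally show ?thesis by simp
qed

definition total_energy :: "((site set \<Rightarrow> real) \<Rightarrow> real) \<Rightarrow> nat \<Rightarrow> real" where
  "total_energy \<psi> m = (\<Sum>q<3. energy \<psi> q m)"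

text \<open>A mean does not record how many bits are in use; the second component is the level up to
  which they are counted.\<close>

definition extensions :: "((site set \<Rightarrow> real) \<Rightarrow> real) \<Rightarrow> nat \<Rightarrow> (((site set \<Rightarrow> real) \<Rightarrow> real) \<times> nat) set" where
  "extensions \<psi> m = {(\<theta>, m'). imean \<theta> \<and> erg \<theta> \<and> agree m \<psi> \<theta> \<and> m \<le> m'}"

lemma extensions_trans:
  "(\<theta>, m') \<in> extensions \<psi> m \<Longrightarrow> (\<phi>, m'') \<in> extensions \<theta> m' \<Longrightarrow> (\<phi>, m'') \<in> extensions \<psi> m"
  unfolding extensions_def using agree_trans by fastforce

text \<open>The total energy is at most 3, so its supremum is finite; an element close to it
  suffices, and no limit of a chain of extensions is formed.\<close>

lemma near_maximal_extension:
  assumes "imean \<psi>" "erg \<psi>" "\<epsilon> > 0"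
  obtains \<theta> m' where "(\<theta>, m') \<in> extensions \<psi> m"
    "\<And>\<phi> m''. (\<phi>, m'') \<in> extensions \<psi> m \<Longrightarrow> total_energy \<phi> m'' < total_energy \<theta> m' + \<epsilon>"
proof -
  let ?E = "(\<lambda>(\<theta>, m'). total_energy \<theta> m') ` extensions \<psi> m"
  have "total_energy \<theta> m' \<le> 3" if "(\<theta>, m') \<in> extensions \<psi> m" for \<theta> m'
  proof -
    have "total_energy \<theta> m' \<le> (\<Sum>q<3::nat. 1)"
      unfolding total_energy_def using that by (intro sum_mono energy_le_one) (simp add: extensions_def)
    then show ?thesis by simp
  qed
  then have bdd: "bdd_above ?E" by (intro bdd_aboveI[of _ 3]) auto
  have "(\<psi>, m) \<in> extensions \<psi> m" using assms by (simp add: extensions_def)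
  then have ne: "?E \<noteq> {}" by blast
  have "Sup ?E - \<epsilon> < Sup ?E" using assms(3) by simp
  then obtain \<theta> m' where 1: "(\<theta>, m') \<in> extensions \<psi> m" "Sup ?E - \<epsilon> < total_energy \<theta> m'"
    unfolding less_cSup_iff[OF ne bdd] by auto
  show thesis
  proof (rule that[OF 1(1)])
    fix \<phi> m'' assume "(\<phi>, m'') \<in> extensions \<psi> m"
    then have "total_energy \<phi> m'' \<le> Sup ?E" by (intro cSup_upper bdd) force
    then show "total_energy \<phi> m'' < total_energy \<theta> m' + \<epsilon>" using 1(2) by linarith
  qed
qed

lemma total_energy_gap:
  assumes "mean \<theta>" "m \<le> m'" "q < 3"
  shows "energy \<theta> q m' - energy \<theta> q m \<le> total_energy \<theta> m' - total_energy \<theta> m"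
proof -
  have "energy \<theta> q m' - energy \<theta> q m \<le> (\<Sum>q<3. energy \<theta> q m' - energy \<theta> q m)"
    using assms(3) energy_mono[OF assms(1,2)] by (intro member_le_sum) auto
  then show ?thesis by (simp add: total_energy_def sum_subtractf)
qed

lemma total_energy_agree: "agree m \<psi> \<theta> \<Longrightarrow> total_energy \<psi> m = total_energy \<theta> m"
  unfolding total_energy_def using energy_agree by simp

text \<open>An extension of a near maximiser is again an extension of \<psi>, so it can gain at most
  \<epsilon> of energy; by Pythagoras the gain is the squared distance of the projections.\<close>

lemma coarse_structure:
  assumes "imean \<psi>" "erg \<psi>" "\<epsilon> > 0"
  obtains \<theta> m where "(\<theta>, m) \<in> extensions \<psi> 0"
    "\<And>\<phi> m' q. (\<phi>, m') \<in> extensions \<theta> m \<Longrightarrow> q < 3 \<Longrightarrow>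
      \<phi> (\<lambda>\<omega>. (proj \<phi> q m' \<omega> - proj \<phi> q m \<omega>)\<^sup>2) \<le> \<epsilon>"
proof -
  obtain \<theta> m where 1: "(\<theta>, m) \<in> extensions \<psi> 0"
    and 2: "\<And>\<phi> m'. (\<phi>, m') \<in> extensions \<psi> 0 \<Longrightarrow> total_energy \<phi> m' < total_energy \<theta> m + \<epsilon>"
    by (rule near_maximal_extension[OF assms, where m = 0]) blast
  show thesis
  proof (rule that[OF 1])
    fix \<phi> m' and q :: nat assume e: "(\<phi>, m') \<in> extensions \<theta> m" and q: "q < 3"
    then have m: "mean \<phi>" "m \<le> m'" and a: "agree m \<theta> \<phi>" by (simp_all add: extensions_def)
    have "energy \<phi> q m' - energy \<phi> q m \<le> total_energy \<phi> m' - total_energy \<phi> m"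
      by (rule total_energy_gap[OF m q])
    also have "\<dots> \<le> \<epsilon>"
      using 2[OF extensions_trans[OF 1 e]] total_energy_agree[OF a] by simp
    finally show "\<phi> (\<lambda>\<omega>. (proj \<phi> q m' \<omega> - proj \<phi> q m \<omega>)\<^sup>2) \<le> \<epsilon>"
      by (simp add: energy_diff[OF m])
  qed
qed

text \<open>If no window were uniform for some \<open>q\<close>, \<open>cut_extension\<close> would
  add bits with correlation at least \<open>\<eta> / 2\<close>, hence raise the energy by
  \<open>(\<eta> / 2)\<^sup>2\<close>, against near maximality.\<close>

lemma uniform_structure:
  assumes "imean \<psi>" "erg \<psi>" "\<eta> > 0"
  obtains \<theta> m' where "(\<theta>, m') \<in> extensions \<psi> m"
    "\<And>q. q < 3 \<Longrightarrow> \<exists>I>0. \<theta> (cutat q (\<lambda>\<omega>. base \<omega> - proj \<theta> q m' \<omega>) I) < \<eta> * (real I)\<^sup>2"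
proof -
  have \<eta>2: "(\<eta> / 2)\<^sup>2 > 0" using assms(3) by simp
  show thesis
  proof (rule near_maximal_extension[OF assms(1,2) \<eta>2, where m = m])
    fix \<theta> m' assume 1: "(\<theta>, m') \<in> extensions \<psi> m"
      and 2: "\<And>\<phi> m''. (\<phi>, m'') \<in> extensions \<psi> m \<Longrightarrow> total_energy \<phi> m'' < total_energy \<theta> m' + (\<eta> / 2)\<^sup>2"
    have \<theta>: "imean \<theta>" "erg \<theta>" using 1 by (simp_all add: extensions_def)
    show thesis
    proof (rule that[OF 1], rule ccontr)
      fix q :: nat assume q: "q < 3"
      let ?g = "\<lambda>\<omega>. base \<omega> - proj \<theta> q m' \<omega>"
      assume n: "\<not> (\<exists>I>0. \<theta> (cutat q ?g I) < \<eta> * (real I)\<^sup>2)"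
      have cut: "\<theta> (cutat q ?g I) \<ge> \<eta> * (real I)\<^sup>2" if "I > 0" for I
        by (rule ccontr, rule notE[OF n]) (intro exI[of _ I] conjI, use that in simp_all)
      have g: "cyl m' ?g" by (intro cyl_diff cyl_base cyl_proj)
      have g1: "\<bar>?g \<omega>\<bar> \<le> 1" for \<omega>
        using proj_nonneg[OF imean_mean[OF \<theta>(1)], of q m' \<omega>] proj_le_one[OF imean_mean[OF \<theta>(1)], of q m' \<omega>]
          base_nonneg[of \<omega>] base_le_one[of \<omega>] by linarith
      obtain \<phi> where \<phi>: "imean \<phi>" "erg \<phi>" and a: "agree m' \<theta> \<phi>"
        and cor: "\<phi> (\<lambda>\<omega>. ?g \<omega> * lbit (k1 q) m' \<omega> * lbit (k2 q) m' \<omega>) \<ge> \<eta> / 2"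
        using cut_extension[OF \<theta> q g g1 assms(3) cut] by blast
      have e: "(\<phi>, Suc m') \<in> extensions \<theta> m'" using \<phi> a by (simp add: extensions_def)
      note M = imean_mean[OF \<phi>(1)]
      have "energy \<phi> q m' + (\<eta> / 2)\<^sup>2 \<le> energy \<phi> q (Suc m')"
        using cor assms(3) unfolding proj_agree[OF a] by (intro energy_increment[OF M q]) auto
      then have "(\<eta> / 2)\<^sup>2 \<le> total_energy \<phi> (Suc m') - total_energy \<phi> m'"
        using total_energy_gap[OF M _ q, of m' "Suc m'"] by linarith
      then show False
        using 2[OF extensions_trans[OF 1 e]] total_energy_agree[OF a] by simp
    qed
  qed
qed

section \<open>Correlations along three lines\<close>

definition atm :: "nat \<Rightarrow> nat \<Rightarrow> int \<Rightarrow> site set \<Rightarrow> nat set" where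
  "atm k m i \<omega> = {j. j < m \<and> Ln k j i \<in> \<omega>}"

lemma atm_in_Pow [simp]: "atm k m i \<omega> \<in> Pow {..<m}"
  by (auto simp: atm_def)

lemma atm_tau [simp]: "atm k m i (tau e \<omega>) = atm k m (i + co k e) \<omega>"
  by (simp add: atm_def)

lemma cyl_atm [simp]: "cyl m (atm k m i)"
proof (rule cylI)
  let ?D = "(\<lambda>j. Ln k j i) ` {..<m}"
  show "finite ?D" by simp
  show "\<And>s. s \<in> ?D \<Longrightarrow> lev s \<le> m" by auto
  show "\<And>\<omega>. atm k m i \<omega> = atm k m i (\<omega> \<inter> ?D)" by (auto simp: atm_def)
qed

definition ia :: "nat \<Rightarrow> nat \<Rightarrow> int \<Rightarrow> nat set \<Rightarrow> site set \<Rightarrow> real" where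
  "ia k m i \<alpha> \<omega> = of_bool (atm k m i \<omega> = \<alpha>)"

lemma ia_tau [simp]: "ia k m i \<alpha> (tau e \<omega>) = ia k m (i + co k e) \<alpha> \<omega>"
  by (simp add: ia_def)

lemma abs_ia: "\<bar>ia k m i \<alpha> \<omega>\<bar> \<le> 1"
  by (simp add: ia_def)

lemma bddf_ia [simp]: "bddf (ia k m i \<alpha>)"
  using abs_ia by (rule bddfI)

lemma cyl_ia [simp]: "cyl m (ia k m i \<alpha>)"
  unfolding ia_def by (intro cyl_of_bool cyl_eq cyl_atm cyl_const)

text \<open>Writes the equality kernel of two lines as a sum of products. Both the positivity of
  \<open>gam\<close> and its Schur bound rest on this splitting.\<close>

lemma sum_ia_mult_ia:
  "(\<Sum>\<beta>\<in>Pow {..<m}. ia k m i \<beta> \<omega> * ia k m j \<beta> \<omega>) = of_bool (atm k m i \<omega> = atm k m j \<omega>)"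
proof -
  have "(\<Sum>\<beta>\<in>Pow {..<m}. ia k m i \<beta> \<omega> * ia k m j \<beta> \<omega>)
      = (\<Sum>\<beta>\<in>Pow {..<m}. if atm k m i \<omega> = \<beta> then of_bool (atm k m i \<omega> = atm k m j \<omega>) else 0)"
    by (rule sum.cong) (auto simp: ia_def)
  then show ?thesis by (simp add: sum.delta del: Pow_iff)
qed

text \<open>Correlation function of the stationary process of patterns on parallel lines. Type 1 is
  singled out because the corner is later moved into the position where \<open>n\<close> labels the
  line of type 1 and the others are at 0.\<close>

definition gam :: "((site set \<Rightarrow> real) \<Rightarrow> real) \<Rightarrow> nat \<Rightarrow> int \<Rightarrow> real" where
  "gam \<psi> m h = \<psi> (\<lambda>\<omega>. of_bool (atm 1 m 0 \<omega> = atm 1 m h \<omega>))"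

lemma gam_eq:
  assumes "imean \<psi>"
  shows "\<psi> (\<lambda>\<omega>. of_bool (atm 1 m a \<omega> = atm 1 m b \<omega>)) = gam \<psi> m (b - a)"
  using imean_tau[OF assms bddf_of_bool[of "\<lambda>\<omega>. atm 1 m 0 \<omega> = atm 1 m (b - a) \<omega>"], of "(0, a)"]
  by (simp add: gam_def)

lemma gam_uminus: "imean \<psi> \<Longrightarrow> gam \<psi> m (- h) = gam \<psi> m h"
  using gam_eq[of \<psi> m 0 h] gam_eq[of \<psi> m h 0] by (simp add: eq_commute)

lemma gam_bounds:
  assumes "imean \<psi>"
  shows "0 \<le> gam \<psi> m h" "gam \<psi> m h \<le> 1" "\<bar>gam \<psi> m h\<bar> \<le> 1"
proof -
  note M = imean_mean[OF assms]
  show 0: "0 \<le> gam \<psi> m h" unfolding gam_def by (rule mean_nonneg[OF M]) auto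
  show 1: "\<bar>gam \<psi> m h\<bar> \<le> 1" unfolding gam_def by (rule mean_bound[OF M]) simp
  show "gam \<psi> m h \<le> 1" using 0 1 by simp
qed

lemma gam_agree: "agree m \<psi> \<theta> \<Longrightarrow> gam \<psi> m = gam \<theta> m"
  unfolding gam_def by (intro ext, erule agreeD, intro cyl_of_bool cyl_eq cyl_atm)

text \<open>Since \<open>u\<close> ignores vertical and \<open>v\<close> horizontal shifts, the
  correlation of \<open>u\<close> with a translate of \<open>v\<close> does not depend on the
  translation. Its ergodic averages are therefore constant and equal to their limit.\<close>

lemma independent:
  assumes \<psi>: "imean \<psi>" "erg \<psi>" and u: "cyl m u" "\<And>t \<omega>. u (tau (0, t) \<omega>) = u \<omega>"
    and v: "cyl m v" "\<And>t \<omega>. v (tau (t, 0) \<omega>) = v \<omega>"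
  shows "\<psi> (\<lambda>\<omega>. u \<omega> * v \<omega>) = \<psi> u * \<psi> v"
proof -
  have bu: "bddf u" and bv: "bddf v" using u v by auto
  have shift: "\<psi> (\<lambda>\<omega>. u \<omega> * v (tau e \<omega>)) = \<psi> (\<lambda>\<omega>. u \<omega> * v \<omega>)" for e
  proof -
    obtain s t where e: "e = (s, t)" by (cases e)
    have "v (tau e \<omega>) = v (tau (0, t) \<omega>)" for \<omega>
      using v(2)[of s "tau (0, t) \<omega>"] by (simp add: e)
    moreover have "u \<omega> = u (tau (0, t) \<omega>)" for \<omega> using u(2) by simp
    ultimately have "\<psi> (\<lambda>\<omega>. u \<omega> * v (tau e \<omega>)) = \<psi> (\<lambda>\<omega>. u (tau (0, t) \<omega>) * v (tau (0, t) \<omega>))"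
      by simp
    also have "\<dots> = \<psi> (\<lambda>\<omega>. u \<omega> * v \<omega>)"
      using mean_shift_pair[OF \<psi>(1) bu bv, of "(0, t)" "(0, t)"] by simp
    finally show ?thesis .
  qed
  have le: "\<bar>\<psi> (\<lambda>\<omega>. u \<omega> * v \<omega>) - \<psi> u * \<psi> v\<bar> \<le> \<epsilon>" if \<epsilon>: "\<epsilon> > 0" for \<epsilon>
  proof -
    obtain K where K: "K > 0" and *: "\<And>K' s. K' \<ge> K \<Longrightarrow>
      \<bar>(\<Sum>j\<in>grid K'. \<psi> (\<lambda>\<omega>. u \<omega> * v (tau (s + j) \<omega>))) / (real K')\<^sup>2 - \<psi> u * \<psi> v\<bar> \<le> \<epsilon>"
      by (rule ergD[OF \<psi>(2) u(1) v(1) \<epsilon>]) blast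
    show ?thesis using *[OF order_refl, of 0] K unfolding shift by (simp add: power2_eq_square)
  qed
  have "\<bar>\<psi> (\<lambda>\<omega>. u \<omega> * v \<omega>) - \<psi> u * \<psi> v\<bar> \<le> 0"
    by (rule field_le_epsilon) (simp add: le)
  then show ?thesis by simp
qed

text \<open>The lines at \<open>- i\<close> and \<open>j + l\<close> have distance
  \<open>i + j + l\<close>. Summing over the common pattern \<beta> turns the kernel into an average
  of \<open>2 ^ m\<close> products, each of which is absorbed into \<open>u\<close> and
  \<open>v\<close>.\<close>

lemma schur_gam:
  assumes \<psi>: "imean \<psi>"
  shows "schur (2 ^ m) (gam \<psi> m)"
proof (rule schurI)
  note M = imean_mean[OF \<psi>]
  fix l :: int and I G and u v :: "int \<Rightarrow> real"
  assume uv: "\<And>i. \<bar>u i\<bar> \<le> 1" "\<And>j. \<bar>v j\<bar> \<le> 1"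
  let ?I = "{0..<int I}"
  define b where "b \<beta> \<omega> = bil I G (\<lambda>i. u i * ia 1 m (- i) \<beta> \<omega>) (\<lambda>j. v j * ia 1 m (j + l) \<beta> \<omega>)" for \<beta> \<omega>
  have b: "\<bar>b \<beta> \<omega>\<bar> \<le> cut I G" for \<beta> \<omega>
    unfolding b_def
  proof (rule abs_bil_le_cut)
    show "\<bar>u i * ia 1 m (- i) \<beta> \<omega>\<bar> \<le> 1" for i using mult_mono'[OF uv(1)[of i] abs_ia] by (simp add: abs_mult)
    show "\<bar>v j * ia 1 m (j + l) \<beta> \<omega>\<bar> \<le> 1" for j using mult_mono'[OF uv(2)[of j] abs_ia] by (simp add: abs_mult)
  qed
  have bb: "bddf (b \<beta>)" for \<beta> using b by (rule bddfI)
  define E where "E i j \<omega> = (of_bool (atm 1 m (- i) \<omega> = atm 1 m (j + l) \<omega>) :: real)" for i j \<omega>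
  have bE: "bddf (E i j)" for i j unfolding E_def by (rule bddf_of_bool)
  have g: "gam \<psi> m (i + j + l) = \<psi> (E i j)" for i j
    unfolding E_def by (subst gam_eq[OF \<psi>]) (simp add: add_ac)
  have "bil I (\<lambda>i j. G i j * gam \<psi> m (i + j + l)) u v
      = \<psi> (\<lambda>\<omega>. \<Sum>i\<in>?I. \<Sum>j\<in>?I. G i j * u i * v j * E i j \<omega>)"
    unfolding bil_def g by (simp add: bE mean_sum[OF M] mean_cmult[OF M] bddf_simps mult_ac)
  also have "(\<lambda>\<omega>. \<Sum>i\<in>?I. \<Sum>j\<in>?I. G i j * u i * v j * E i j \<omega>)
      = (\<lambda>\<omega>. \<Sum>\<beta>\<in>Pow {..<m}. b \<beta> \<omega>)"
  proof
    fix \<omega>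
    have "(\<Sum>\<beta>\<in>Pow {..<m}. b \<beta> \<omega>)
       = (\<Sum>\<beta>\<in>Pow {..<m}. \<Sum>i\<in>?I. \<Sum>j\<in>?I. G i j * u i * v j * (ia 1 m (- i) \<beta> \<omega> * ia 1 m (j + l) \<beta> \<omega>))"
      by (simp add: b_def bil_def mult_ac)
    also have "\<dots> = (\<Sum>i\<in>?I. \<Sum>\<beta>\<in>Pow {..<m}. \<Sum>j\<in>?I. G i j * u i * v j * (ia 1 m (- i) \<beta> \<omega> * ia 1 m (j + l) \<beta> \<omega>))"
      by (rule sum.swap)
    also have "\<dots> = (\<Sum>i\<in>?I. \<Sum>j\<in>?I. \<Sum>\<beta>\<in>Pow {..<m}. G i j * u i * v j * (ia 1 m (- i) \<beta> \<omega> * ia 1 m (j + l) \<beta> \<omega>))"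
      by (intro sum.cong refl sum.swap)
    finally show "(\<Sum>i\<in>?I. \<Sum>j\<in>?I. G i j * u i * v j * E i j \<omega>)
        = (\<Sum>\<beta>\<in>Pow {..<m}. b \<beta> \<omega>)"
      by (simp only: sum_distrib_left[symmetric] sum_ia_mult_ia E_def)
  qed
  also have "\<psi> (\<lambda>\<omega>. \<Sum>\<beta>\<in>Pow {..<m}. b \<beta> \<omega>) = (\<Sum>\<beta>\<in>Pow {..<m}. \<psi> (b \<beta>))"
    by (rule mean_sum[OF M bb])
  also have "\<dots> \<le> (\<Sum>\<beta>\<in>Pow {..<m}. cut I G)"
    using mean_bound[OF M b] by (intro sum_mono) (simp add: abs_le_iff)
  also have "\<dots> = 2 ^ m * cut I G" by (simp add: card_Pow)
  finally show "bil I (\<lambda>i j. G i j * gam \<psi> m (i + j + l)) u v \<le> 2 ^ m * cut I G" .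
qed simp

text \<open>Lists instead of finite sets: the differences of a list are counted with multiplicity,
  and a list is joined with a translate that may overlap it.\<close>

definition avg2 :: "int list \<Rightarrow> (int \<Rightarrow> int \<Rightarrow> real) \<Rightarrow> real" where
  "avg2 xs f = (\<Sum>s\<leftarrow>xs. \<Sum>t\<leftarrow>xs. f s t) / (real (length xs))\<^sup>2"

lemma avg2_add: "avg2 xs (\<lambda>s t. f s t + g s t) = avg2 xs f + avg2 xs g"
  by (simp add: avg2_def sum_list_addf add_divide_distrib)

lemma avg2_cmult: "avg2 xs (\<lambda>s t. c * f s t) = c * avg2 xs f"
  by (simp add: avg2_def sum_list_const_mult)

lemma avg2_diff: "avg2 xs (\<lambda>s t. f s t - g s t) = avg2 xs f - avg2 xs g"
  using avg2_add[of xs f "\<lambda>s t. (-1) * g s t"] unfolding avg2_cmult by simp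

lemma avg2_mono: "(\<And>s t. f s t \<le> g s t) \<Longrightarrow> avg2 xs f \<le> avg2 xs g"
  unfolding avg2_def by (intro divide_right_mono sum_list_mono) auto

lemma avg2_const: "xs \<noteq> [] \<Longrightarrow> avg2 xs (\<lambda>_ _. c) = c"
  by (simp add: avg2_def sum_list_triv power2_eq_square)

lemma sum_list_swap: "(\<Sum>s\<leftarrow>xs. \<Sum>t\<leftarrow>ys. f s t) = (\<Sum>t\<leftarrow>ys. \<Sum>s\<leftarrow>xs. (f s t :: real))"
  by (induction xs) (simp_all add: sum_list_addf)

lemma avg2_swap: "avg2 xs (\<lambda>s t. f t s) = avg2 xs f"
  unfolding avg2_def by (subst sum_list_swap) simp

lemma avg2_square_sum:
  assumes M: "mean \<psi>" and f: "\<And>s. bddf (f s)"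
  shows "\<psi> (\<lambda>\<omega>. ((\<Sum>s\<leftarrow>xs. f s \<omega>) / real (length xs))\<^sup>2) = avg2 xs (\<lambda>s t. \<psi> (\<lambda>\<omega>. f s \<omega> * f t \<omega>))"
proof -
  have eq: "((\<Sum>s\<leftarrow>xs. f s \<omega>) / real (length xs))\<^sup>2
      = (\<Sum>s\<leftarrow>xs. \<Sum>t\<leftarrow>xs. f s \<omega> * f t \<omega>) / (real (length xs))\<^sup>2" for \<omega>
    by (simp add: power_divide power2_eq_square sum_list_const_mult sum_list_mult_const)
  have "\<psi> (\<lambda>\<omega>. (\<Sum>s\<leftarrow>xs. \<Sum>t\<leftarrow>xs. f s \<omega> * f t \<omega>) / (real (length xs))\<^sup>2)
      = (\<Sum>s\<leftarrow>xs. \<Sum>t\<leftarrow>xs. \<psi> (\<lambda>\<omega>. f s \<omega> * f t \<omega>)) / (real (length xs))\<^sup>2"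
    using f by (simp add: mean_divide[OF M] mean_sum_list[OF M] bddf_simps)
  then show ?thesis by (simp add: eq avg2_def)
qed

text \<open>Small values mark \<open>n\<close> as a return time. Averaging over the differences of a
  finite list, not over all integers, keeps this a polynomial in translates of \<gamma>, hence a
  Schur multiplier when \<gamma> is \<open>gam\<close>.\<close>

definition dd :: "(int \<Rightarrow> real) \<Rightarrow> int list \<Rightarrow> int \<Rightarrow> real" where
  "dd \<gamma> xs n = avg2 xs (\<lambda>s t. (\<gamma> (s - t) - \<gamma> (s - t + n))\<^sup>2)"

definition tri :: "((site set \<Rightarrow> real) \<Rightarrow> real) \<Rightarrow> nat \<Rightarrow> nat set \<Rightarrow> nat set \<Rightarrow> nat set \<Rightarrow> int \<Rightarrow> real" where
  "tri \<psi> m \<alpha> \<beta> \<zeta> n = \<psi> (\<lambda>\<omega>. ia 0 m 0 \<alpha> \<omega> * ia 1 m n \<beta> \<omega> * ia 2 m 0 \<zeta> \<omega>)"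

lemma tri_shift:
  assumes "imean \<psi>"
  shows "\<psi> (\<lambda>\<omega>. ia 0 m s \<alpha> \<omega> * ia 1 m (n - s) \<beta> \<omega> * ia 2 m 0 \<zeta> \<omega>) = tri \<psi> m \<alpha> \<beta> \<zeta> n"
proof -
  have "bddf (\<lambda>\<omega>. ia 0 m 0 \<alpha> \<omega> * ia 1 m n \<beta> \<omega> * ia 2 m 0 \<zeta> \<omega>)" by (intro bddf_mult bddf_ia)
  from imean_tau[OF assms this, of "(s, - s)"] show ?thesis by (simp add: tri_def)
qed

text \<open>Shifting the base point along the lines of type \<open>0\<close> averages out everything about the
  configuration on the lines of type \<open>1\<close> except its correlation function \<open>gam\<close>.\<close>

lemma tri_diff_le:
  assumes \<psi>: "imean \<psi>" "erg \<psi>" and xs: "xs \<noteq> []" and \<beta>: "\<beta> \<subseteq> {..<m}"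
  shows "(tri \<psi> m \<alpha> \<beta> \<zeta> n - tri \<psi> m \<alpha> \<beta> \<zeta> 0)\<^sup>2
    \<le> avg2 xs (\<lambda>s t. \<bar>2 * gam \<psi> m (s - t) - gam \<psi> m (s - t + n) - gam \<psi> m (s - t - n)\<bar>)"
proof -
  note M = imean_mean[OF \<psi>(1)]
  define \<Delta> where "\<Delta> \<beta> s \<omega> = ia 1 m (n - s) \<beta> \<omega> - ia 1 m (- s) \<beta> \<omega>" for \<beta> s \<omega>
  \<comment> \<open>By \<open>tri_shift\<close> every base point \<open>s\<close> gives the same
    difference of correlations, while the factor on the line of type 2 does not move. So one may
    average over \<open>s\<close> and discard that factor by Cauchy-Schwarz.\<close>
  define f where "f \<beta> s \<omega> = ia 0 m s \<alpha> \<omega> * \<Delta> \<beta> s \<omega>" for \<beta> s \<omega>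
  define X where "X \<beta> \<omega> = (\<Sum>s\<leftarrow>xs. f \<beta> s \<omega>) / real (length xs)" for \<beta> \<omega>
  have b\<Delta>: "bddf (\<Delta> \<beta> s)" for \<beta> s unfolding \<Delta>_def by (intro bddf_diff bddf_ia)
  have bff: "bddf (f \<beta> s)" for \<beta> s unfolding f_def by (intro bddf_mult bddf_ia b\<Delta>)
  have bX: "bddf (X \<beta>)" for \<beta> unfolding X_def by (intro bddf_divide bddf_sum_list bff)
  have fs: "\<psi> (\<lambda>\<omega>. f \<beta> s \<omega> * ia 2 m 0 \<zeta> \<omega>) = tri \<psi> m \<alpha> \<beta> \<zeta> n - tri \<psi> m \<alpha> \<beta> \<zeta> 0" for s
  proof -
    have "(\<lambda>\<omega>. f \<beta> s \<omega> * ia 2 m 0 \<zeta> \<omega>) = (\<lambda>\<omega>. ia 0 m s \<alpha> \<omega> * ia 1 m (n - s) \<beta> \<omega> * ia 2 m 0 \<zeta> \<omega>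
        - ia 0 m s \<alpha> \<omega> * ia 1 m (0 - s) \<beta> \<omega> * ia 2 m 0 \<zeta> \<omega>)"
      by (simp add: f_def \<Delta>_def algebra_simps)
    then show ?thesis
      by (simp only: mean_diff[OF M] bddf_mult bddf_ia tri_shift[OF \<psi>(1)])
  qed
  have "\<psi> (\<lambda>\<omega>. X \<beta> \<omega> * ia 2 m 0 \<zeta> \<omega>) = \<psi> (\<lambda>\<omega>. (\<Sum>s\<leftarrow>xs. f \<beta> s \<omega> * ia 2 m 0 \<zeta> \<omega>) / real (length xs))"
    by (simp add: X_def sum_list_mult_const)
  also have "\<dots> = (\<Sum>s\<leftarrow>xs. \<psi> (\<lambda>\<omega>. f \<beta> s \<omega> * ia 2 m 0 \<zeta> \<omega>)) / real (length xs)"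
  proof -
    have b: "bddf (\<lambda>\<omega>. f \<beta> s \<omega> * ia 2 m 0 \<zeta> \<omega>)" for s by (intro bddf_mult bff bddf_ia)
    show ?thesis by (simp only: mean_divide[OF M bddf_sum_list[OF b]] mean_sum_list[OF M b])
  qed
  also have "\<dots> = tri \<psi> m \<alpha> \<beta> \<zeta> n - tri \<psi> m \<alpha> \<beta> \<zeta> 0"
    unfolding fs using xs by (simp add: sum_list_triv)
  finally have "(tri \<psi> m \<alpha> \<beta> \<zeta> n - tri \<psi> m \<alpha> \<beta> \<zeta> 0)\<^sup>2 = (\<psi> (\<lambda>\<omega>. X \<beta> \<omega> * ia 2 m 0 \<zeta> \<omega>))\<^sup>2"
    by (rule arg_cong[where f = "\<lambda>x. x\<^sup>2", OF sym])
  also have "\<dots> \<le> \<psi> (\<lambda>\<omega>. (X \<beta> \<omega>)\<^sup>2)"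
    by (rule mean_cauchy_schwarz_le_one[OF M bX abs_ia])
  \<comment> \<open>The other patterns only increase the bound, and the sum over all patterns
    collapses to equality events, that is, to values of \<open>gam\<close>.\<close>
  also have "\<dots> \<le> (\<Sum>\<beta>\<in>Pow {..<m}. \<psi> (\<lambda>\<omega>. (X \<beta> \<omega>)\<^sup>2))"
    using \<beta> by (intro member_le_sum[where f = "\<lambda>\<beta>. \<psi> (\<lambda>\<omega>. (X \<beta> \<omega>)\<^sup>2)"] mean_nonneg[OF M] bddf_power bX) auto
  also have "\<dots> = (\<Sum>\<beta>\<in>Pow {..<m}. avg2 xs (\<lambda>s t. \<psi> (\<lambda>\<omega>. f \<beta> s \<omega> * f \<beta> t \<omega>)))"
    unfolding X_def by (simp only: avg2_square_sum[OF M bff])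
  also have "\<dots> = (\<Sum>\<beta>\<in>Pow {..<m}. avg2 xs (\<lambda>s t. \<psi> (\<lambda>\<omega>. ia 0 m s \<alpha> \<omega> * ia 0 m t \<alpha> \<omega>) * \<psi> (\<lambda>\<omega>. \<Delta> \<beta> s \<omega> * \<Delta> \<beta> t \<omega>)))"
  proof -
    have "\<psi> (\<lambda>\<omega>. f \<beta> s \<omega> * f \<beta> t \<omega>) = \<psi> (\<lambda>\<omega>. ia 0 m s \<alpha> \<omega> * ia 0 m t \<alpha> \<omega>) * \<psi> (\<lambda>\<omega>. \<Delta> \<beta> s \<omega> * \<Delta> \<beta> t \<omega>)" for \<beta> s t
    proof -
      have "\<psi> (\<lambda>\<omega>. f \<beta> s \<omega> * f \<beta> t \<omega>) = \<psi> (\<lambda>\<omega>. (ia 0 m s \<alpha> \<omega> * ia 0 m t \<alpha> \<omega>) * (\<Delta> \<beta> s \<omega> * \<Delta> \<beta> t \<omega>))"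
        by (simp add: f_def mult_ac)
      also have "\<dots> = \<psi> (\<lambda>\<omega>. ia 0 m s \<alpha> \<omega> * ia 0 m t \<alpha> \<omega>) * \<psi> (\<lambda>\<omega>. \<Delta> \<beta> s \<omega> * \<Delta> \<beta> t \<omega>)"
        by (rule independent[OF \<psi>, of m]) (simp_all add: \<Delta>_def cyl_mult cyl_diff)
      finally show ?thesis .
    qed
    then show ?thesis by simp
  qed
  also have "\<dots> = avg2 xs (\<lambda>s t. \<psi> (\<lambda>\<omega>. ia 0 m s \<alpha> \<omega> * ia 0 m t \<alpha> \<omega>) * (\<Sum>\<beta>\<in>Pow {..<m}. \<psi> (\<lambda>\<omega>. \<Delta> \<beta> s \<omega> * \<Delta> \<beta> t \<omega>)))"
  proof -
    have "(\<Sum>\<beta>\<in>B. avg2 xs (g \<beta>)) = avg2 xs (\<lambda>s t. \<Sum>\<beta>\<in>B. g \<beta> s t)" for B :: "nat set set" and g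
      by (induction B rule: infinite_finite_induct) (simp_all add: avg2_add, simp_all add: avg2_def)
    then show ?thesis by (simp add: sum_distrib_left)
  qed
  also have "\<dots> \<le> avg2 xs (\<lambda>s t. \<bar>2 * gam \<psi> m (s - t) - gam \<psi> m (s - t + n) - gam \<psi> m (s - t - n)\<bar>)"
  proof (rule avg2_mono)
    fix s t
    let ?e = "\<lambda>a b \<omega>. of_bool (atm 1 m a \<omega> = atm 1 m b \<omega>) :: real"
    have "(\<Sum>\<beta>\<in>Pow {..<m}. \<psi> (\<lambda>\<omega>. \<Delta> \<beta> s \<omega> * \<Delta> \<beta> t \<omega>)) = \<psi> (\<lambda>\<omega>. \<Sum>\<beta>\<in>Pow {..<m}. \<Delta> \<beta> s \<omega> * \<Delta> \<beta> t \<omega>)"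
      by (rule mean_sum[OF M, symmetric]) (intro bddf_mult b\<Delta>)
    also have "(\<lambda>\<omega>. \<Sum>\<beta>\<in>Pow {..<m}. \<Delta> \<beta> s \<omega> * \<Delta> \<beta> t \<omega>)
        = (\<lambda>\<omega>. (?e (n - s) (n - t) \<omega> - ?e (- s) (n - t) \<omega>) - (?e (n - s) (- t) \<omega> - ?e (- s) (- t) \<omega>))"
      unfolding \<Delta>_def left_diff_distrib right_diff_distrib sum_subtractf sum_ia_mult_ia ..
    also have "\<psi> \<dots> = (\<psi> (?e (n - s) (n - t)) - \<psi> (?e (- s) (n - t))) - (\<psi> (?e (n - s) (- t)) - \<psi> (?e (- s) (- t)))"
      by (simp only: mean_diff[OF M] bddf_diff bddf_of_bool)
    also have "\<dots> = 2 * gam \<psi> m (s - t) - gam \<psi> m (s - t + n) - gam \<psi> m (s - t - n)"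
      unfolding gam_eq[OF \<psi>(1)] by (simp add: algebra_simps)
    finally have e: "(\<Sum>\<beta>\<in>Pow {..<m}. \<psi> (\<lambda>\<omega>. \<Delta> \<beta> s \<omega> * \<Delta> \<beta> t \<omega>))
      = 2 * gam \<psi> m (s - t) - gam \<psi> m (s - t + n) - gam \<psi> m (s - t - n)" .
    have "\<bar>\<psi> (\<lambda>\<omega>. ia 0 m s \<alpha> \<omega> * ia 0 m t \<alpha> \<omega>)\<bar> \<le> 1"
      by (rule mean_bound[OF M]) (simp add: ia_def)
    then have "\<bar>\<psi> (\<lambda>\<omega>. ia 0 m s \<alpha> \<omega> * ia 0 m t \<alpha> \<omega>) * (2 * gam \<psi> m (s - t) - gam \<psi> m (s - t + n) - gam \<psi> m (s - t - n))\<bar>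
      \<le> 1 * \<bar>2 * gam \<psi> m (s - t) - gam \<psi> m (s - t + n) - gam \<psi> m (s - t - n)\<bar>"
      unfolding abs_mult by (rule mult_right_mono) simp
    then show "\<psi> (\<lambda>\<omega>. ia 0 m s \<alpha> \<omega> * ia 0 m t \<alpha> \<omega>) * (\<Sum>\<beta>\<in>Pow {..<m}. \<psi> (\<lambda>\<omega>. \<Delta> \<beta> s \<omega> * \<Delta> \<beta> t \<omega>))
      \<le> \<bar>2 * gam \<psi> m (s - t) - gam \<psi> m (s - t + n) - gam \<psi> m (s - t - n)\<bar>"
      unfolding e mult_1 by (rule order_trans[OF abs_ge_self])
  qed
  finally show ?thesis .
qed

lemma tri_diff_le_of_dd:
  assumes \<psi>: "imean \<psi>" "erg \<psi>" and xs: "xs \<noteq> []" and \<beta>: "\<beta> \<subseteq> {..<m}" and t: "t > 0"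
    and d: "dd (gam \<psi> m) xs n \<le> t\<^sup>2"
  shows "(tri \<psi> m \<alpha> \<beta> \<zeta> n - tri \<psi> m \<alpha> \<beta> \<zeta> 0)\<^sup>2 \<le> 2 * t"
proof -
  let ?g = "gam \<psi> m"
  have "(tri \<psi> m \<alpha> \<beta> \<zeta> n - tri \<psi> m \<alpha> \<beta> \<zeta> 0)\<^sup>2 \<le> avg2 xs (\<lambda>s t. \<bar>2 * ?g (s - t) - ?g (s - t + n) - ?g (s - t - n)\<bar>)"
    by (rule tri_diff_le[OF \<psi> xs \<beta>])
  also have "\<dots> \<le> avg2 xs (\<lambda>s t. \<bar>?g (s - t) - ?g (s - t + n)\<bar> + \<bar>?g (s - t) - ?g (s - t - n)\<bar>)"
    by (rule avg2_mono) linarith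
  also have "\<dots> = avg2 xs (\<lambda>s t. \<bar>?g (s - t) - ?g (s - t + n)\<bar>) + avg2 xs (\<lambda>s t. \<bar>?g (s - t) - ?g (s - t - n)\<bar>)"
    by (rule avg2_add)
  also have "avg2 xs (\<lambda>s t. \<bar>?g (s - t) - ?g (s - t - n)\<bar>) = avg2 xs (\<lambda>s t. \<bar>?g (s - t) - ?g (s - t + n)\<bar>)"
  proof -
    have "?g (s - t) = ?g (t - s)" "?g (s - t - n) = ?g (t - s + n)" for s t
      using gam_uminus[OF \<psi>(1), of m "s - t"] gam_uminus[OF \<psi>(1), of m "s - t - n"] by (simp_all add: algebra_simps)
    then show ?thesis using avg2_swap[of xs "\<lambda>s t. \<bar>?g (s - t) - ?g (s - t + n)\<bar>"] by simp
  qed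
  \<comment> \<open>Young's inequality
    \<open>\<bar>y\<bar> \<le> y\<^sup>2 / (2 * t) + t / 2\<close>; as the average of
    \<open>y\<^sup>2\<close> is at most \<open>t\<^sup>2\<close>, both terms contribute at most
    \<open>t / 2\<close>.\<close>
  also have "avg2 xs (\<lambda>s t. \<bar>?g (s - t) - ?g (s - t + n)\<bar>) \<le> avg2 xs (\<lambda>s t'. 1 / (2 * t) * (?g (s - t') - ?g (s - t' + n))\<^sup>2 + t / 2)"
  proof (rule avg2_mono)
    fix s t'
    have "0 \<le> (\<bar>y\<bar> - t)\<^sup>2 / (2 * t)" for y using t by simp
    also have "(\<bar>y\<bar> - t)\<^sup>2 / (2 * t) = 1 / (2 * t) * y\<^sup>2 + t / 2 - \<bar>y\<bar>" for y
      using t by (simp add: power2_eq_square field_simps)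
    finally show "\<bar>?g (s - t') - ?g (s - t' + n)\<bar> \<le> 1 / (2 * t) * (?g (s - t') - ?g (s - t' + n))\<^sup>2 + t / 2"
      by (smt (verit))
  qed
  also have "\<dots> = 1 / (2 * t) * dd ?g xs n + t / 2"
    unfolding avg2_add avg2_cmult avg2_const[OF xs] dd_def ..
  also have "\<dots> \<le> t"
  proof -
    have "1 / (2 * t) * dd ?g xs n \<le> 1 / (2 * t) * t\<^sup>2" using d t by (intro mult_left_mono) auto
    also have "\<dots> = t / 2" using t by (simp add: power2_eq_square)
    finally show ?thesis by simp
  qed
  finally show ?thesis by simp
qed

section \<open>Return times\<close>

text \<open>The kernel \<open>(s, t) \<mapsto> \<gamma> (s - t)\<^sup>2\<close> is realised on two independent copies of the system, where it
  is visibly positive definite. Both bounds come from the vectors indexed by pairs of atoms.\<close>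

lemma square_kernel_bound:
  fixes m :: nat
  assumes \<psi>: "imean \<psi>" and xs: "xs \<noteq> []"
  defines "\<gamma> \<equiv> gam \<psi> m"
  defines "B \<equiv> \<lambda>t. avg2 xs (\<lambda>h h'. 2 * (\<gamma> (h - h'))\<^sup>2 - (\<gamma> (h - h' - t))\<^sup>2 - (\<gamma> (h - h' + t))\<^sup>2)"
  shows "((\<Sum>h\<leftarrow>xs. \<gamma> (h + a) * \<gamma> (h + b) - \<gamma> (h + t + a) * \<gamma> (h + t + b)) / real (length xs))\<^sup>2 \<le> B t"
proof -
  note M = imean_mean[OF \<psi>]
  define \<Psi> where "\<Psi> f = \<psi> (\<lambda>\<omega>. \<psi> (\<lambda>\<omega>'. f (\<omega>, \<omega>')))" for f
  have M2: "mean \<Psi>" unfolding \<Psi>_def[abs_def] by (rule mean_iterated[OF M M])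
  define P where "P = Pow {..<m} \<times> Pow {..<m}"
  define z where "z p h w = ia 1 m h (fst p) (fst w) * ia 1 m h (snd p) (snd w)" for p h and w :: "site set \<times> site set"
  define f where "f p h w = z p h w - z p (h + t) w" for p h w
  define A where "A p w = (\<Sum>h\<leftarrow>xs. f p h w) / real (length xs)" for p w
  \<comment> \<open>The pair of patterns found on the lines \<open>- a\<close> and
    \<open>- b\<close> of the two copies. With this random index, \<open>z\<close> tests whether the
    line \<open>h\<close> repeats both patterns, which has mean
    \<open>\<gamma> (h + a) * \<gamma> (h + b)\<close>.\<close>
  define cell where "cell w = (atm 1 m (- a) (fst w), atm 1 m (- b) (snd w))" for w :: "site set \<times> site set"
  have b1: "bddf (\<lambda>w. ia 1 m h \<beta> (fst w))" "bddf (\<lambda>w. ia 1 m h \<beta> (snd w))" for h \<beta> and w :: "site set \<times> site set"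
    by (rule bddfI[of _ 1], rule abs_ia)+
  have bz: "bddf (z p h)" for p h unfolding z_def by (intro bddf_mult b1)
  have bf: "bddf (f p h)" for p h unfolding f_def by (intro bddf_diff bz)
  have bA: "bddf (A p)" for p unfolding A_def by (intro bddf_divide bddf_sum_list bf)
  have finP: "finite P" by (simp add: P_def)
  define e where "e h h' w = of_bool (atm 1 m h (fst w) = atm 1 m h' (fst w)) * (of_bool (atm 1 m h (snd w) = atm 1 m h' (snd w)) :: real)"
    for h h' and w :: "site set \<times> site set"
  have be: "bddf (e h h')" for h h' unfolding e_def by (intro bddf_mult bddf_of_bool)
  have \<Psi>_prod: "\<Psi> (\<lambda>w. u (fst w) * v (snd w)) = \<psi> u * \<psi> v" if "bddf u" "bddf v" for u v
    using that by (simp add: \<Psi>_def mean_cmult[OF M] mean_multc[OF M])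
  have \<Psi>e: "\<Psi> (e h h') = (\<gamma> (h - h'))\<^sup>2" for h h'
  proof -
    have "\<Psi> (e h h') = gam \<psi> m (h' - h) * gam \<psi> m (h' - h)"
      unfolding e_def gam_eq[OF \<psi>, symmetric] by (rule \<Psi>_prod) auto
    then show ?thesis using gam_uminus[OF \<psi>, of m "h - h'"] by (simp add: \<gamma>_def power2_eq_square)
  qed
  have sum_z: "(\<Sum>p\<in>P. z p h w * z p h' w) = e h h' w" for h h' w
  proof -
    have "(\<Sum>p\<in>P. z p h w * z p h' w) = (\<Sum>\<beta>\<in>Pow {..<m}. \<Sum>\<beta>'\<in>Pow {..<m}.
        (ia 1 m h \<beta> (fst w) * ia 1 m h' \<beta> (fst w)) * (ia 1 m h \<beta>' (snd w) * ia 1 m h' \<beta>' (snd w)))"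
      unfolding P_def z_def sum.cartesian_product by (rule sum.cong) (auto simp: mult_ac)
    also have "\<dots> = e h h' w"
      unfolding sum_product[symmetric] sum_ia_mult_ia e_def ..
    finally show ?thesis .
  qed
  have sum_f: "(\<Sum>p\<in>P. f p h w * f p h' w) = (e h h' w - e (h + t) h' w) - (e h (h' + t) w - e (h + t) (h' + t) w)" for h h' w
    unfolding f_def left_diff_distrib right_diff_distrib sum_subtractf sum_z ..
  have "(\<Sum>p\<in>P. \<Psi> (\<lambda>w. (A p w)\<^sup>2)) = (\<Sum>p\<in>P. avg2 xs (\<lambda>h h'. \<Psi> (\<lambda>w. f p h w * f p h' w)))"
    unfolding A_def by (simp only: avg2_square_sum[OF M2 bf])
  also have "\<dots> = avg2 xs (\<lambda>h h'. \<Sum>p\<in>P. \<Psi> (\<lambda>w. f p h w * f p h' w))"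
    by (induction P rule: infinite_finite_induct) (simp_all add: avg2_add, simp_all add: avg2_def)
  also have "\<dots> = B t"
    unfolding B_def
  proof (rule arg_cong[where f = "avg2 xs"], intro ext)
    fix h h'
    have "(\<Sum>p\<in>P. \<Psi> (\<lambda>w. f p h w * f p h' w)) = \<Psi> (\<lambda>w. \<Sum>p\<in>P. f p h w * f p h' w)"
      by (rule mean_sum[OF M2, symmetric]) (intro bddf_mult bf)
    also have "\<dots> = (\<Psi> (e h h') - \<Psi> (e (h + t) h')) - (\<Psi> (e h (h' + t)) - \<Psi> (e (h + t) (h' + t)))"
      by (simp only: sum_f mean_diff[OF M2] bddf_diff be)
    also have "\<dots> = 2 * (\<gamma> (h - h'))\<^sup>2 - (\<gamma> (h - h' - t))\<^sup>2 - (\<gamma> (h - h' + t))\<^sup>2"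
      unfolding \<Psi>e by (simp add: algebra_simps)
    finally show "(\<Sum>p\<in>P. \<Psi> (\<lambda>w. f p h w * f p h' w)) = 2 * (\<gamma> (h - h'))\<^sup>2 - (\<gamma> (h - h' - t))\<^sup>2 - (\<gamma> (h - h' + t))\<^sup>2" .
  qed
  finally have AB: "(\<Sum>p\<in>P. \<Psi> (\<lambda>w. (A p w)\<^sup>2)) = B t" .
  define A' where "A' w = (\<Sum>h\<leftarrow>xs. f (cell w) h w) / real (length xs)" for w
  have f_cell: "f (cell w) h w = (\<Sum>p\<in>P. of_bool (cell w = p) * f p h w)" for h w
  proof -
    have "(\<Sum>p\<in>P. of_bool (cell w = p) * f p h w) = (\<Sum>p\<in>P. if cell w = p then f (cell w) h w else 0)"
      by (rule sum.cong) auto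
    then show ?thesis using finP by (simp add: sum.delta cell_def P_def del: Pow_iff)
  qed
  have bfa: "bddf (\<lambda>w. f (cell w) h w)" for h unfolding f_cell by (intro bddf_sum bddf_mult bddf_of_bool bf)
  have bA': "bddf A'" unfolding A'_def by (intro bddf_divide bddf_sum_list bfa)
  have \<Psi>z: "\<Psi> (\<lambda>w. z (cell w) h w) = \<gamma> (h + a) * \<gamma> (h + b)" for h
  proof -
    have "\<Psi> (\<lambda>w. z (cell w) h w) = \<Psi> (\<lambda>w. of_bool (atm 1 m (- a) (fst w) = atm 1 m h (fst w)) * of_bool (atm 1 m (- b) (snd w) = atm 1 m h (snd w)))"
      by (simp add: z_def cell_def ia_def eq_commute)
    also have "\<dots> = gam \<psi> m (h - (- a)) * gam \<psi> m (h - (- b))"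
      unfolding gam_eq[OF \<psi>, symmetric] by (rule \<Psi>_prod) auto
    finally show ?thesis by (simp add: \<gamma>_def)
  qed
  have \<Psi>f: "\<Psi> (\<lambda>w. f (cell w) h w) = \<gamma> (h + a) * \<gamma> (h + b) - \<gamma> (h + t + a) * \<gamma> (h + t + b)" for h
  proof -
    have "bddf (\<lambda>w. z (cell w) h w)" for h
      by (rule bddfI[of _ 1]) (simp add: z_def ia_def)
    then show ?thesis unfolding f_def by (simp only: mean_diff[OF M2] \<Psi>z)
  qed
  have "\<Psi> A' = (\<Sum>h\<leftarrow>xs. \<Psi> (\<lambda>w. f (cell w) h w)) / real (length xs)"
    unfolding A'_def by (simp only: mean_divide[OF M2 bddf_sum_list[OF bfa]] mean_sum_list[OF M2 bfa])
  then have "((\<Sum>h\<leftarrow>xs. \<gamma> (h + a) * \<gamma> (h + b) - \<gamma> (h + t + a) * \<gamma> (h + t + b)) / real (length xs))\<^sup>2 = (\<Psi> A')\<^sup>2"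
    unfolding \<Psi>f by simp
  also have "\<dots> \<le> \<Psi> (\<lambda>w. (A' w)\<^sup>2)" by (rule mean_square[OF M2 bA'])
  \<comment> \<open>The square with the random index is one of the summands over \<open>P\<close>,
    and the full sum was computed in \<open>AB\<close>.\<close>
  also have "\<dots> \<le> \<Psi> (\<lambda>w. \<Sum>p\<in>P. (A p w)\<^sup>2)"
  proof (rule mean_mono[OF M2])
    fix w
    have "(A (cell w) w)\<^sup>2 \<le> (\<Sum>p\<in>P. (A p w)\<^sup>2)"
      by (rule member_le_sum[where f = "\<lambda>p. (A p w)\<^sup>2"]) (simp_all add: finP cell_def P_def del: Pow_iff)
    then show "(A' w)\<^sup>2 \<le> (\<Sum>p\<in>P. (A p w)\<^sup>2)" by (simp add: A_def A'_def)
  qed (intro bddf_power bA' bddf_sum bA)+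
  also have "\<dots> = B t" unfolding AB[symmetric] by (rule mean_sum[OF M2]) (intro bddf_power bA)
  finally show ?thesis .
qed

definition diffs :: "int list \<Rightarrow> int list" where
  "diffs xs = concat (map (\<lambda>s. map (\<lambda>t. s - t) xs) xs)"

lemma sum_list_diffs: "(\<Sum>h\<leftarrow>diffs xs. f h) = (\<Sum>s\<leftarrow>xs. \<Sum>t\<leftarrow>xs. (f (s - t) :: real))"
proof -
  have "(\<Sum>h\<leftarrow>concat (map (\<lambda>s. map (\<lambda>t. s - t) xs) ys). f h) = (\<Sum>s\<leftarrow>ys. \<Sum>t\<leftarrow>xs. f (s - t))" for ys
    by (induction ys) (simp_all add: o_def)
  then show ?thesis by (simp add: diffs_def)
qed

lemma length_diffs: "length (diffs xs) = (length xs)\<^sup>2"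
  by (simp add: diffs_def length_concat o_def sum_list_triv power2_eq_square)

lemma diffs_nonempty: "xs \<noteq> [] \<Longrightarrow> diffs xs \<noteq> []"
  using length_diffs[of xs] by (metis length_0_conv zero_eq_power2)

text \<open>A variational form of the mean ergodic theorem for the positive definite kernel
  \<open>b\<close>: take a list almost minimising the average \<open>N\<close>. Its list of
  differences \<open>F\<close> is almost minimal too, and joining \<open>F\<close> with a translate
  cannot go below the infimum. So translation hardly changes the average over \<open>F\<close>, and
  \<open>square_kernel_bound\<close> transfers this to products of translates of \<gamma>.\<close>

lemma shift_insensitive_average:
  fixes m :: nat
  assumes \<psi>: "imean \<psi>" and \<epsilon>: "\<epsilon> > 0"
  defines "\<gamma> \<equiv> gam \<psi> m"
  obtains xs where "xs \<noteq> []"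
    "\<And>a b t. \<bar>avg2 xs (\<lambda>s s'. \<gamma> (s - s' + a) * \<gamma> (s - s' + b)) - avg2 xs (\<lambda>s s'. \<gamma> (s - s' + t + a) * \<gamma> (s - s' + t + b))\<bar> \<le> \<epsilon>"
proof -
  define b where "b h = (\<gamma> h)\<^sup>2" for h
  define N where "N xs = avg2 xs (\<lambda>h h'. b (h - h'))" for xs
  define c where "c xs t = avg2 xs (\<lambda>h h'. b (h - h' + t))" for xs t
  have b_even: "b (- h) = b h" for h using gam_uminus[OF \<psi>] by (simp add: b_def \<gamma>_def)
  have c_minus: "avg2 xs (\<lambda>h h'. b (h - h' - t)) = c xs t" for xs t
  proof -
    have "b (h - h' - t) = b (h' - h + t)" for h h' using b_even[of "h - h' - t"] by (simp add: algebra_simps)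
    then show ?thesis unfolding c_def using avg2_swap[of xs "\<lambda>h h'. b (h - h' + t)"] by simp
  qed
  have bound: "((\<Sum>h\<leftarrow>xs. \<gamma> (h + a) * \<gamma> (h + a') - \<gamma> (h + t + a) * \<gamma> (h + t + a')) / real (length xs))\<^sup>2
      \<le> 2 * N xs - 2 * c xs t" if "xs \<noteq> []" for xs a a' t
  proof -
    have "avg2 xs (\<lambda>h h'. 2 * b (h - h') - b (h - h' - t) - b (h - h' + t)) = 2 * N xs - c xs t - c xs t"
      unfolding avg2_diff avg2_cmult N_def c_minus unfolding c_def ..
    then show ?thesis
      using square_kernel_bound[OF \<psi> that, where m = m and a = a and b = a' and t = t] by (simp add: \<gamma>_def[symmetric] b_def)
  qed
  have cN: "c xs t \<le> N xs" if "xs \<noteq> []" for xs t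
    using order_trans[OF zero_le_power2 bound[OF that, of 0 0 t]] by simp
  define S where "S = Inf (N ` {xs. xs \<noteq> []})"
  have N0: "0 \<le> N xs" for xs unfolding N_def avg2_def b_def
    by (intro divide_nonneg_nonneg sum_list_nonneg) (auto intro!: sum_list_nonneg)
  have bdd: "bdd_below (N ` {xs. xs \<noteq> []})" using N0 by (intro bdd_belowI[of _ 0]) auto
  have S_le: "S \<le> N xs" if "xs \<noteq> []" for xs unfolding S_def using that by (intro cInf_lower bdd) auto
  have ne: "N ` {xs. xs \<noteq> []} \<noteq> {}" by auto
  \<comment> \<open>The final bound is \<open>4 * (N F - S)\<close>, whence the tolerance
    \<open>\<epsilon>\<^sup>2 / 4\<close>.\<close>
  have "Inf (N ` {xs. xs \<noteq> []}) < S + \<epsilon>\<^sup>2 / 4" using \<epsilon> by (simp add: S_def)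
  then obtain xs where xs: "xs \<noteq> []" "N xs < S + \<epsilon>\<^sup>2 / 4"
    unfolding cInf_less_iff[OF ne bdd] by auto
  define F where "F = diffs xs"
  have F: "F \<noteq> []" unfolding F_def by (rule diffs_nonempty[OF xs(1)])
  have len: "real (length F) = (real (length xs))\<^sup>2" by (simp add: F_def length_diffs)
  have lp: "real (length xs) > 0" using xs(1) by simp
  \<comment> \<open>For fixed \<open>t\<close> and \<open>t'\<close> the sum over \<open>s\<close>
    and \<open>s'\<close> is a translated average over \<open>xs\<close>, which by \<open>cN\<close>
    is at most the untranslated one.\<close>
  have NF: "N F \<le> N xs"
  proof -
    have "(\<Sum>h\<leftarrow>F. \<Sum>h'\<leftarrow>F. b (h - h')) = (\<Sum>s\<leftarrow>xs. \<Sum>t\<leftarrow>xs. \<Sum>s'\<leftarrow>xs. \<Sum>t'\<leftarrow>xs. b (s - t - (s' - t')))"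
      unfolding F_def sum_list_diffs ..
    also have "\<dots> = (\<Sum>t\<leftarrow>xs. \<Sum>t'\<leftarrow>xs. \<Sum>s\<leftarrow>xs. \<Sum>s'\<leftarrow>xs. b (s - s' + (t' - t)))"
    proof -
      have "(\<Sum>s\<leftarrow>xs. \<Sum>t\<leftarrow>xs. \<Sum>s'\<leftarrow>xs. \<Sum>t'\<leftarrow>xs. b (s - t - (s' - t')))
          = (\<Sum>t\<leftarrow>xs. \<Sum>s\<leftarrow>xs. \<Sum>s'\<leftarrow>xs. \<Sum>t'\<leftarrow>xs. b (s - t - (s' - t')))"
        by (rule sum_list_swap)
      also have "\<dots> = (\<Sum>t\<leftarrow>xs. \<Sum>s\<leftarrow>xs. \<Sum>t'\<leftarrow>xs. \<Sum>s'\<leftarrow>xs. b (s - t - (s' - t')))"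
        by (intro arg_cong[where f = sum_list] map_cong refl sum_list_swap)
      also have "\<dots> = (\<Sum>t\<leftarrow>xs. \<Sum>t'\<leftarrow>xs. \<Sum>s\<leftarrow>xs. \<Sum>s'\<leftarrow>xs. b (s - t - (s' - t')))"
        by (intro arg_cong[where f = sum_list] map_cong refl sum_list_swap)
      finally show ?thesis by (simp add: algebra_simps)
    qed
    also have "\<dots> = (\<Sum>t\<leftarrow>xs. \<Sum>t'\<leftarrow>xs. c xs (t' - t)) * (real (length xs))\<^sup>2"
    proof -
      have "(\<Sum>s\<leftarrow>xs. \<Sum>s'\<leftarrow>xs. b (s - s' + t)) = c xs t * (real (length xs))\<^sup>2" for t
        using xs(1) by (simp add: c_def avg2_def)
      then show ?thesis by (simp only: sum_list_mult_const)
    qed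
    also have "\<dots> \<le> (\<Sum>t\<leftarrow>xs. \<Sum>t'\<leftarrow>xs. N xs) * (real (length xs))\<^sup>2"
      by (intro mult_right_mono sum_list_mono cN xs(1)) auto
    also have "\<dots> = N xs * (real (length F))\<^sup>2"
      by (simp add: sum_list_triv len power2_eq_square)
    finally show ?thesis
      unfolding N_def[of F] avg2_def using F by (simp add: divide_le_eq)
  qed
  \<comment> \<open>The join of \<open>F\<close> with its translate has the average
    \<open>(N F + c F t) / 2\<close>, which is at least the infimum \<open>S\<close>.\<close>
  have cF: "c F t \<ge> 2 * S - N F" for t
  proof -
    let ?F = "F @ map (\<lambda>h. h + t) F"
    have "(\<Sum>h\<leftarrow>?F. \<Sum>h'\<leftarrow>?F. b (h - h')) = 2 * (\<Sum>h\<leftarrow>F. \<Sum>h'\<leftarrow>F. b (h - h'))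
       + (\<Sum>h\<leftarrow>F. \<Sum>h'\<leftarrow>F. b (h - h' - t)) + (\<Sum>h\<leftarrow>F. \<Sum>h'\<leftarrow>F. b (h - h' + t))"
      by (simp add: sum_list_addf o_def algebra_simps)
    moreover have "(real (length ?F))\<^sup>2 = 4 * (real (length F))\<^sup>2" by (simp add: power2_eq_square)
    ultimately have "N ?F = (2 * N F + avg2 F (\<lambda>h h'. b (h - h' - t)) + c F t) / 4"
      unfolding N_def c_def avg2_def by (simp add: add_divide_distrib)
    then have "N ?F = (2 * N F + 2 * c F t) / 4" unfolding c_minus by simp
    moreover have "S \<le> N ?F" using F by (intro S_le) simp
    ultimately show ?thesis by simp
  qed
  show thesis
  proof (rule that[OF xs(1)])
    fix a a' t
    let ?d = "(\<Sum>h\<leftarrow>F. \<gamma> (h + a) * \<gamma> (h + a') - \<gamma> (h + t + a) * \<gamma> (h + t + a')) / real (length F)"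
    have "?d\<^sup>2 \<le> 2 * N F - 2 * c F t" by (rule bound[OF F])
    also have "\<dots> \<le> \<epsilon>\<^sup>2" using cF[of t] NF xs(2) by linarith
    finally have "\<bar>?d\<bar> \<le> \<epsilon>" using \<epsilon> by (simp add: abs_le_square_iff[symmetric])
    moreover have "?d = avg2 xs (\<lambda>s s'. \<gamma> (s - s' + a) * \<gamma> (s - s' + a')) - avg2 xs (\<lambda>s s'. \<gamma> (s - s' + t + a) * \<gamma> (s - s' + t + a'))"
      unfolding F_def sum_list_diffs avg2_diff[symmetric] length_diffs by (simp add: avg2_def)
    ultimately show "\<bar>avg2 xs (\<lambda>s s'. \<gamma> (s - s' + a) * \<gamma> (s - s' + a')) - avg2 xs (\<lambda>s s'. \<gamma> (s - s' + t + a) * \<gamma> (s - s' + t + a'))\<bar> \<le> \<epsilon>"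
      by simp
  qed
qed

text \<open>Arbitrarily long gaps between return times would allow arbitrarily many positions that
  are pairwise separated in \<open>V\<close>. This contradicts total boundedness: \<open>V\<close>
  depends on finitely many numbers in the unit interval for each position.\<close>

lemma syndetic_return:
  assumes \<psi>: "imean \<psi>" and \<delta>: "\<delta> > 0"
  obtains xs and N :: nat where "xs \<noteq> []" "N > 0" "\<And>M. \<exists>n\<in>{M..<M + int N}. dd (gam \<psi> m) xs n \<le> \<delta>"
proof -
  define \<gamma> where "\<gamma> = gam \<psi> m"
  have \<gamma>01: "0 \<le> \<gamma> h" "\<gamma> h \<le> 1" for h unfolding \<gamma>_def by (rule gam_bounds[OF \<psi>])+
  obtain xs where xs: "xs \<noteq> []" and inv: "\<And>a b t. \<bar>avg2 xs (\<lambda>s s'. \<gamma> (s - s' + a) * \<gamma> (s - s' + b))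
      - avg2 xs (\<lambda>s s'. \<gamma> (s - s' + t + a) * \<gamma> (s - s' + t + b))\<bar> \<le> \<delta> / 8"
    using shift_insensitive_average[OF \<psi>, of "\<delta> / 8" m] \<delta> unfolding \<gamma>_def by auto
  define V where "V x y = avg2 xs (\<lambda>s s'. (\<gamma> (s - s' + y) - \<gamma> (s - s' + x))\<^sup>2)" for x y
  \<comment> \<open>Expanding the squares leaves three products, each insensitive up to
    \<open>\<delta> / 8\<close> to a shift by \<open>y\<close>; the mixed one counts twice, which
    makes \<open>\<delta> / 2\<close> in all.\<close>
  have V: "dd \<gamma> xs (x - y) \<le> V x y + \<delta> / 2" for x y
  proof -
    let ?G = "\<lambda>a b. avg2 xs (\<lambda>s s'. \<gamma> (s - s' + a) * \<gamma> (s - s' + b))"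
    have ddG: "dd \<gamma> xs n = ?G 0 0 - 2 * ?G 0 n + ?G n n" for n
      unfolding dd_def avg2_cmult[symmetric] avg2_diff[symmetric] avg2_add[symmetric]
      by (simp add: power2_eq_square algebra_simps)
    have "V x y = ?G y y - 2 * ?G y x + ?G x x"
      unfolding V_def avg2_cmult[symmetric] avg2_diff[symmetric] avg2_add[symmetric]
      by (simp add: power2_eq_square algebra_simps)
    moreover have "\<bar>?G 0 0 - ?G y y\<bar> \<le> \<delta> / 8" using inv[of 0 0 y] by simp
    moreover have "\<bar>?G 0 (x - y) - ?G y x\<bar> \<le> \<delta> / 8" using inv[of 0 "x - y" y] by (simp add: algebra_simps)
    moreover have "\<bar>?G (x - y) (x - y) - ?G x x\<bar> \<le> \<delta> / 8" using inv[of "x - y" "x - y" y] by (simp add: algebra_simps)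
    ultimately show ?thesis using ddG[of "x - y"] by linarith
  qed
  have V_sym: "V x y = V y x" for x y unfolding V_def by (simp add: power2_commute)
  have "\<exists>N>0. \<forall>M. \<exists>n\<in>{M..<M + int N}. dd \<gamma> xs n \<le> \<delta>"
  proof (rule ccontr)
    assume "\<not> ?thesis"
    then have gap: "\<exists>M. \<forall>n\<in>{M..<M + int N}. dd \<gamma> xs n > \<delta>" if "N > 0" for N using that by (meson not_le)
    have exS: "\<exists>S. finite S \<and> card S = k \<and> (\<forall>x\<in>S. \<forall>y\<in>S. x \<noteq> y \<longrightarrow> V x y > \<delta> / 2)" for k
    proof (induction k)
      case 0
      then show ?case by (intro exI[of _ "{}"]) simp
    next
      case (Suc k)
      then obtain S where S: "finite S" "card S = k" "\<forall>x\<in>S. \<forall>y\<in>S. x \<noteq> y \<longrightarrow> V x y > \<delta> / 2" by blast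
      obtain B where B: "\<And>y. y \<in> S \<Longrightarrow> \<bar>y\<bar> \<le> B" "B \<ge> 0"
      proof
        show "\<bar>y\<bar> \<le> (\<Sum>y\<in>S. \<bar>y\<bar>)" if "y \<in> S" for y
          using that S(1) by (intro member_le_sum) auto
        show "(\<Sum>y\<in>S. \<bar>y\<bar>) \<ge> 0" by (rule sum_nonneg) simp
      qed
      \<comment> \<open>In a gap of length \<open>2 * B + 1\<close> starting at \<open>M\<close>,
        the midpoint \<open>M + B\<close> has all its differences to points of \<open>S\<close>
        inside the gap.\<close>
      have "nat (2 * B + 1) > 0" using B(2) by simp
      then obtain M where M: "\<forall>n\<in>{M..<M + int (nat (2 * B + 1))}. dd \<gamma> xs n > \<delta>"
        using gap by blast
      have new: "V (M + B) y > \<delta> / 2" if "y \<in> S" for y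
      proof -
        have "dd \<gamma> xs (M + B - y) > \<delta>" using B(1)[OF that] B(2) by (intro bspec[OF M]) auto
        then show ?thesis using V[of "M + B" y] by linarith
      qed
      have "V x x = 0" for x by (simp add: V_def avg2_def sum_list_triv)
      then have "M + B \<notin> S" using new \<delta> by force
      then show ?case
        using S new V_sym by (intro exI[of _ "insert (M + B) S"]) auto
    qed
    obtain k where k: "inverse (real (Suc k)) < \<delta> / 2"
      using reals_Archimedean[of "\<delta> / 2"] \<delta> by auto
    define R where "R = Suc k"
    have R: "R > 0" "1 / real R < \<delta> / 2" using k by (simp_all only: R_def inverse_eq_divide zero_less_Suc)
    define T where "T = PiE (set (diffs xs)) (\<lambda>_. {0..int R})"
    have T: "finite T" unfolding T_def by (intro finite_PiE) auto
    obtain S where S: "finite S" "card S = Suc (card T)" "\<forall>x\<in>S. \<forall>y\<in>S. x \<noteq> y \<longrightarrow> V x y > \<delta> / 2"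
      using exS[of "Suc (card T)"] by blast
    \<comment> \<open>Rounds the values entering \<open>V\<close> down to multiples of
      \<open>1 / R\<close>. With more positions than possible roundings, two positions share one and
      are then too close.\<close>
    define c where "c x = restrict (\<lambda>h. \<lfloor>real R * \<gamma> (h + x)\<rfloor>) (set (diffs xs))" for x
    have "\<lfloor>real R * \<gamma> h\<rfloor> \<in> {0..int R}" for h
    proof -
      have "\<lfloor>real R * \<gamma> h\<rfloor> \<le> \<lfloor>real R\<rfloor>" using \<gamma>01[of h] by (intro floor_mono) (simp add: mult_left_le)
      then show ?thesis using \<gamma>01[of h] by simp
    qed
    then have "c ` S \<subseteq> T" unfolding c_def T_def by (intro image_subsetI restrict_PiE_iff[THEN iffD2]) simp
    then have "card (c ` S) < card S" using card_mono[OF T] S(2) by (simp add: less_Suc_eq_le)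
    then have "\<not> inj_on c S" by (rule pigeonhole)
    then obtain x y where xy: "x \<in> S" "y \<in> S" "x \<noteq> y" "c x = c y" by (auto simp: inj_on_def)
    have "V x y \<le> 1 / real R"
    proof -
      have "(\<gamma> (h + y) - \<gamma> (h + x))\<^sup>2 \<le> 1 / real R" if h: "h \<in> set (diffs xs)" for h
      proof -
        have "\<lfloor>real R * \<gamma> (h + x)\<rfloor> = \<lfloor>real R * \<gamma> (h + y)\<rfloor>"
          using fun_cong[OF xy(4), of h] h by (simp add: c_def)
        then have "\<bar>real R * \<gamma> (h + y) - real R * \<gamma> (h + x)\<bar> \<le> 1" by linarith
        then have "real R * \<bar>\<gamma> (h + y) - \<gamma> (h + x)\<bar> \<le> 1"
          by (simp add: right_diff_distrib[symmetric] abs_mult)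
        then have 1: "\<bar>\<gamma> (h + y) - \<gamma> (h + x)\<bar> \<le> 1 / real R" using R(1) by (simp add: pos_le_divide_eq mult.commute)
        have "\<bar>\<gamma> (h + y) - \<gamma> (h + x)\<bar> \<le> 1" using \<gamma>01[of "h + x"] \<gamma>01[of "h + y"] by linarith
        then have "\<bar>\<gamma> (h + y) - \<gamma> (h + x)\<bar> * \<bar>\<gamma> (h + y) - \<gamma> (h + x)\<bar> \<le> 1 * (1 / real R)"
          by (rule mult_mono) (use 1 in auto)
        then show ?thesis by (simp add: power2_eq_square)
      qed
      then have "(\<Sum>h\<leftarrow>diffs xs. (\<gamma> (h + y) - \<gamma> (h + x))\<^sup>2) \<le> (\<Sum>h\<leftarrow>diffs xs. 1 / real R)"
        by (intro sum_list_mono)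
      also have "\<dots> = (real (length xs))\<^sup>2 * (1 / real R)" by (simp add: sum_list_triv length_diffs)
      finally show ?thesis
        unfolding V_def avg2_def sum_list_diffs[where f = "\<lambda>h. (\<gamma> (h + y) - \<gamma> (h + x))\<^sup>2", symmetric]
        using xs by (simp add: pos_divide_le_eq mult.commute)
    qed
    then show False using S(3) xy R(2) by fastforce
  qed
  then show thesis using that[OF xs] unfolding \<gamma>_def by blast
qed

section \<open>The lower bound for ergodic means\<close>

lemma corner_eq_line1:
  assumes \<psi>: "imean \<psi>" and f: "\<And>q. bddf (f q)"
  shows "corner \<psi> f n = trip \<psi> f (\<lambda>k. if k = 1 then n else 0)"
  using trip_eq_corner[OF assms, where L = "\<lambda>k. if k = 1 then n else 0"] by simp

lemma corner_telescope:
  assumes M: "mean \<psi>" and f: "\<And>q. bddf (f q)" and g: "\<And>q. bddf (g q)"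
  shows "corner \<psi> f n - corner \<psi> g n
    = (\<Sum>j<3. corner \<psi> (\<lambda>q. if q < j then g q else if q = j then (\<lambda>\<omega>. f q \<omega> - g q \<omega>) else f q) n)"
proof -
  have b: "bddf (\<lambda>\<omega>. f q (tau e \<omega>))" "bddf (\<lambda>\<omega>. g q (tau e \<omega>))" for q e
    by (rule bddf_tau[OF f], rule bddf_tau[OF g])
  show ?thesis
    unfolding corner_def trip_def
    by (simp add: numeral_3_eq_3 b bddf_simps mean_diff[OF M] left_diff_distrib right_diff_distrib)
qed

lemma abs_corner_le:
  assumes \<psi>: "imean \<psi>" and b: "\<And>k. bddf (f k)" and f: "\<And>k \<omega>. k \<noteq> q \<Longrightarrow> \<bar>f k \<omega>\<bar> \<le> 1" and q: "q < 3"
  shows "\<bar>corner \<psi> f n\<bar> \<le> \<psi> (\<lambda>\<omega>. \<bar>f q \<omega>\<bar>)"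
proof -
  note M = imean_mean[OF \<psi>]
  let ?L = "\<lambda>k::nat. if k = 2 then n else 0"
  have p: "\<bar>x * y * z\<bar> \<le> \<bar>x\<bar>" "\<bar>y * x * z\<bar> \<le> \<bar>x\<bar>" "\<bar>y * z * x\<bar> \<le> \<bar>x\<bar>" if "\<bar>y\<bar> \<le> 1" "\<bar>z\<bar> \<le> 1" for x y z :: real
  proof -
    have "\<bar>x\<bar> * (\<bar>y\<bar> * \<bar>z\<bar>) \<le> \<bar>x\<bar> * 1" using that by (intro mult_left_mono mult_le_one) auto
    then show "\<bar>x * y * z\<bar> \<le> \<bar>x\<bar>" "\<bar>y * x * z\<bar> \<le> \<bar>x\<bar>" "\<bar>y * z * x\<bar> \<le> \<bar>x\<bar>" by (simp_all add: abs_mult mult_ac)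
  qed
  let ?h = "\<lambda>\<omega>. f 0 (tau (vt 0 ?L) \<omega>) * f 1 (tau (vt 1 ?L) \<omega>) * f 2 (tau (vt 2 ?L) \<omega>)"
  have bh: "bddf ?h" by (intro bddf_mult bddf_tau[OF b])
  have "\<bar>corner \<psi> f n\<bar> \<le> \<psi> (\<lambda>\<omega>. \<bar>?h \<omega>\<bar>)"
    unfolding corner_def trip_def by (rule mean_abs[OF M bh])
  also have "\<dots> \<le> \<psi> (\<lambda>\<omega>. \<bar>f q (tau (vt q ?L) \<omega>)\<bar>)"
  proof (rule mean_mono[OF M bddf_abs[OF bh] bddf_abs[OF bddf_tau[OF b]]])
    show "\<bar>?h \<omega>\<bar> \<le> \<bar>f q (tau (vt q ?L) \<omega>)\<bar>" for \<omega>
    proof (rule less_3_cases[OF q])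
      assume q: "q = 0"
      show ?thesis unfolding q by (rule p(1); rule f; simp add: q)
    next
      assume q: "q = 1"
      show ?thesis unfolding q by (rule p(2); rule f; simp add: q)
    next
      assume q: "q = 2"
      show ?thesis unfolding q by (rule p(3); rule f; simp add: q)
    qed
  qed
  also have "\<dots> = \<psi> (\<lambda>\<omega>. \<bar>f q \<omega>\<bar>)" by (rule imean_tau[OF \<psi> bddf_abs[OF b]])
  finally show ?thesis .
qed

text \<open>The four numbers \<open>x * y * z / a ^ 3\<close>, \<open>a / x\<close>,
  \<open>a / y\<close>, \<open>a / z\<close> have product 1, so their sum is at least 4. Equality
  holds at \<open>x = y = z = a\<close>.\<close>

lemma four_term_am_gm:
  fixes x y z a :: real
  assumes "x > 0" "y > 0" "z > 0" "a > 0"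
  shows "a ^ 3 * (4 - a / x - a / y - a / z) \<le> x * y * z"
proof -
  have "ln (x * y * z / a ^ 3) + (ln (a / x) + ln (a / y) + ln (a / z)) = 0"
    using assms by (simp add: ln_div ln_mult ln_realpow)
  moreover have "ln (x * y * z / a ^ 3) \<le> x * y * z / a ^ 3 - 1" "ln (a / x) \<le> a / x - 1"
    "ln (a / y) \<le> a / y - 1" "ln (a / z) \<le> a / z - 1"
    using assms by (intro ln_le_minus_one; simp)+
  ultimately have "4 - a / x - a / y - a / z \<le> x * y * z / a ^ 3" by linarith
  then show ?thesis using assms by (simp add: pos_le_divide_eq mult.commute)
qed

text \<open>Integrate the previous inequality over \<open>base\<close>: the quotient of \<open>base\<close> by its projection has mean
  at most one.\<close>

lemma proj_product_ge:
  assumes M: "mean \<theta>" and pos: "\<theta> base > 0"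
  shows "(\<theta> base) ^ 4 \<le> \<theta> (\<lambda>\<omega>. proj \<theta> 0 m \<omega> * proj \<theta> 1 m \<omega> * proj \<theta> 2 m \<omega>)"
proof -
  define a where "a = \<theta> base"
  define P where "P q = proj \<theta> q m" for q
  have P0: "0 \<le> P q \<omega>" and P1: "\<bar>P q \<omega>\<bar> \<le> 1" for q \<omega> unfolding P_def by (rule proj_nonneg[OF M], rule abs_proj[OF M])
  have bP: "bddf (P q)" for q using P1 by (rule bddfI)
  \<comment> \<open>Marks the points where a projection vanishes; by \<open>swap\<close> those among
    them lying in \<open>A\<close> have mean 0. There \<open>R\<close> takes the default value
    \<open>inverse 0 = 0\<close>, and it is bounded because \<open>P q\<close> takes finitely many
    values.\<close>
  define Z where "Z q \<omega> = (of_bool (P q \<omega> = 0) :: real)" for q \<omega>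
  define R where "R q \<omega> = inverse (P q \<omega>)" for q \<omega>
  have cP: "cyl m (P q)" for q by (simp add: P_def)
  have bZ: "bddf (Z q)" and bR: "bddf (R q)" for q
    unfolding Z_def R_def by (rule bddf_of_bool, rule cyl_bddf[OF cyl_comp[OF cP]])
  have swap: "\<theta> (\<lambda>\<omega>. h (P q \<omega>) * base \<omega>) = \<theta> (\<lambda>\<omega>. h (P q \<omega>) * P q \<omega>)" for h :: "real \<Rightarrow> real" and q
  proof -
    obtain g where g: "\<And>\<omega>. P q \<omega> = g (lpart q m \<omega>)" unfolding P_def using proj_function by blast
    show ?thesis
      using proj_orthogonal[where g = "\<lambda>\<omega>. h (P q \<omega>)" and h = "\<lambda>b. h (g b)" and q = q and m = m, OF M order_refl] by (simp add: g P_def[symmetric])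
  qed
  have ZB: "\<theta> (\<lambda>\<omega>. Z q \<omega> * base \<omega>) = 0" for q
  proof -
    have "\<theta> (\<lambda>\<omega>. Z q \<omega> * base \<omega>) = \<theta> (\<lambda>\<omega>. Z q \<omega> * P q \<omega>)"
      unfolding Z_def by (rule swap)
    also have "(\<lambda>\<omega>. Z q \<omega> * P q \<omega>) = (\<lambda>_. 0)" by (auto simp: Z_def)
    finally show ?thesis using M by simp
  qed
  have RB: "\<theta> (\<lambda>\<omega>. R q \<omega> * base \<omega>) \<le> 1" for q
  proof -
    have "\<theta> (\<lambda>\<omega>. R q \<omega> * base \<omega>) = \<theta> (\<lambda>\<omega>. R q \<omega> * P q \<omega>)"
      unfolding R_def by (rule swap)
    also have "\<dots> \<le> \<theta> (\<lambda>_. 1)"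
    proof (rule mean_mono[OF M])
      show "R q \<omega> * P q \<omega> \<le> 1" for \<omega> by (cases "P q \<omega> = 0") (simp_all add: R_def)
    qed (intro bddf_mult bR bP bddf_const)+
    finally show ?thesis using M by simp
  qed
  \<comment> \<open>Off \<open>A\<close>, or where a projection vanishes, the left side is at most 0
    and the right side nonnegative; elsewhere this is \<open>four_term_am_gm\<close>.\<close>
  have "a ^ 3 * (4 * (base \<omega> - Z 0 \<omega> * base \<omega> - Z 1 \<omega> * base \<omega> - Z 2 \<omega> * base \<omega>)
      - a * (R 0 \<omega> * base \<omega> + R 1 \<omega> * base \<omega> + R 2 \<omega> * base \<omega>)) \<le> P 0 \<omega> * P 1 \<omega> * P 2 \<omega>" for \<omega>
  proof (cases "base \<omega> = 0 \<or> P 0 \<omega> = 0 \<or> P 1 \<omega> = 0 \<or> P 2 \<omega> = 0")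
    case True
    have R0: "R q \<omega> \<ge> 0" and Z0: "Z q \<omega> \<ge> 0" for q using P0[of q \<omega>] by (simp_all add: R_def Z_def)
    have "4 * (base \<omega> - Z 0 \<omega> * base \<omega> - Z 1 \<omega> * base \<omega> - Z 2 \<omega> * base \<omega>) \<le> 0"
    proof (cases "base \<omega> = 0")
      case False
      then have "P 0 \<omega> = 0 \<or> P 1 \<omega> = 0 \<or> P 2 \<omega> = 0" using True by blast
      then have "1 \<le> Z 0 \<omega> + Z 1 \<omega> + Z 2 \<omega>" by (elim disjE) (simp_all add: Z_def)
      then have "base \<omega> * 1 \<le> base \<omega> * (Z 0 \<omega> + Z 1 \<omega> + Z 2 \<omega>)" by (intro mult_left_mono) simp_all
      then show ?thesis by (simp add: algebra_simps)
    qed simp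
    moreover have "a * (R 0 \<omega> * base \<omega> + R 1 \<omega> * base \<omega> + R 2 \<omega> * base \<omega>) \<ge> 0"
      using R0 pos by (intro mult_nonneg_nonneg add_nonneg_nonneg) (simp_all add: a_def)
    ultimately have "a ^ 3 * (4 * (base \<omega> - Z 0 \<omega> * base \<omega> - Z 1 \<omega> * base \<omega> - Z 2 \<omega> * base \<omega>)
      - a * (R 0 \<omega> * base \<omega> + R 1 \<omega> * base \<omega> + R 2 \<omega> * base \<omega>)) \<le> 0"
      using pos by (intro mult_nonneg_nonpos) (simp_all add: a_def)
    also have "0 \<le> P 0 \<omega> * P 1 \<omega> * P 2 \<omega>" by (intro mult_nonneg_nonneg P0)
    finally show ?thesis .
  next
    case False
    then have b: "base \<omega> = 1" by (simp add: base_def split: if_splits)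
    have "P q \<omega> > 0" if "q = 0 \<or> q = 1 \<or> q = 2" for q using False P0[of q \<omega>] that by (auto simp: order_less_le)
    then show ?thesis
      using four_term_am_gm[of "P 0 \<omega>" "P 1 \<omega>" "P 2 \<omega>" a] pos False b
      by (simp add: Z_def R_def a_def divide_inverse algebra_simps)
  qed
  then have "\<theta> (\<lambda>\<omega>. a ^ 3 * (4 * (base \<omega> - Z 0 \<omega> * base \<omega> - Z 1 \<omega> * base \<omega> - Z 2 \<omega> * base \<omega>)
      - a * (R 0 \<omega> * base \<omega> + R 1 \<omega> * base \<omega> + R 2 \<omega> * base \<omega>))) \<le> \<theta> (\<lambda>\<omega>. P 0 \<omega> * P 1 \<omega> * P 2 \<omega>)"
    by (intro mean_mono[OF M] bddf_mult bddf_diff bddf_add bddf_const bddf_base bZ bR bP)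
  moreover have "\<theta> (\<lambda>\<omega>. a ^ 3 * (4 * (base \<omega> - Z 0 \<omega> * base \<omega> - Z 1 \<omega> * base \<omega> - Z 2 \<omega> * base \<omega>)
      - a * (R 0 \<omega> * base \<omega> + R 1 \<omega> * base \<omega> + R 2 \<omega> * base \<omega>)))
    = a ^ 3 * (4 * (a - 0 - 0 - 0) - a * (\<theta> (\<lambda>\<omega>. R 0 \<omega> * base \<omega>) + \<theta> (\<lambda>\<omega>. R 1 \<omega> * base \<omega>) + \<theta> (\<lambda>\<omega>. R 2 \<omega> * base \<omega>)))"
    by (simp only: mean_cmult[OF M] mean_diff[OF M] mean_add[OF M] bddf_mult bddf_diff bddf_add bddf_const bddf_base bZ bR ZB a_def[symmetric])
  moreover have "a ^ 3 * (4 * a - a * 3) \<le> a ^ 3 * (4 * (a - 0 - 0 - 0) - a * (\<theta> (\<lambda>\<omega>. R 0 \<omega> * base \<omega>) + \<theta> (\<lambda>\<omega>. R 1 \<omega> * base \<omega>) + \<theta> (\<lambda>\<omega>. R 2 \<omega> * base \<omega>)))"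
  proof (rule mult_left_mono)
    have "a * (\<theta> (\<lambda>\<omega>. R 0 \<omega> * base \<omega>) + \<theta> (\<lambda>\<omega>. R 1 \<omega> * base \<omega>) + \<theta> (\<lambda>\<omega>. R 2 \<omega> * base \<omega>)) \<le> a * 3"
      using RB[of 0] RB[of 1] RB[of 2] pos by (intro mult_left_mono) (auto simp: a_def)
    then show "4 * a - a * 3 \<le> 4 * (a - 0 - 0 - 0) - a * (\<theta> (\<lambda>\<omega>. R 0 \<omega> * base \<omega>) + \<theta> (\<lambda>\<omega>. R 1 \<omega> * base \<omega>) + \<theta> (\<lambda>\<omega>. R 2 \<omega> * base \<omega>))"
      by simp
  qed (use pos in \<open>simp add: a_def\<close>)
  moreover have "a ^ 3 * (4 * a - a * 3) = a ^ 4" by (simp add: power4_eq_xxxx power3_eq_cube)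
  ultimately show ?thesis by (simp add: a_def P_def)
qed

text \<open>Each of the three projections is a function of the patterns on two sides of the
  triangle, so the corner expands over the \<open>(2 ^ m) ^ 3\<close> triples of patterns with
  coefficients bounded by 1 and independent of \<open>n\<close>.\<close>

lemma corner_proj_diff_le:
  assumes \<theta>: "imean \<theta>" and tri: "\<And>\<alpha> \<beta> \<zeta>. \<beta> \<subseteq> {..<m} \<Longrightarrow> \<bar>tri \<theta> m \<alpha> \<beta> \<zeta> n - tri \<theta> m \<alpha> \<beta> \<zeta> 0\<bar> \<le> \<kappa>"
  shows "\<bar>corner \<theta> (\<lambda>q. proj \<theta> q m) n - corner \<theta> (\<lambda>q. proj \<theta> q m) 0\<bar> \<le> (2 ^ m) ^ 3 * \<kappa>"
proof -
  note M = imean_mean[OF \<theta>]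
  have "\<exists>h. \<forall>\<omega>. proj \<theta> q m \<omega> = h (lpart q m \<omega>)" for q using proj_function by metis
  then obtain h' where h': "\<And>q \<omega>. proj \<theta> q m \<omega> = h' q (lpart q m \<omega>)" by metis
  \<comment> \<open>The function \<open>h'\<close> is controlled only at values of
    \<open>lpart\<close>; clamping makes it bounded by 1 everywhere without changing it
    there.\<close>
  define h where "h q b = max (-1) (min 1 (h' q b))" for q b
  have h: "proj \<theta> q m \<omega> = h q (lpart q m \<omega>)" for q \<omega>
    using abs_proj[OF M, of q m \<omega>] by (simp add: h_def h'[symmetric] abs_le_iff)
  have h1: "\<bar>h q b\<bar> \<le> 1" for q b by (simp add: h_def)
  define K where "K q \<alpha> \<beta> \<zeta> = h q {(k, j). k < 3 \<and> k \<noteq> q \<and> j \<in> (if k = 0 then \<alpha> else if k = 1 then \<beta> else \<zeta>)}"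
    for q and \<alpha> \<beta> \<zeta> :: "nat set"
  define \<Phi> where "\<Phi> \<alpha> \<beta> \<zeta> = K 0 \<alpha> \<beta> \<zeta> * K 1 \<alpha> \<beta> \<zeta> * K 2 \<alpha> \<beta> \<zeta>" for \<alpha> \<beta> \<zeta>
  have \<Phi>1: "\<bar>\<Phi> \<alpha> \<beta> \<zeta>\<bar> \<le> 1" for \<alpha> \<beta> \<zeta>
    unfolding \<Phi>_def abs_mult K_def by (intro mult_le_one h1 mult_nonneg_nonneg abs_ge_zero)
  let ?Q = "Pow {..<m} \<times> Pow {..<m} \<times> Pow {..<m}"
  have corner: "corner \<theta> (\<lambda>q. proj \<theta> q m) n = (\<Sum>(\<alpha>, \<beta>, \<zeta>)\<in>?Q. \<Phi> \<alpha> \<beta> \<zeta> * tri \<theta> m \<alpha> \<beta> \<zeta> n)" for n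
  proof -
    define L where "L = (\<lambda>k::nat. if k = 1 then n else 0 :: int)"
    have PK: "proj \<theta> q m (tau (vt q L) \<omega>) = K q (atm 0 m 0 \<omega>) (atm 1 m n \<omega>) (atm 2 m 0 \<omega>)" if q: "q < 3" for q \<omega>
    proof -
      have "lpart q m (tau (vt q L) \<omega>) = {(k, j). k < 3 \<and> k \<noteq> q \<and> j \<in> atm k m (L k) \<omega>}"
        using q by (auto simp: lpart_def atm_def co_vt)
      also have "\<dots> = {(k, j). k < 3 \<and> k \<noteq> q \<and> j \<in> (if k = 0 then atm 0 m 0 \<omega> else if k = 1 then atm 1 m n \<omega> else atm 2 m 0 \<omega>)}"
        by (auto simp: L_def elim!: less_3_cases)
      finally show ?thesis unfolding h K_def by (rule arg_cong)
    qed
    have b: "bddf (\<lambda>\<omega>. ia 0 m 0 \<alpha> \<omega> * ia 1 m n \<beta> \<omega> * ia 2 m 0 \<zeta> \<omega>)" for \<alpha> \<beta> \<zeta>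
      by (intro bddf_mult bddf_ia)
    have "corner \<theta> (\<lambda>q. proj \<theta> q m) n = trip \<theta> (\<lambda>q. proj \<theta> q m) L"
      unfolding L_def by (rule corner_eq_line1[OF \<theta> bddf_proj[OF M]])
    also have "\<dots> = \<theta> (\<lambda>\<omega>. \<Phi> (atm 0 m 0 \<omega>) (atm 1 m n \<omega>) (atm 2 m 0 \<omega>))"
      unfolding trip_def \<Phi>_def by (simp add: PK)
    also have "(\<lambda>\<omega>. \<Phi> (atm 0 m 0 \<omega>) (atm 1 m n \<omega>) (atm 2 m 0 \<omega>))
        = (\<lambda>\<omega>. \<Sum>(\<alpha>, \<beta>, \<zeta>)\<in>?Q. \<Phi> \<alpha> \<beta> \<zeta> * (ia 0 m 0 \<alpha> \<omega> * ia 1 m n \<beta> \<omega> * ia 2 m 0 \<zeta> \<omega>))"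
    proof
      fix \<omega>
      let ?p = "(atm 0 m 0 \<omega>, atm 1 m n \<omega>, atm 2 m 0 \<omega>)"
      have "(\<Sum>(\<alpha>, \<beta>, \<zeta>)\<in>?Q. \<Phi> \<alpha> \<beta> \<zeta> * (ia 0 m 0 \<alpha> \<omega> * ia 1 m n \<beta> \<omega> * ia 2 m 0 \<zeta> \<omega>))
          = (\<Sum>p\<in>?Q. if ?p = p then \<Phi> (atm 0 m 0 \<omega>) (atm 1 m n \<omega>) (atm 2 m 0 \<omega>) else 0)"
        by (rule sum.cong) (auto simp: ia_def)
      also have "\<dots> = \<Phi> (atm 0 m 0 \<omega>) (atm 1 m n \<omega>) (atm 2 m 0 \<omega>)"
        by (subst sum.delta') (simp_all add: atm_in_Pow del: Pow_iff)
      finally show "\<Phi> (atm 0 m 0 \<omega>) (atm 1 m n \<omega>) (atm 2 m 0 \<omega>)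
          = (\<Sum>(\<alpha>, \<beta>, \<zeta>)\<in>?Q. \<Phi> \<alpha> \<beta> \<zeta> * (ia 0 m 0 \<alpha> \<omega> * ia 1 m n \<beta> \<omega> * ia 2 m 0 \<zeta> \<omega>))" ..
    qed
    also have "\<theta> \<dots> = (\<Sum>(\<alpha>, \<beta>, \<zeta>)\<in>?Q. \<Phi> \<alpha> \<beta> \<zeta> * tri \<theta> m \<alpha> \<beta> \<zeta> n)"
      unfolding split_def tri_def
      by (subst mean_sum[OF M]) (auto intro!: bddf_mult b sum.cong mean_cmult[OF M])
    finally show ?thesis .
  qed
  have "corner \<theta> (\<lambda>q. proj \<theta> q m) n - corner \<theta> (\<lambda>q. proj \<theta> q m) 0
      = (\<Sum>(\<alpha>, \<beta>, \<zeta>)\<in>?Q. \<Phi> \<alpha> \<beta> \<zeta> * (tri \<theta> m \<alpha> \<beta> \<zeta> n - tri \<theta> m \<alpha> \<beta> \<zeta> 0))"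
    unfolding corner sum_subtractf[symmetric] by (rule sum.cong) (auto simp: right_diff_distrib)
  also have "\<bar>\<dots>\<bar> \<le> (\<Sum>p\<in>?Q. \<kappa>)"
  proof (rule order_trans[OF sum_abs], rule sum_mono)
    fix p assume "p \<in> ?Q"
    then obtain \<alpha> \<beta> \<zeta> where p: "p = (\<alpha>, \<beta>, \<zeta>)" "\<beta> \<subseteq> {..<m}" by auto
    have "\<bar>\<Phi> \<alpha> \<beta> \<zeta> * (tri \<theta> m \<alpha> \<beta> \<zeta> n - tri \<theta> m \<alpha> \<beta> \<zeta> 0)\<bar> \<le> 1 * \<kappa>"
      unfolding abs_mult by (intro mult_mono' \<Phi>1 tri[OF p(2)]) auto
    then show "\<bar>case p of (\<alpha>, \<beta>, \<zeta>) \<Rightarrow> \<Phi> \<alpha> \<beta> \<zeta> * (tri \<theta> m \<alpha> \<beta> \<zeta> n - tri \<theta> m \<alpha> \<beta> \<zeta> 0)\<bar> \<le> \<kappa>"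
      by (simp add: p)
  qed
  also have "\<dots> = (2 ^ m) ^ 3 * \<kappa>" by (simp add: card_cartesian_product card_Pow power3_eq_cube)
  finally show ?thesis .
qed

lemma sum_periodic_lower_bound:
  fixes w :: "int \<Rightarrow> real"
  assumes w0: "\<And>n. 0 \<le> w n" and w: "\<And>M. \<exists>n\<in>{M..<M + int N}. w n \<ge> c"
  shows "real J * c \<le> (\<Sum>n\<in>{M..<M + int (N * J)}. w n)"
proof (induction J)
  case (Suc J)
  let ?A = "{M..<M + int (N * J)}" and ?B = "{M + int (N * J)..<M + int (N * J) + int N}"
  obtain n where n: "n \<in> ?B" "w n \<ge> c" using w[of "M + int (N * J)"] by blast
  have "{M..<M + (p + int N)} = {M..<M + p} \<union> {M + p..<M + p + int N}" if "p \<ge> 0" for p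
    using that by auto
  from this[of "int (N * J)"] have "{M..<M + int (N * Suc J)} = ?A \<union> ?B" by (simp add: algebra_simps)
  then have "(\<Sum>n\<in>{M..<M + int (N * Suc J)}. w n) = sum w ?A + sum w ?B"
    by (simp add: sum.union_disjoint ivl_disj_int)
  moreover have "w n \<le> sum w ?B" using n w0 by (intro member_le_sum) auto
  ultimately show ?case using Suc n(2) by (simp add: algebra_simps)
qed simp

text \<open>The weight is a polynomial in finitely many translates of \<open>gam\<close>, and Schur
  multipliers are closed under translation, sums and products. The constant may be large, but it is
  known before the uniformity is chosen.\<close>

lemma schur_dd_power:
  assumes \<psi>: "imean \<psi>"
  obtains C where "schur C (\<lambda>n. (1 - dd (gam \<psi> m) xs n) ^ D)"
proof -
  let ?g = "gam \<psi> m" and ?l = "real (length xs)"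
  have neg: "\<exists>C. schur C (\<lambda>n. - w n)" if "schur C w" for C w
    using schur_mult[OF schur_const[of "-1"] that] by auto
  have sq: "\<exists>C. schur C (\<lambda>n. (?g (s - t) - ?g (s - t + n))\<^sup>2)" for s t
  proof -
    obtain C where "schur C (\<lambda>n. - ?g (s - t + n))"
      using neg[OF schur_shift[OF schur_gam[OF \<psi>, of m], of "s - t"]] by blast
    from schur_add[OF schur_const[of "?g (s - t)"] this] show ?thesis
      by (intro schur_power[of "\<bar>?g (s - t)\<bar> + C"]) simp
  qed
  obtain C where C: "schur C (\<lambda>n. \<Sum>s\<leftarrow>xs. \<Sum>t\<leftarrow>xs. (?g (s - t) - ?g (s - t + n))\<^sup>2)"
    using schur_sum_list[of xs "\<lambda>s n. \<Sum>t\<leftarrow>xs. (?g (s - t) - ?g (s - t + n))\<^sup>2"]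
      schur_sum_list[of xs "\<lambda>t n. (?g (_ - t) - ?g (_ - t + n))\<^sup>2"] sq by blast
  have "dd ?g xs = (\<lambda>n. 1 / ?l\<^sup>2 * (\<Sum>s\<leftarrow>xs. \<Sum>t\<leftarrow>xs. (?g (s - t) - ?g (s - t + n))\<^sup>2))"
    by (rule ext) (simp add: dd_def avg2_def)
  with schur_mult[OF schur_const[of "1 / ?l\<^sup>2"] C] obtain C' where "schur C' (dd ?g xs)" by metis
  from neg[OF this] obtain C'' where "schur C'' (\<lambda>n. - dd ?g xs n)" by blast
  from schur_add[OF schur_const[of 1] this] have "schur (1 + C'') (\<lambda>n. 1 - dd ?g xs n)" by simp
  from schur_power[OF this, of D] show thesis using that by blast
qed

text \<open>Two levels are needed: the weight \<open>w\<close>, which is concentrated on the return times of the level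
  \<open>m\<close> lines, has to be known before the uniformity \<open>\<eta>\<close> of the finer level \<open>m'\<close> is fixed. Maximality
  of the energy makes the projections to both levels close in mean square.\<close>

lemma corner_return_times:
  assumes \<psi>: "imean \<psi>" "erg \<psi>" and pos: "\<psi> base > 0" and \<epsilon>: "\<epsilon> > 0"
  obtains N :: nat where "N > 0"
    "\<And>M. \<exists>n\<in>{M..<M + int N}. corner \<psi> (\<lambda>_. base) n > \<psi> base ^ 4 - \<epsilon>"
proof -
  define a where "a = \<psi> base"
  \<comment> \<open>The budget is \<open>3 * e\<close> for changing the level of the projections,
    \<open>e\<close> for the move from 0 to a near return, \<open>e\<close> for the weight off the
    returns and \<open>2 * e\<close> for the uniform errors: \<open>7 * e\<close> against the
    available \<open>8 * e\<close>.\<close>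
  define e where "e = min 1 (\<epsilon> / 8)"
  have e: "e > 0" "e \<le> 1" "8 * e \<le> \<epsilon>" using \<epsilon> by (auto simp: e_def)
  have a1: "a \<le> 1" using mean_bound[OF imean_mean[OF \<psi>(1)], of base 1] by (simp add: a_def abs_le_iff)
  have a0: "a > 0" using pos by (simp add: a_def)
  have "e\<^sup>2 > 0" using e by simp
  obtain \<theta>0 m where \<theta>0: "(\<theta>0, m) \<in> extensions \<psi> 0"
    and coarse: "\<And>\<theta> m' q. (\<theta>, m') \<in> extensions \<theta>0 m \<Longrightarrow> q < 3 \<Longrightarrow>
      \<theta> (\<lambda>\<omega>. (proj \<theta> q m' \<omega> - proj \<theta> q m \<omega>)\<^sup>2) \<le> e\<^sup>2"
    by (rule coarse_structure[OF \<psi> \<open>e\<^sup>2 > 0\<close>]) blast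
  have \<theta>0i: "imean \<theta>0" and \<theta>0e: "erg \<theta>0" using \<theta>0 by (simp_all add: extensions_def)
  define \<gamma> where "\<gamma> = gam \<theta>0 m"
  \<comment> \<open>Chosen backwards: the \<open>(2 ^ m) ^ 3\<close> triples may each lose \<kappa>
    to stay within \<open>e\<close>; \<open>2 * t\<close> is to be \<open>\<kappa>\<^sup>2\<close>,
    and \<delta> is the bound on \<open>dd\<close> that \<open>tri_diff_le_of_dd\<close> asks
    for.\<close>
  define \<kappa> where "\<kappa> = e / (2 ^ m) ^ 3"
  define t where "t = \<kappa>\<^sup>2 / 2"
  define \<delta> where "\<delta> = t\<^sup>2"
  have \<kappa>: "\<kappa> > 0" "\<kappa> \<le> 1"
  proof -
    have "(1::real) \<le> (2 ^ m) ^ 3" by (simp add: one_le_power)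
    then have "e \<le> (2 ^ m) ^ 3" using e(2) by linarith
    then show "\<kappa> > 0" "\<kappa> \<le> 1" using e by (simp_all add: \<kappa>_def divide_le_eq)
  qed
  have t: "t > 0" "t \<le> 1 / 2" using \<kappa> power_le_one[of \<kappa> 2] by (simp_all add: t_def)
  have \<delta>: "\<delta> > 0" "\<delta> < 1"
    using t power_strict_mono[of t 1 2] by (simp_all add: \<delta>_def)
  have "\<delta> / 2 > 0" using \<delta> by simp
  obtain xs and N :: nat where xs: "xs \<noteq> []" and N: "N > 0"
    and ret: "\<And>M. \<exists>n\<in>{M..<M + int N}. dd \<gamma> xs n \<le> \<delta> / 2"
    unfolding \<gamma>_def by (rule syndetic_return[OF \<theta>0i \<open>\<delta> / 2 > 0\<close>]) blast
  have \<gamma>01: "0 \<le> \<gamma> h" "\<gamma> h \<le> 1" for h unfolding \<gamma>_def using gam_bounds[OF \<theta>0i] by auto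
  have dd01: "0 \<le> dd \<gamma> xs n" "dd \<gamma> xs n \<le> 1" for n
  proof -
    have "(\<gamma> h - \<gamma> h')\<^sup>2 \<le> 1" for h h' using \<gamma>01[of h] \<gamma>01[of h'] by (simp add: abs_square_le_1)
    then have "dd \<gamma> xs n \<le> avg2 xs (\<lambda>_ _. 1)" unfolding dd_def by (intro avg2_mono)
    then show "dd \<gamma> xs n \<le> 1" by (simp add: avg2_const[OF xs])
    have "avg2 xs (\<lambda>_ _. 0) \<le> dd \<gamma> xs n" unfolding dd_def by (intro avg2_mono) simp
    then show "0 \<le> dd \<gamma> xs n" by (simp add: avg2_const[OF xs])
  qed
  \<comment> \<open>Returns are syndetic already at the level \<open>\<delta> / 2\<close>, whereas
    the correlation is controlled up to \<delta>. This gap makes \<open>r\<close> less than 1, and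
    the power \<open>D\<close> makes the weight beyond \<delta> negligible against that at level
    \<open>\<delta> / 2\<close>.\<close>
  define r where "r = (1 - \<delta>) / (1 - \<delta> / 2)"
  have r: "0 \<le> r" "r < 1" using \<delta> by (simp_all add: r_def divide_less_eq)
  obtain D where D: "r ^ D < e / real N"
    using real_arch_pow_inv[OF _ r(2), of "e / real N"] e N by auto
  define w where "w n = (1 - dd \<gamma> xs n) ^ D" for n
  have w01: "0 \<le> w n" "w n \<le> 1" for n using dd01[of n] by (simp_all add: w_def power_le_one)
  \<comment> \<open>A lower bound for the average of \<open>w\<close>: each block of
    \<open>N\<close> integers contains a return, of weight at least
    \<open>(1 - \<delta> / 2) ^ D\<close>.\<close>
  define w0 where "w0 = (1 - \<delta> / 2) ^ D / real N"
  have w0: "w0 > 0" using \<delta> N by (simp add: w0_def)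
  have w_far: "w n \<le> e * w0" if "dd \<gamma> xs n > \<delta>" for n
  proof -
    have "w n \<le> (1 - \<delta>) ^ D" unfolding w_def using that dd01[of n] by (intro power_mono) auto
    also have "\<dots> = r ^ D * (1 - \<delta> / 2) ^ D" using \<delta> by (simp add: r_def power_divide)
    also have "\<dots> \<le> e / real N * (1 - \<delta> / 2) ^ D" using D \<delta> by (intro mult_right_mono) auto
    also have "\<dots> = e * w0" by (simp add: w0_def)
    finally show ?thesis .
  qed
  obtain C where C: "schur C w" unfolding w_def \<gamma>_def by (rule schur_dd_power[OF \<theta>0i])
  \<comment> \<open>Three errors of size \<open>C * \<eta>\<close> together stay below
    \<open>e * w0\<close>; \<open>C + 1\<close> avoids a zero denominator.\<close>
  define \<eta> where "\<eta> = e * w0 / (3 * (C + 1))"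
  have C0: "C \<ge> 0" by (rule schur_nonneg[OF C])
  have \<eta>: "\<eta> > 0" using e w0 C0 by (simp add: \<eta>_def)
  have C\<eta>: "3 * (C * \<eta>) \<le> e * w0"
  proof -
    have "3 * (C * \<eta>) = C / (C + 1) * (e * w0)" using C0 by (simp add: \<eta>_def field_simps)
    also have "\<dots> \<le> 1 * (e * w0)" using C0 e w0 by (intro mult_right_mono) auto
    finally show ?thesis by simp
  qed
  show thesis
  proof (rule uniform_structure[OF \<theta>0i \<theta>0e \<eta>, where m = m])
    fix \<theta> m'
    assume ext: "(\<theta>, m') \<in> extensions \<theta>0 m"
      and small: "\<And>q. q < 3 \<Longrightarrow> \<exists>I>0. \<theta> (cutat q (\<lambda>\<omega>. base \<omega> - proj \<theta> q m' \<omega>) I) < \<eta> * (real I)\<^sup>2"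
    have \<theta>: "imean \<theta>" "erg \<theta>" and ag: "agree m \<theta>0 \<theta>" and mm: "m \<le> m'" using ext by (simp_all add: extensions_def)
    note M = imean_mean[OF \<theta>(1)]
    have ag0: "agree 0 \<psi> \<theta>" using extensions_trans[OF \<theta>0 ext] by (simp add: extensions_def)
    have \<gamma>\<theta>: "\<gamma> = gam \<theta> m" unfolding \<gamma>_def by (rule gam_agree[OF ag])
    have a\<theta>: "\<theta> base = a" using agreeD[OF ag0 cyl_base] by (simp add: a_def)
    define G where "G q = proj \<theta> q m'" for q
    define H where "H q = proj \<theta> q m" for q
    have G: "0 \<le> G q \<omega>" "\<bar>G q \<omega>\<bar> \<le> 1" "bddf (G q)" and H: "0 \<le> H q \<omega>" "\<bar>H q \<omega>\<bar> \<le> 1" "bddf (H q)" for q \<omega>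
      unfolding G_def H_def by (rule proj_nonneg[OF M] abs_proj[OF M] bddf_proj[OF M])+
    have GH1: "\<bar>G q \<omega> - H q \<omega>\<bar> \<le> 1" for q \<omega>
      using G(1)[of q \<omega>] G(2)[of q \<omega>] H(1)[of q \<omega>] H(2)[of q \<omega>] by linarith
    have bG1: "\<bar>base \<omega> - G q \<omega>\<bar> \<le> 1" for q \<omega>
      using G(1)[of q \<omega>] G(2)[of q \<omega>] base_nonneg[of \<omega>] base_le_one[of \<omega>] by linarith
    obtain I where I: "\<And>q. q < 3 \<Longrightarrow> I q > (0::nat)"
      and cutI: "\<And>q. q < 3 \<Longrightarrow> \<theta> (cutat q (\<lambda>\<omega>. base \<omega> - G q \<omega>) (I q)) < \<eta> * (real (I q))\<^sup>2"
      using bchoice[of "{..<3::nat}" "\<lambda>q I. I > 0 \<and> \<theta> (cutat q (\<lambda>\<omega>. base \<omega> - G q \<omega>) I) < \<eta> * (real I)\<^sup>2"] small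
      unfolding G_def by auto
    define err where "err j q = (if q < j then G q else if q = j then (\<lambda>\<omega>. base \<omega> - G q \<omega>) else base)" for j q
    have err1: "\<bar>err j q \<omega>\<bar> \<le> 1" for j q \<omega> using G(2) bG1 by (simp add: err_def)
    have corner_split: "corner \<theta> (\<lambda>_. base) n = corner \<theta> G n + (\<Sum>j<3. corner \<theta> (err j) n)" for n
      using corner_telescope[OF M, of "\<lambda>_. base" G n] G(3) by (simp add: err_def[abs_def])
    have GH: "\<bar>corner \<theta> G n - corner \<theta> H n\<bar> \<le> 3 * e" for n
    proof -
      let ?f = "\<lambda>j q. if q < j then H q else if q = j then (\<lambda>\<omega>. G q \<omega> - H q \<omega>) else G q"
      have "\<bar>corner \<theta> (?f j) n\<bar> \<le> e" if j: "j < 3" for j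
      proof -
        have f1: "\<bar>?f j k \<omega>\<bar> \<le> 1" for k \<omega> using G(2) H(2) GH1 by simp
        have "bddf (?f j k)" for k by (rule bddfI) (rule f1)
        then have "\<bar>corner \<theta> (?f j) n\<bar> \<le> \<theta> (\<lambda>\<omega>. \<bar>?f j j \<omega>\<bar>)"
          by (rule abs_corner_le[OF \<theta>(1) _ f1 j])
        then have "\<bar>corner \<theta> (?f j) n\<bar> \<le> \<theta> (\<lambda>\<omega>. \<bar>G j \<omega> - H j \<omega>\<bar>)" by simp
        moreover have "(\<theta> (\<lambda>\<omega>. \<bar>G j \<omega> - H j \<omega>\<bar>))\<^sup>2 \<le> e\<^sup>2"
          using order_trans[OF mean_square[OF M, of "\<lambda>\<omega>. \<bar>G j \<omega> - H j \<omega>\<bar>"]] coarse[OF ext j] G(3) H(3)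
          by (simp add: G_def H_def bddf_simps)
        ultimately show ?thesis using e(1) power2_le_imp_le by fastforce
      qed
      then have "\<bar>\<Sum>j<3. corner \<theta> (?f j) n\<bar> \<le> (\<Sum>j<3::nat. e)"
        by (intro order_trans[OF sum_abs] sum_mono) simp
      then show ?thesis using corner_telescope[OF M, of G H n] G(3) H(3) by simp
    qed
    have H0: "a ^ 4 \<le> corner \<theta> H 0"
    proof -
      have z: "vt q (\<lambda>k. if k = 2 then 0 else 0) = 0" for q by (simp add: vt_def zero_prod_def)
      have "corner \<theta> H 0 = \<theta> (\<lambda>\<omega>. H 0 \<omega> * H 1 \<omega> * H 2 \<omega>)" unfolding corner_def trip_def z by simp
      then show ?thesis using proj_product_ge[OF M, of m] a0 by (simp add: a\<theta> H_def)
    qed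
    have near: "corner \<theta> H n \<ge> a ^ 4 - e" if d: "dd \<gamma> xs n \<le> \<delta>" for n
    proof -
      have "\<bar>tri \<theta> m \<alpha> \<beta> \<zeta> n - tri \<theta> m \<alpha> \<beta> \<zeta> 0\<bar> \<le> \<kappa>" if \<beta>: "\<beta> \<subseteq> {..<m}" for \<alpha> \<beta> \<zeta>
      proof -
        have "(tri \<theta> m \<alpha> \<beta> \<zeta> n - tri \<theta> m \<alpha> \<beta> \<zeta> 0)\<^sup>2 \<le> 2 * t"
          using d unfolding \<delta>_def \<gamma>\<theta> by (intro tri_diff_le_of_dd[OF \<theta> xs \<beta> t(1)])
        also have "\<dots> = \<kappa>\<^sup>2" by (simp add: t_def)
        finally show ?thesis using \<kappa>(1) by (simp add: abs_le_square_iff[symmetric])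
      qed
      from corner_proj_diff_le[OF \<theta>(1) this]
      have "\<bar>corner \<theta> H n - corner \<theta> H 0\<bar> \<le> e" by (simp add: H_def[abs_def] \<kappa>_def)
      then show ?thesis using H0 by linarith
    qed
    have G0: "corner \<theta> G n \<ge> 0" for n
      unfolding corner_def trip_def
      by (intro mean_nonneg[OF M] bddf_mult bddf_tau[OF G(3)] mult_nonneg_nonneg G(1))
    \<comment> \<open>Near a return the correlation is close to its value at 0. Elsewhere only the
      nonnegativity of the corner of \<open>G\<close> and the smallness of \<open>w\<close> are
      used.\<close>
    have main: "w n * corner \<theta> G n \<ge> w n * (a ^ 4 - 4 * e) - e * w0" for n
    proof (cases "dd \<gamma> xs n \<le> \<delta>")
      case True
      have "corner \<theta> G n \<ge> a ^ 4 - 4 * e" using near[OF True] GH[of n] by linarith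
      then have "w n * corner \<theta> G n \<ge> w n * (a ^ 4 - 4 * e)" using w01 by (intro mult_left_mono)
      moreover have "e * w0 \<ge> 0" using e w0 by simp
      ultimately show ?thesis by linarith
    next
      case False
      have "a ^ 4 \<le> 1" using a0 a1 by (simp add: power_le_one)
      then have "w n * (a ^ 4 - 4 * e) \<le> w n * 1" using w01(1) e by (intro mult_left_mono) auto
      moreover have "w n \<le> e * w0" using False by (intro w_far) simp
      moreover have "0 \<le> w n * corner \<theta> G n" by (intro mult_nonneg_nonneg w01 G0)
      ultimately show ?thesis by linarith
    qed
    define T where "T = (\<Sum>j<3. 4 * real (I j))"
    \<comment> \<open>The window sizes \<open>I j\<close>, and with them the boundary terms, are
      fixed by now, so a long enough interval absorbs them. Its length \<open>N * J\<close> serves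
      for all positions.\<close>
    obtain J :: nat where J: "J > 0" "T \<le> real J * (real N * e * w0)"
    proof -
      have "real N * e * w0 > 0" using N e w0 by simp
      then obtain J :: nat where "T < real J * (real N * e * w0)" using reals_Archimedean3 by blast
      moreover have "T \<ge> 0" unfolding T_def by (rule sum_nonneg) simp
      ultimately show thesis by (intro that[of J]) (auto intro: gr0I)
    qed
    let ?L = "N * J"
    have L: "real ?L * w0 = real J * (1 - \<delta> / 2) ^ D" using N by (simp add: w0_def)
    have "\<exists>n\<in>{K..<K + int ?L}. corner \<psi> (\<lambda>_. base) n > a ^ 4 - \<epsilon>" for K
    proof (rule ccontr)
      let ?A = "{K..<K + int ?L}"
      assume neg: "\<not> (\<exists>n\<in>?A. corner \<psi> (\<lambda>_. base) n > a ^ 4 - \<epsilon>)"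
      have bad: "corner \<psi> (\<lambda>_. base) n \<le> a ^ 4 - 8 * e" if "n \<in> ?A" for n
      proof -
        have "\<not> corner \<psi> (\<lambda>_. base) n > a ^ 4 - \<epsilon>" using neg that by blast
        then show ?thesis using e(3) by linarith
      qed
      define S where "S = (\<Sum>n\<in>?A. w n)"
      have S: "real ?L * w0 \<le> S"
        unfolding L S_def
      proof (rule sum_periodic_lower_bound[OF w01(1)])
        fix K
        obtain n where "n \<in> {K..<K + int N}" "dd \<gamma> xs n \<le> \<delta> / 2" using ret by blast
        moreover from this(2) have "(1 - \<delta> / 2) ^ D \<le> w n"
          unfolding w_def using \<delta> by (intro power_mono) auto
        ultimately show "\<exists>n\<in>{K..<K + int N}. (1 - \<delta> / 2) ^ D \<le> w n" by blast
      qed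
      have Lp: "real ?L * w0 > 0" using N J w0 by simp
      have errb: "\<bar>\<Sum>n\<in>?A. w n * corner \<theta> (err j) n\<bar> \<le> real ?L * (C * \<eta>) + 4 * real (I j)" if j: "j < 3" for j
      proof -
        have "\<bar>w n\<bar> \<le> 1" for n using w01[of n] by simp
        then have "\<bar>\<Sum>n\<in>?A. w n * corner \<theta> (err j) n\<bar>
            \<le> real ?L * C * \<theta> (cutat j (err j j) (I j)) / (real (I j))\<^sup>2 + 4 * real (I j) * 1"
          by (intro abs_sum_corner_le_cut[OF \<theta>(1) err1 j C _ I[OF j]])
        also have "real ?L * C * \<theta> (cutat j (err j j) (I j)) / (real (I j))\<^sup>2 \<le> real ?L * C * \<eta>"
        proof -
          have "\<theta> (cutat j (err j j) (I j)) / (real (I j))\<^sup>2 \<le> \<eta>"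
            using cutI[OF j] I[OF j] by (simp add: err_def pos_divide_le_eq)
          then have "real ?L * C * (\<theta> (cutat j (err j j) (I j)) / (real (I j))\<^sup>2) \<le> real ?L * C * \<eta>"
            using C0 by (intro mult_left_mono) auto
          then show ?thesis by simp
        qed
        finally show ?thesis by (simp add: mult.assoc)
      qed
      have "\<bar>\<Sum>j<3. \<Sum>n\<in>?A. w n * corner \<theta> (err j) n\<bar> \<le> (\<Sum>j<3. real ?L * (C * \<eta>) + 4 * real (I j))"
        by (intro order_trans[OF sum_abs] sum_mono errb) simp
      also have "\<dots> = real ?L * (3 * (C * \<eta>)) + T" by (simp add: T_def sum.distrib)
      also have "\<dots> \<le> real ?L * (e * w0) + real ?L * (e * w0)"
        using C\<eta> J(2) by (intro add_mono mult_left_mono) (auto simp: mult_ac)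
      also have "\<dots> = 2 * e * (real ?L * w0)" by (simp add: mult_ac)
      also have "\<dots> \<le> 2 * e * S" using S e by (intro mult_left_mono) auto
      finally have 1: "\<bar>\<Sum>j<3. \<Sum>n\<in>?A. w n * corner \<theta> (err j) n\<bar> \<le> 2 * e * S" .
      have "(\<Sum>n\<in>?A. w n * corner \<theta> G n) \<ge> (\<Sum>n\<in>?A. w n * (a ^ 4 - 4 * e) - e * w0)"
        by (intro sum_mono main)
      moreover have "(\<Sum>n\<in>?A. w n * (a ^ 4 - 4 * e) - e * w0) = S * (a ^ 4 - 4 * e) - e * (real ?L * w0)"
        by (simp add: S_def sum_subtractf sum_distrib_right)
      moreover have "e * (real ?L * w0) \<le> e * S" using S e by (intro mult_left_mono) auto
      ultimately have 2: "(\<Sum>n\<in>?A. w n * corner \<theta> G n) \<ge> S * (a ^ 4 - 4 * e) - e * S" by linarith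
      have "(\<Sum>n\<in>?A. w n * corner \<theta> (\<lambda>_. base) n) = (\<Sum>n\<in>?A. w n * corner \<theta> G n) + (\<Sum>j<3. \<Sum>n\<in>?A. w n * corner \<theta> (err j) n)"
        unfolding corner_split distrib_left sum.distrib sum_distrib_left by (subst sum.swap) (rule refl)
      moreover have "S * (a ^ 4 - 7 * e) = S * (a ^ 4 - 4 * e) - e * S - 2 * e * S" by (simp add: algebra_simps)
      ultimately have 3: "(\<Sum>n\<in>?A. w n * corner \<theta> (\<lambda>_. base) n) \<ge> S * (a ^ 4 - 7 * e)"
        using 1 2 by linarith
      have "corner \<theta> (\<lambda>_. base) n = corner \<psi> (\<lambda>_. base) n" for n
        unfolding corner_def trip_def
        by (rule agreeD[OF ag0, symmetric]) (intro cyl_mult cyl_tau[OF cyl_base])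
      then have "(\<Sum>n\<in>?A. w n * corner \<theta> (\<lambda>_. base) n) \<le> (\<Sum>n\<in>?A. w n * (a ^ 4 - 8 * e))"
        using bad w01 by (intro sum_mono mult_left_mono) auto
      also have "\<dots> = S * (a ^ 4 - 8 * e)" by (simp add: S_def sum_distrib_right)
      finally have "S * (a ^ 4 - 7 * e) \<le> S * (a ^ 4 - 8 * e)" using 3 by linarith
      moreover have "S > 0" using S Lp by linarith
      ultimately show False using e(1) by (simp add: mult_le_cancel_left_pos)
    qed
    then show thesis using that[of ?L] N J(1) unfolding a_def by simp
  qed
qed

section \<open>Measure preserving actions\<close>

locale z2_action = prob_space M for M :: "'a measure" +
  fixes ac :: "int \<times> int \<Rightarrow> 'a \<Rightarrow> 'a"
  assumes ac_measurable [measurable]: "ac e \<in> M \<rightarrow>\<^sub>M M"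
    and ac_zero: "x \<in> space M \<Longrightarrow> ac 0 x = x"
    and ac_add: "x \<in> space M \<Longrightarrow> ac (e + e') x = ac e (ac e' x)"
    and ac_preserves: "B \<in> sets M \<Longrightarrow> emeasure M (ac e -` B \<inter> space M) = emeasure M B"
    and ac_ergodic: "B \<in> sets M \<Longrightarrow> (\<And>e. ac e -` B \<inter> space M = B) \<Longrightarrow> measure M B = 0 \<or> measure M B = 1"
begin

lemma ac_space [simp]: "x \<in> space M \<Longrightarrow> ac e x \<in> space M"
  using ac_measurable by (rule measurable_space)

lemma distr_ac: "distr M M (ac e) = M"
  by (rule measure_eqI) (simp_all add: emeasure_distr ac_preserves)

lemma integral_ac:
  fixes f :: "'a \<Rightarrow> real"
  assumes f [measurable]: "f \<in> borel_measurable M"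
  shows "(\<integral>x. f (ac e x) \<partial>M) = (\<integral>x. f x \<partial>M)"
proof -
  have "(\<integral>x. f x \<partial>M) = (\<integral>x. f x \<partial>distr M M (ac e))" by (simp only: distr_ac)
  also have "\<dots> = (\<integral>x. f (ac e x) \<partial>M)" by (rule integral_distr) simp_all
  finally show ?thesis ..
qed

lemma bounded_integrable:
  fixes f :: "'a \<Rightarrow> real"
  assumes "f \<in> borel_measurable M" "\<And>x. \<bar>f x\<bar> \<le> C"
  shows "integrable M f"
  using assms by (intro integrable_const_bound[where B = C]) auto

lemma abs_integral_le:
  fixes f :: "'a \<Rightarrow> real"
  assumes "f \<in> borel_measurable M" "\<And>x. \<bar>f x\<bar> \<le> C"
  shows "\<bar>\<integral>x. f x \<partial>M\<bar> \<le> C"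
proof -
  have "\<bar>\<integral>x. f x \<partial>M\<bar> \<le> (\<integral>x. \<bar>f x\<bar> \<partial>M)" by (rule integral_abs_bound)
  also have "\<dots> \<le> (\<integral>x. C \<partial>M)"
    by (rule integral_mono[OF integrable_abs[OF bounded_integrable[OF assms]] integrable_const assms(2)])
  finally show ?thesis by (simp add: prob_space)
qed

text \<open>The intersection of all translates is strictly invariant and, the group being countable,
  differs from \<open>E\<close> by a null set.\<close>

lemma almost_invariant_zero_one:
  assumes E [measurable]: "E \<in> sets M" and null: "\<And>e. measure M (E - (ac e -` E \<inter> space M)) = 0"
  shows "measure M E = 0 \<or> measure M E = 1"
proof -
  define E' where "E' = (\<Inter>e. ac e -` E \<inter> space M)"
  have E'm [measurable]: "E' \<in> sets M" unfolding E'_def by (intro sets.countable_INT) auto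
  have EE: "E' \<subseteq> E"
  proof
    fix x assume "x \<in> E'"
    then have "x \<in> ac 0 -` E \<inter> space M" unfolding E'_def by blast
    then show "x \<in> E" by (auto simp: ac_zero)
  qed
  have "E - E' = (\<Union>e. E - (ac e -` E \<inter> space M))" by (auto simp: E'_def)
  moreover have "(\<Union>e. E - (ac e -` E \<inter> space M)) \<in> null_sets M"
    using null by (intro null_sets_UN) (simp add: null_setsI emeasure_eq_measure)
  ultimately have "measure M (E - E') = 0" by (metis measure_eq_0_null_sets)
  then have eq: "measure M E = measure M E'" using finite_measure_Diff[OF E E'm EE] by simp
  have "measure M E' = 0 \<or> measure M E' = 1"
  proof (rule ac_ergodic[OF E'm])
    fix e
    show "ac e -` E' \<inter> space M = E'"
    proof (intro set_eqI iffI)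
      fix x assume x: "x \<in> ac e -` E' \<inter> space M"
      then have *: "ac e' (ac e x) \<in> E" for e' unfolding E'_def by blast
      have "ac e' x \<in> E" for e' using *[of "e' - e"] ac_add[of x "e' - e" e] x by simp
      then show "x \<in> E'" using x by (auto simp: E'_def)
    next
      fix x assume x: "x \<in> E'"
      then have xs: "x \<in> space M" by (auto simp: E'_def)
      have "ac (e' + e) x \<in> E" for e' using x unfolding E'_def by blast
      then have "ac e' (ac e x) \<in> E" for e' using xs by (simp add: ac_add)
      then show "x \<in> ac e -` E' \<inter> space M" using xs by (auto simp: E'_def)
    qed
  qed
  then show ?thesis by (simp add: eq)
qed

text \<open>Take the density \<rho> of \<open>n\<close> and the set \<open>E\<close> where it
  exceeds \<open>t\<close>, the total value of \<open>n\<close>. Ergodicity gives \<open>E\<close>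
  measure 0 or 1, and 1 would make \<open>n E\<close> exceed \<open>t\<close>. So \<open>n\<close>
  is at most \<open>t\<close> times the measure on every set; applied to the complement, this gives
  equality.\<close>

lemma invariant_dominated_rigid:
  fixes n :: "'a set \<Rightarrow> real"
  assumes n0: "\<And>B. B \<in> sets M \<Longrightarrow> 0 \<le> n B" and n1: "\<And>B. B \<in> sets M \<Longrightarrow> n B \<le> measure M B"
    and add: "\<And>B C. B \<in> sets M \<Longrightarrow> C \<in> sets M \<Longrightarrow> B \<inter> C = {} \<Longrightarrow> n (B \<union> C) = n B + n C"
    and inv: "\<And>B e. B \<in> sets M \<Longrightarrow> n (ac e -` B \<inter> space M) = n B"
    and B: "B \<in> sets M"
  shows "n B = n (space M) * measure M B"
proof -
  define N where "N = measure_of (space M) (sets M) (\<lambda>B. ennreal (n B))"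
  define t where "t = n (space M)"
  have t0: "t \<ge> 0" unfolding t_def by (rule n0) simp
  have sN [simp]: "sets N = sets M" by (simp add: N_def)
  have n_empty: "n {} = 0" using n0[of "{}"] n1[of "{}"] by simp
  have pos: "positive (sets M) (\<lambda>B. ennreal (n B))" by (simp add: positive_def n_empty)
  \<comment> \<open>Domination by the measure gives continuity at the empty set, which upgrades
    finite to countable additivity.\<close>
  have "countably_additive (sets M) (\<lambda>B. ennreal (n B))"
  proof (rule sets.empty_continuous_imp_countably_additive[OF pos])
    show "additive (sets M) (\<lambda>B. ennreal (n B))"
      by (auto simp: additive_def add n0 ennreal_plus)
    fix A :: "nat \<Rightarrow> 'a set" assume A: "range A \<subseteq> sets M" "decseq A" "(\<Inter>i. A i) = {}"
    have "(\<lambda>i. measure M (A i)) \<longlonglongrightarrow> measure M (\<Inter>i. A i)"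
      by (rule finite_Lim_measure_decseq[OF A(1,2)])
    then have "(\<lambda>i. measure M (A i)) \<longlonglongrightarrow> 0" using A(3) by simp
    then have "(\<lambda>i. n (A i)) \<longlonglongrightarrow> 0"
      by (rule tendsto_sandwich[OF _ _ tendsto_const, rotated 2]) (use A(1) n0 n1 in auto)
    then show "(\<lambda>i. ennreal (n (A i))) \<longlonglongrightarrow> 0" using tendsto_ennrealI by fastforce
  qed simp
  then have eN: "emeasure N B = ennreal (n B)" if "B \<in> sets M" for B
    using that pos by (intro emeasure_measure_of[OF N_def]) (auto simp: sets.space_closed)
  have "absolutely_continuous M N"
    unfolding absolutely_continuous_def
  proof
    fix B assume "B \<in> null_sets M"
    then have "B \<in> sets M" "measure M B = 0" by (auto simp: measure_eq_0_null_sets)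
    then show "B \<in> null_sets N" using n0[of B] n1[of B] by (simp add: null_sets_def eN)
  qed
  then obtain \<rho> where \<rho> [measurable]: "\<rho> \<in> borel_measurable M" and dens: "density M \<rho> = N"
    using Radon_Nikodym[of N] by auto
  have nB: "(\<integral>\<^sup>+x. \<rho> x * indicator B x \<partial>M) = ennreal (n B)" if "B \<in> sets M" for B
    using that eN by (simp add: dens[symmetric] emeasure_density)
  define E where "E = {x \<in> space M. \<rho> x > ennreal t}"
  have E [measurable]: "E \<in> sets M" unfolding E_def by measurable
  have low: "n B \<le> t * measure M B" if B [measurable]: "B \<in> sets M" and "B \<inter> E = {}" for B
  proof -
    have "ennreal (n B) = (\<integral>\<^sup>+x. \<rho> x * indicator B x \<partial>M)" using nB[OF B] ..
    also have "\<dots> \<le> (\<integral>\<^sup>+x. ennreal t * indicator B x \<partial>M)"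
      using \<open>B \<inter> E = {}\<close> by (intro nn_integral_mono) (auto simp: E_def indicator_def not_less)
    also have "\<dots> = ennreal (t * measure M B)"
      by (simp add: nn_integral_cmult_indicator emeasure_eq_measure ennreal_mult t0)
    finally show ?thesis using t0 by (simp add: ennreal_le_iff)
  qed
  have high: "t * measure M B < n B" if B [measurable]: "B \<in> sets M" and BE: "B \<subseteq> E" and pos: "measure M B \<noteq> 0" for B
  proof (rule ccontr)
    assume "\<not> t * measure M B < n B"
    then have le: "ennreal (n B) \<le> ennreal (t * measure M B)" by (simp add: ennreal_leI)
    have "ennreal (n B) = (\<integral>\<^sup>+x. \<rho> x * indicator B x \<partial>M)" using nB[OF B] ..
    also have "\<dots> = (\<integral>\<^sup>+x. ennreal t * indicator B x + (\<rho> x - ennreal t) * indicator B x \<partial>M)"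
      using BE by (intro nn_integral_cong) (auto simp: E_def indicator_def add_diff_inverse_ennreal less_imp_le)
    also have "\<dots> = (\<integral>\<^sup>+x. ennreal t * indicator B x \<partial>M) + (\<integral>\<^sup>+x. (\<rho> x - ennreal t) * indicator B x \<partial>M)"
      by (rule nn_integral_add) simp_all
    also have "(\<integral>\<^sup>+x. ennreal t * indicator B x \<partial>M) = ennreal (t * measure M B)"
      by (simp add: nn_integral_cmult_indicator emeasure_eq_measure ennreal_mult t0)
    finally have "ennreal (t * measure M B) + (\<integral>\<^sup>+x. (\<rho> x - ennreal t) * indicator B x \<partial>M) \<le> ennreal (t * measure M B) + 0"
      using le by simp
    then have "(\<integral>\<^sup>+x. (\<rho> x - ennreal t) * indicator B x \<partial>M) = 0"
      by (subst (asm) ennreal_add_left_cancel_le) auto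
    then have "AE x in M. (\<rho> x - ennreal t) * indicator B x = 0"
      by (subst (asm) nn_integral_0_iff_AE) auto
    then have "AE x in M. x \<notin> B"
    proof (rule AE_mp[OF _ AE_I2], intro impI notI)
      fix x assume "(\<rho> x - ennreal t) * indicator B x = 0" "x \<in> B"
      then have "\<rho> x \<le> ennreal t" by (simp add: diff_eq_0_iff_ennreal)
      then show False using BE \<open>x \<in> B\<close> by (auto simp: E_def)
    qed
    then have "measure M B = 0" using B by (simp add: AE_iff_null_sets measure_eq_0_null_sets)
    then show False using pos by simp
  qed
  have meas_diff: "measure M (A - C) = measure M (C - A) \<and> n (A - C) = n (C - A)"
    if A [measurable]: "A \<in> sets M" and C [measurable]: "C \<in> sets M" and "measure M A = measure M C" "n A = n C" for A C
  proof -
    have "n A = n (A \<inter> C) + n (A - C)" if "A \<in> sets M" "C \<in> sets M" for A C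
    proof -
      have "n (A \<inter> C \<union> (A - C)) = n (A \<inter> C) + n (A - C)" using that by (intro add) auto
      then show ?thesis by (simp add: Int_Diff_Un)
    qed
    from this[OF A C] this[OF C A] have "n A = n (A \<inter> C) + n (A - C)" "n C = n (A \<inter> C) + n (C - A)"
      by (simp_all add: Int_commute)
    moreover have "measure M (A - C) = measure M A - measure M (A \<inter> C)" "measure M (C - A) = measure M C - measure M (A \<inter> C)"
      using finite_measure_Diff'[OF A C] finite_measure_Diff'[OF C A] by (simp_all add: Int_commute)
    ultimately show ?thesis using that by simp
  qed
  \<comment> \<open>\<open>E\<close> and its preimage agree in measure and in \<open>n\<close>,
    hence so do their two differences. On the part inside \<open>E\<close>, if not null,
    \<open>n\<close> exceeds \<open>t\<close> times the measure, on the part outside it does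
    not.\<close>
  have "measure M E = 0 \<or> measure M E = 1"
  proof (rule almost_invariant_zero_one[OF E], rule ccontr)
    fix e assume ne: "measure M (E - (ac e -` E \<inter> space M)) \<noteq> 0"
    let ?E = "ac e -` E \<inter> space M"
    have E2 [measurable]: "?E \<in> sets M" by measurable
    have m: "measure M E = measure M ?E" using ac_preserves[OF E, of e] by (simp add: measure_def)
    have d: "measure M (E - ?E) = measure M (?E - E) \<and> n (E - ?E) = n (?E - E)"
      by (rule meas_diff[OF E E2 m]) (simp add: inv[OF E])
    have "t * measure M (E - ?E) < n (E - ?E)" by (rule high[OF _ _ ne]) auto
    moreover have "n (?E - E) \<le> t * measure M (?E - E)" by (rule low) auto
    ultimately show False using d by simp
  qed
  moreover have "measure M E \<noteq> 1"
  proof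
    assume 1: "measure M E = 1"
    have "t * measure M E < n E" by (rule high) (use 1 in auto)
    moreover have "n E \<le> t"
    proof -
      have "E \<union> (space M - E) = space M" using sets.sets_into_space[OF E] by auto
      then have "t = n E + n (space M - E)" using add[of E "space M - E"] by (simp add: t_def)
      moreover have "0 \<le> n (space M - E)" by (rule n0) auto
      ultimately show ?thesis by simp
    qed
    ultimately show False using 1 by simp
  qed
  ultimately have E0: "measure M E = 0" by blast
  have le: "n B \<le> t * measure M B" if B [measurable]: "B \<in> sets M" for B
  proof -
    have "n B = n (B \<inter> E) + n (B - E)" using add[of "B \<inter> E" "B - E"] by (simp add: Int_Diff_Un Int_Diff_disjoint)
    moreover have "n (B \<inter> E) \<le> 0"
      using n1[of "B \<inter> E"] finite_measure_mono[of "B \<inter> E" E] E0 by simp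
    moreover have "n (B - E) \<le> t * measure M (B - E)" by (rule low) auto
    moreover have "t * measure M (B - E) \<le> t * measure M B" by (intro mult_left_mono finite_measure_mono t0) auto
    ultimately show ?thesis by linarith
  qed
  have "t = n B + n (space M - B)"
  proof -
    have "B \<union> (space M - B) = space M" using sets.sets_into_space[OF B] by auto
    then show ?thesis using add[of B "space M - B"] B by (simp add: t_def)
  qed
  moreover have "n (space M - B) \<le> t * measure M (space M - B)" by (rule le) (use B in auto)
  moreover have "measure M (space M - B) = 1 - measure M B" using prob_compl[OF B] .
  ultimately show ?thesis using le[OF B] by (simp add: t_def algebra_simps)
qed

text \<open>Argues by compactness: bad boxes of growing size yield, in the limit, an invariant set
  function \<open>n\<close>, dominated by the measure since \<open>v\<close> lies in the unit
  interval. Rigidity identifies it as a multiple of the measure, and summing over the finitely many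
  level sets of \<open>f\<close> contradicts the choice of the boxes.\<close>

lemma mean_ergodic_unit:
  fixes f v :: "'a \<Rightarrow> real"
  assumes f [measurable]: "f \<in> borel_measurable M" and fin: "finite (range f)"
    and v [measurable]: "v \<in> borel_measurable M" and v01: "\<And>x. 0 \<le> v x" "\<And>x. v x \<le> 1"
    and \<epsilon>: "\<epsilon> > 0"
  shows "\<exists>K0>0. \<forall>K\<ge>K0. \<forall>s.
    \<bar>(\<Sum>j\<in>grid K. \<integral>x. f x * v (ac (s + j) x) \<partial>M) / (real K)\<^sup>2 - (\<integral>x. f x \<partial>M) * (\<integral>x. v x \<partial>M)\<bar> \<le> \<epsilon>"
proof (rule ccontr)
  define B where "B K s \<longleftrightarrow> \<bar>(\<Sum>j\<in>grid K. \<integral>x. f x * v (ac (s + j) x) \<partial>M) / (real K)\<^sup>2 - (\<integral>x. f x \<partial>M) * (\<integral>x. v x \<partial>M)\<bar> > \<epsilon>" for K s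
  assume "\<not> ?thesis"
  then have ex: "\<exists>K. Suc k \<le> K \<and> (\<exists>s. B K s)" for k
    unfolding B_def by (meson not_le zero_less_Suc)
  obtain K where K: "\<And>k. Suc k \<le> K k" and "\<And>k. \<exists>s. B (K k) s"
    using choice[of "\<lambda>k K. Suc k \<le> K \<and> (\<exists>s. B K s)"] ex by blast
  then obtain s where bad: "\<And>k. B (K k) (s k)"
    using choice[of "\<lambda>k. B (K k)"] by blast
  have Kp: "real (K k) > 0" for k using K[of k] by simp
  define A where "A k x = (\<Sum>j\<in>grid (K k). v (ac (s k + j) x)) / (real (K k))\<^sup>2" for k x
  have vm [measurable]: "(\<lambda>x. v (ac e x)) \<in> borel_measurable M" for e by measurable
  have Am [measurable]: "A k \<in> borel_measurable M" for k unfolding A_def by measurable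
  have A01: "0 \<le> A k x" "A k x \<le> 1" for k x
  proof -
    show "0 \<le> A k x" unfolding A_def by (intro divide_nonneg_nonneg sum_nonneg v01) auto
    have "(\<Sum>j\<in>grid (K k). v (ac (s k + j) x)) \<le> (\<Sum>j\<in>grid (K k). 1)" by (intro sum_mono v01)
    then show "A k x \<le> 1" using Kp[of k] by (simp add: A_def divide_le_eq)
  qed
  define ok where "ok h \<longleftrightarrow> h \<in> borel_measurable M \<and> bddf h" for h :: "'a \<Rightarrow> real"
  \<comment> \<open>Outside the bounded measurable functions the value 0 keeps the family bounded at
    every index, as compactness requires.\<close>
  define X where "X k h = (if ok h then \<integral>x. h x * A k x \<partial>M else 0)" for k and h :: "'a \<Rightarrow> real"
  define C where "C h = (SOME C. 0 \<le> C \<and> (bddf h \<longrightarrow> (\<forall>x. \<bar>h x\<bar> \<le> C)))" for h :: "'a \<Rightarrow> real"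
  have C: "0 \<le> C h \<and> (bddf h \<longrightarrow> (\<forall>x. \<bar>h x\<bar> \<le> C h))" for h
  proof -
    have "\<exists>C. 0 \<le> C \<and> (bddf h \<longrightarrow> (\<forall>x. \<bar>h x\<bar> \<le> C))"
    proof (cases "bddf h")
      case True
      then obtain C where "C > 0" "\<And>x. \<bar>h x\<bar> \<le> C" using bddfE by blast
      then show ?thesis by (intro exI[of _ C]) simp
    qed auto
    then show ?thesis unfolding C_def by (rule someI_ex)
  qed
  have hA: "\<bar>h x * A k x\<bar> \<le> C h" if "ok h" for h k x
  proof -
    have "\<bar>h x\<bar> * \<bar>A k x\<bar> \<le> C h * 1"
      using C[of h] that A01[of k x] by (intro mult_mono') (auto simp: ok_def)
    then show ?thesis by (simp add: abs_mult)
  qed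
  have hAi: "integrable M (\<lambda>x. h x * A k x)" if h: "ok h" for h k
  proof -
    have [measurable]: "h \<in> borel_measurable M" using h by (simp add: ok_def)
    show ?thesis by (rule bounded_integrable[OF _ hA[OF h]]) simp
  qed
  have "\<bar>X k h\<bar> \<le> C h" for k h
  proof (cases "ok h")
    case True
    then have [measurable]: "h \<in> borel_measurable M" by (simp add: ok_def)
    show ?thesis using abs_integral_le[OF _ hA[OF True, of _ k]] True by (simp add: X_def)
  qed (use C in \<open>simp add: X_def\<close>)
  then obtain F Y where F: "F \<noteq> bot" "F \<le> sequentially" and L: "\<And>h. ((\<lambda>k. X k h) \<longlongrightarrow> Y h) F"
    using pointwise_cluster[of X C] by metis
  have Xeq: "X k h = (\<integral>x. h x * A k x \<partial>M)" if "ok h" for k h using that by (simp add: X_def)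
  define n where "n B = Y (indicator B)" for B
  have okI: "ok (indicator B)" if "B \<in> sets M" for B
    unfolding ok_def using that by (auto intro: bddfI[of _ 1] simp: indicator_def)
  have nL: "((\<lambda>k. \<integral>x. indicator B x * A k x \<partial>M) \<longlongrightarrow> n B) F" if "B \<in> sets M" for B
    using L[of "indicator B"] by (simp add: Xeq[OF okI[OF that]] n_def)
  have n0: "0 \<le> n B" if "B \<in> sets M" for B
    by (rule tendsto_lowerbound[OF nL[OF that] _ F(1)])
      (intro always_eventually allI integral_nonneg_AE AE_I2 mult_nonneg_nonneg A01, simp)
  have n1: "n B \<le> measure M B" if B: "B \<in> sets M" for B
  proof (rule tendsto_upperbound[OF nL[OF B] _ F(1)], intro always_eventually allI)
    fix k
    have "(\<integral>x. indicator B x * A k x \<partial>M) \<le> (\<integral>x. indicator B x \<partial>M)"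
    proof (rule integral_mono[OF hAi[OF okI[OF B]]])
      show "integrable M (indicator B :: 'a \<Rightarrow> real)"
        by (rule bounded_integrable[of _ 1]) (use B in \<open>auto simp: indicator_def\<close>)
    qed (use A01 in \<open>simp add: indicator_def\<close>)
    then show "(\<integral>x. indicator B x * A k x \<partial>M) \<le> measure M B" using B by simp
  qed
  have add: "n (B \<union> D) = n B + n D" if B: "B \<in> sets M" and D: "D \<in> sets M" and BD: "B \<inter> D = {}" for B D
  proof -
    have "(\<integral>x. indicator (B \<union> D) x * A k x \<partial>M) = (\<integral>x. indicator B x * A k x \<partial>M) + (\<integral>x. indicator D x * A k x \<partial>M)" for k
      unfolding Bochner_Integration.integral_add[OF hAi[OF okI[OF B]] hAi[OF okI[OF D]], symmetric]
      using BD by (intro Bochner_Integration.integral_cong) (auto simp: indicator_def)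
    then have "((\<lambda>k. \<integral>x. indicator (B \<union> D) x * A k x \<partial>M) \<longlongrightarrow> n B + n D) F"
      using tendsto_add[OF nL[OF B] nL[OF D]] by simp
    then show ?thesis using tendsto_unique[OF F(1) nL[of "B \<union> D"]] B D by blast
  qed
  have XG: "(\<integral>x. h x * A k x \<partial>M) = (\<Sum>j\<in>grid (K k). \<integral>x. h x * v (ac (s k + j) x) \<partial>M) / (real (K k))\<^sup>2"
    if h: "ok h" for h k
  proof -
    have [measurable]: "h \<in> borel_measurable M" using h by (simp add: ok_def)
    have "\<bar>h x * v (ac e x)\<bar> \<le> C h * 1" for e x
      unfolding abs_mult using C[of h] h v01[of "ac e x"] by (intro mult_mono') (auto simp: ok_def)
    then have i: "integrable M (\<lambda>x. h x * v (ac e x))" for e by (intro bounded_integrable[of _ "C h * 1"]) simp_all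
    have "(\<integral>x. h x * A k x \<partial>M) = (\<integral>x. (\<Sum>j\<in>grid (K k). h x * v (ac (s k + j) x)) / (real (K k))\<^sup>2 \<partial>M)"
      by (simp add: A_def sum_distrib_left)
    also have "\<dots> = (\<Sum>j\<in>grid (K k). \<integral>x. h x * v (ac (s k + j) x) \<partial>M) / (real (K k))\<^sup>2"
      using i by (simp add: Bochner_Integration.integral_sum)
    finally show ?thesis .
  qed
  have inv: "n (ac e -` B \<inter> space M) = n B" if B [measurable]: "B \<in> sets M" for B e
  proof -
    let ?B = "ac e -` B \<inter> space M"
    have B2: "?B \<in> sets M" by measurable
    define G where "G k j = (\<integral>x. indicator B x * v (ac (s k + j) x) \<partial>M)" for k j
    have G1: "\<bar>G k j\<bar> \<le> 1" for k j
      unfolding G_def by (rule abs_integral_le) (use v01 in \<open>auto simp: indicator_def\<close>)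
    have "(\<integral>x. indicator ?B x * v (ac (s k + j) x) \<partial>M) = G k (j + - e)" for k j
    proof -
      have "G k (j + - e) = (\<integral>x. indicator B (ac e x) * v (ac (s k + (j + - e)) (ac e x)) \<partial>M)"
        unfolding G_def by (rule integral_ac[symmetric]) simp
      also have "\<dots> = (\<integral>x. indicator ?B x * v (ac (s k + j) x) \<partial>M)"
        by (rule Bochner_Integration.integral_cong) (auto simp: indicator_def ac_add[symmetric])
      finally show ?thesis ..
    qed
    then have "(\<integral>x. indicator ?B x * A k x \<partial>M) - (\<integral>x. indicator B x * A k x \<partial>M)
        = ((\<Sum>j\<in>grid (K k). G k (j + - e)) - (\<Sum>j\<in>grid (K k). G k j)) / (real (K k))\<^sup>2" for k
      unfolding XG[OF okI[OF B]] XG[OF okI[OF B2]] by (simp add: G_def diff_divide_distrib)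
    moreover have "(\<lambda>k. ((\<Sum>j\<in>grid (K k). G k (j + - e)) - (\<Sum>j\<in>grid (K k). G k j)) / (real (K k))\<^sup>2) \<longlonglongrightarrow> 0"
      using K by (intro shifted_grid_average_tendsto[of G 1 K, OF G1]) (simp add: Suc_le_lessD)
    ultimately have "((\<lambda>k. (\<integral>x. indicator ?B x * A k x \<partial>M) - (\<integral>x. indicator B x * A k x \<partial>M)) \<longlongrightarrow> 0) F"
      using tendsto_mono[OF F(2)] by simp
    moreover have "((\<lambda>k. (\<integral>x. indicator ?B x * A k x \<partial>M) - (\<integral>x. indicator B x * A k x \<partial>M)) \<longlongrightarrow> n ?B - n B) F"
      by (intro tendsto_diff nL B B2)
    ultimately have "0 = n ?B - n B" by (rule tendsto_unique[OF F(1)])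
    then show ?thesis by simp
  qed
  have rigid: "n B = n (space M) * measure M B" if "B \<in> sets M" for B
    by (rule invariant_dominated_rigid[OF n0 n1 add inv that])
  have n_space: "n (space M) = (\<integral>x. v x \<partial>M)"
  proof -
    have "(\<integral>x. indicator (space M) x * A k x \<partial>M) = (\<integral>x. v x \<partial>M)" for k
    proof -
      have "(\<integral>x. indicator (space M) x * v (ac e x) \<partial>M) = (\<integral>x. v x \<partial>M)" for e
      proof -
        have "(\<integral>x. indicator (space M) x * v (ac e x) \<partial>M) = (\<integral>x. v (ac e x) \<partial>M)"
          by (rule Bochner_Integration.integral_cong) auto
        then show ?thesis using integral_ac[OF v] by simp
      qed
      then show ?thesis unfolding XG[OF okI[OF sets.top]] using Kp[of k] by simp
    qed
    then have "((\<lambda>k. \<integral>x. v x \<partial>M) \<longlongrightarrow> n (space M)) F" using nL[OF sets.top] by simp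
    then show ?thesis using tendsto_unique[OF F(1)] tendsto_const by blast
  qed
  define V where "V y = f -` {y} \<inter> space M" for y
  have V [measurable]: "V y \<in> sets M" for y unfolding V_def by measurable
  have f_sum: "f x = (\<Sum>y\<in>range f. y * indicator (V y) x)" if "x \<in> space M" for x
  proof -
    have "(\<Sum>y\<in>range f. y * indicator (V y) x) = (\<Sum>y\<in>range f. if f x = y then y else 0)"
      using that by (intro sum.cong) (auto simp: V_def indicator_def)
    then show ?thesis using fin by (simp add: sum.delta')
  qed
  have "(\<integral>x. f x * A k x \<partial>M) = (\<Sum>y\<in>range f. y * (\<integral>x. indicator (V y) x * A k x \<partial>M))" for k
  proof -
    have "(\<integral>x. f x * A k x \<partial>M) = (\<integral>x. (\<Sum>y\<in>range f. y * (indicator (V y) x * A k x)) \<partial>M)"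
      by (rule Bochner_Integration.integral_cong[OF refl]) (simp add: f_sum sum_distrib_right mult.assoc)
    then show ?thesis using hAi[OF okI[OF V]] by (simp add: Bochner_Integration.integral_sum)
  qed
  then have "((\<lambda>k. \<integral>x. f x * A k x \<partial>M) \<longlongrightarrow> (\<Sum>y\<in>range f. y * n (V y))) F"
    by (simp only:) (intro tendsto_sum tendsto_mult tendsto_const nL V)
  moreover have "(\<Sum>y\<in>range f. y * n (V y)) = (\<integral>x. f x \<partial>M) * (\<integral>x. v x \<partial>M)"
  proof -
    have "(\<integral>x. f x \<partial>M) = (\<integral>x. (\<Sum>y\<in>range f. y * indicator (V y) x) \<partial>M)"
      by (rule Bochner_Integration.integral_cong[OF refl]) (rule f_sum)
    also have "\<dots> = (\<Sum>y\<in>range f. y * measure M (V y))"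
      by (subst Bochner_Integration.integral_sum) (simp_all add: emeasure_eq_measure)
    finally show ?thesis
      unfolding rigid[OF V] n_space by (simp add: sum_distrib_left mult_ac)
  qed
  ultimately have "((\<lambda>k. \<integral>x. f x * A k x \<partial>M) \<longlongrightarrow> (\<integral>x. f x \<partial>M) * (\<integral>x. v x \<partial>M)) F" by simp
  then have "eventually (\<lambda>k. dist (\<integral>x. f x * A k x \<partial>M) ((\<integral>x. f x \<partial>M) * (\<integral>x. v x \<partial>M)) < \<epsilon>) F"
    using \<epsilon> by (rule tendstoD)
  then obtain k where k: "\<bar>(\<integral>x. f x * A k x \<partial>M) - (\<integral>x. f x \<partial>M) * (\<integral>x. v x \<partial>M)\<bar> < \<epsilon>"
    using eventually_happens'[OF F(1)] by (auto simp: dist_real_def)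
  have "ok f"
  proof -
    have "\<bar>f x\<bar> \<le> (\<Sum>y\<in>range f. \<bar>y\<bar>)" for x by (rule member_le_sum) (use fin in auto)
    then show ?thesis unfolding ok_def using f by (auto intro: bddfI)
  qed
  then show False using bad[of k] k by (simp add: B_def XG)
qed

lemma mean_ergodic:
  fixes f v :: "'a \<Rightarrow> real"
  assumes f [measurable]: "f \<in> borel_measurable M" and fin: "finite (range f)"
    and v [measurable]: "v \<in> borel_measurable M" and bv: "bddf v" and \<epsilon>: "\<epsilon> > 0"
  shows "\<exists>K0>0. \<forall>K\<ge>K0. \<forall>s.
    \<bar>(\<Sum>j\<in>grid K. \<integral>x. f x * v (ac (s + j) x) \<partial>M) / (real K)\<^sup>2 - (\<integral>x. f x \<partial>M) * (\<integral>x. v x \<partial>M)\<bar> \<le> \<epsilon>"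
proof -
  obtain C where C: "C > 0" "\<And>x. \<bar>v x\<bar> \<le> C" using bddfE[OF bv] by blast
  define u where "u x = (v x + C) / (2 * C)" for x
  have u [measurable]: "u \<in> borel_measurable M" unfolding u_def by measurable
  have vu: "v x = 2 * C * u x - C" for x using C(1) by (simp add: u_def)
  have u01: "0 \<le> u x" "u x \<le> 1" for x
    using C(1) C(2)[of x] by (simp_all add: u_def divide_le_eq abs_le_iff)
  have um [measurable]: "(\<lambda>x. u (ac e x)) \<in> borel_measurable M" for e by measurable
  have "\<epsilon> / (2 * C) > 0" using \<epsilon> C by simp
  from mean_ergodic_unit[OF f fin u u01 this] obtain K0 where K0: "K0 > 0"
    "\<forall>K\<ge>K0. \<forall>s. \<bar>(\<Sum>j\<in>grid K. \<integral>x. f x * u (ac (s + j) x) \<partial>M) / (real K)\<^sup>2 - (\<integral>x. f x \<partial>M) * (\<integral>x. u x \<partial>M)\<bar> \<le> \<epsilon> / (2 * C)"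
    by blast
  define D where "D = (\<Sum>y\<in>range f. \<bar>y\<bar>)"
  have fD: "\<bar>f x\<bar> \<le> D" for x unfolding D_def by (rule member_le_sum) (use fin in auto)
  have fi: "integrable M f" by (rule bounded_integrable[OF f fD])
  have ui: "integrable M u" by (rule bounded_integrable[OF u, of 1]) (use u01 in simp)
  have fui: "integrable M (\<lambda>x. f x * u (ac e x))" for e
  proof (rule bounded_integrable)
    show "\<bar>f x * u (ac e x)\<bar> \<le> D * 1" for x
      unfolding abs_mult using fD u01 by (intro mult_mono') auto
  qed simp
  have "\<bar>(\<Sum>j\<in>grid K. \<integral>x. f x * v (ac (s + j) x) \<partial>M) / (real K)\<^sup>2 - (\<integral>x. f x \<partial>M) * (\<integral>x. v x \<partial>M)\<bar> \<le> \<epsilon>" if K: "K \<ge> K0" for K s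
  proof -
    let ?U = "(\<Sum>j\<in>grid K. \<integral>x. f x * u (ac (s + j) x) \<partial>M) / (real K)\<^sup>2" and ?f = "\<integral>x. f x \<partial>M" and ?u = "\<integral>x. u x \<partial>M"
    have Kp: "real K > 0" using K K0(1) by simp
    have 1: "(\<integral>x. f x * v (ac e x) \<partial>M) = 2 * C * (\<integral>x. f x * u (ac e x) \<partial>M) - C * ?f" for e
    proof -
      have "(\<integral>x. f x * v (ac e x) \<partial>M) = (\<integral>x. 2 * C * (f x * u (ac e x)) - C * f x \<partial>M)"
        unfolding vu by (simp add: algebra_simps)
      then show ?thesis using fi fui by simp
    qed
    have 2: "(\<integral>x. v x \<partial>M) = 2 * C * ?u - C" unfolding vu using ui by (simp add: prob_space)
    have "(\<Sum>j\<in>grid K. \<integral>x. f x * v (ac (s + j) x) \<partial>M) / (real K)\<^sup>2 = 2 * C * ?U - C * ?f"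
      unfolding 1 using Kp by (simp add: sum_subtractf sum_distrib_left[symmetric] diff_divide_distrib)
    then have "(\<Sum>j\<in>grid K. \<integral>x. f x * v (ac (s + j) x) \<partial>M) / (real K)\<^sup>2 - ?f * (\<integral>x. v x \<partial>M) = 2 * C * (?U - ?f * ?u)"
      unfolding 2 by (simp add: algebra_simps)
    moreover have "\<bar>2 * C * (?U - ?f * ?u)\<bar> = 2 * C * \<bar>?U - ?f * ?u\<bar>" using C(1) by (simp add: abs_mult)
    moreover have "2 * C * \<bar>?U - ?f * ?u\<bar> \<le> 2 * C * (\<epsilon> / (2 * C))"
      using C(1) by (intro mult_left_mono K0(2)[rule_format, OF K]) simp
    ultimately show ?thesis using C(1) by simp
  qed
  then show ?thesis using K0(1) by blast
qed

definition coding :: "'a set \<Rightarrow> 'a \<Rightarrow> site set" where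
  "coding A x = Pt ` {e. ac e x \<in> A}"

lemma mem_coding [simp]: "Pt e \<in> coding A x \<longleftrightarrow> ac e x \<in> A" "Ln k j i \<notin> coding A x"
  unfolding coding_def by blast+

lemma tau_coding: "x \<in> space M \<Longrightarrow> tau e (coding A x) = coding A (ac e x)"
proof (rule set_eqI)
  fix s assume x: "x \<in> space M"
  show "s \<in> tau e (coding A x) \<longleftrightarrow> s \<in> coding A (ac e x)"
    by (cases s) (simp_all add: ac_add[OF x])
qed

lemma measurable_coding_restrict:
  assumes A [measurable]: "A \<in> sets M" and D: "finite D"
  shows "{x \<in> space M. coding A x \<inter> D = \<sigma>} \<in> sets M"
proof -
  have 1: "{x \<in> space M. s \<in> coding A x} \<in> sets M" for s
  proof (cases s)
    case (Pt e)
    then have "{x \<in> space M. s \<in> coding A x} = ac e -` A \<inter> space M" by auto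
    then show ?thesis by simp
  next
    case (Ln k j i)
    then have "{x \<in> space M. s \<in> coding A x} = {}" by auto
    then show ?thesis by (simp only: sets.empty_sets)
  qed
  have eq: "{x \<in> space M. s \<in> coding A x \<longleftrightarrow> s \<in> \<sigma>} \<in> sets M" for s
  proof (cases "s \<in> \<sigma>")
    case False
    have "{x \<in> space M. s \<in> coding A x \<longleftrightarrow> s \<in> \<sigma>} = space M - {x \<in> space M. s \<in> coding A x}"
      using False by auto
    then show ?thesis using 1 by auto
  qed (use 1 in simp)
  show ?thesis
  proof (cases "\<sigma> \<subseteq> D")
    case True
    have "{x \<in> space M. coding A x \<inter> D = \<sigma>} = {x \<in> space M. \<forall>s\<in>D. s \<in> coding A x \<longleftrightarrow> s \<in> \<sigma>}"
      using True by blast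
    also have "\<dots> \<in> sets M" by (rule sets.sets_Collect_finite_All[OF _ D]) (use eq in auto)
    finally show ?thesis .
  next
    case False
    then have "{x \<in> space M. coding A x \<inter> D = \<sigma>} = {}" by auto
    then show ?thesis by (simp only: sets.empty_sets)
  qed
qed

lemma coding_restrict_borel:
  fixes f :: "site set \<Rightarrow> real"
  assumes A: "A \<in> sets M" and D: "finite D"
  shows "(\<lambda>x. f (coding A x \<inter> D)) \<in> borel_measurable M"
proof -
  have "(\<lambda>x. \<Sum>\<sigma>\<in>Pow D. f \<sigma> * indicator {x \<in> space M. coding A x \<inter> D = \<sigma>} x) \<in> borel_measurable M"
    using measurable_coding_restrict[OF A D] by (intro borel_measurable_sum borel_measurable_times) auto
  also have "?this \<longleftrightarrow> ?thesis"
  proof (rule measurable_cong)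
    fix x assume x: "x \<in> space M"
    have "(\<Sum>\<sigma>\<in>Pow D. f \<sigma> * indicator {x \<in> space M. coding A x \<inter> D = \<sigma>} x)
        = (\<Sum>\<sigma>\<in>Pow D. if coding A x \<inter> D = \<sigma> then f \<sigma> else 0)"
      using x by (intro sum.cong) (auto simp: indicator_def)
    then show "(\<Sum>\<sigma>\<in>Pow D. f \<sigma> * indicator {x \<in> space M. coding A x \<inter> D = \<sigma>} x) = f (coding A x \<inter> D)"
      using D by (simp add: sum.delta')
  qed
  finally show ?thesis .
qed

lemma cyl_coding:
  fixes f :: "site set \<Rightarrow> real"
  assumes A: "A \<in> sets M" and f: "cyl m f"
  shows "(\<lambda>x. f (coding A x)) \<in> borel_measurable M" "finite (range (\<lambda>x. f (coding A x)))"
proof -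
  obtain D where D: "finite D" "\<And>\<omega>. f \<omega> = f (\<omega> \<inter> D)" using f by (rule cylE) blast
  have eq: "(\<lambda>x. f (coding A x)) = (\<lambda>x. f (coding A x \<inter> D))" using D(2) by blast
  show "(\<lambda>x. f (coding A x)) \<in> borel_measurable M" unfolding eq by (rule coding_restrict_borel[OF A D(1)])
  show "finite (range (\<lambda>x. f (coding A x)))"
    unfolding eq by (rule finite_subset[of _ "f ` Pow D"]) (use D(1) in auto)
qed

text \<open>The composition with the coding is measurable only for cylinder functions. Two limits extend the
  law of the coding to an invariant mean on all bounded functions.\<close>

lemma coding_mean:
  assumes A: "A \<in> sets M"
  obtains \<psi> where "imean \<psi>" "\<And>m f. cyl m f \<Longrightarrow> \<psi> f = (\<integral>x. f (coding A x) \<partial>M)"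
proof -
  \<comment> \<open>Cut down to a finite window the coding takes only finitely many values, so its
    composition with an arbitrary function is measurable.\<close>
  define D where "D N = Pt ` ({- int N..int N} \<times> {- int N..int N})" for N
  have fD: "finite (D N)" for N by (simp add: D_def)
  define \<psi> where "\<psi> N f = (\<integral>x. f (coding A x \<inter> D N) \<partial>M)" for N and f :: "site set \<Rightarrow> real"
  have m: "mean (\<psi> N)" for N
  proof -
    have i: "integrable M (\<lambda>x. f (coding A x \<inter> D N))" if f: "bddf f" for f
    proof -
      obtain C where "\<And>\<omega>. \<bar>f \<omega>\<bar> \<le> C" using bddfE[OF f] by blast
      then show ?thesis by (intro bounded_integrable[OF coding_restrict_borel[OF A fD]])
    qed
    show ?thesis
      unfolding mean_def \<psi>_def
    proof (intro conjI allI impI)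
      show "0 \<le> (\<integral>x. f (coding A x \<inter> D N) \<partial>M)" if "bddf f" "\<forall>\<omega>. 0 \<le> f \<omega>" for f
        using that by simp
    qed (use i in \<open>simp_all add: prob_space\<close>)
  qed
  obtain F \<phi> where F: "F \<noteq> bot" "F \<le> sequentially" "mean \<phi>"
    and L: "\<And>f. bddf f \<Longrightarrow> ((\<lambda>N. \<psi> N f) \<longlongrightarrow> \<phi> f) F"
    using mean_cluster[of \<psi>, OF m] by blast
  have \<phi>: "\<phi> f = (\<integral>x. f (coding A x) \<partial>M)" if f: "cyl m f" for m f
  proof -
    obtain E where E: "finite E" "\<And>\<omega>. f \<omega> = f (\<omega> \<inter> E)" using f by (rule cylE) blast
    have "\<exists>N0. \<forall>N\<ge>N0. E \<inter> range Pt \<subseteq> D N"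
      using E(1)
    proof (induction E rule: finite_induct)
      case (insert s E)
      then obtain N0 where N0: "\<forall>N\<ge>N0. E \<inter> range Pt \<subseteq> D N" by blast
      show ?case
      proof (cases s)
        case (Pt v)
        obtain a b where v: "v = (a, b)" by (cases v)
        have "insert s E \<inter> range Pt \<subseteq> D N" if "N \<ge> max N0 (nat (\<bar>a\<bar> + \<bar>b\<bar>))" for N
        proof -
          have "(a, b) \<in> {- int N..int N} \<times> {- int N..int N}" using that by auto
          then have "s \<in> D N" unfolding D_def Pt v by blast
          then show ?thesis using N0 that by auto
        qed
        then show ?thesis by blast
      next
        case (Ln k j i)
        then show ?thesis using N0 by auto
      qed
    qed auto
    then obtain N0 where N0: "\<And>N. N \<ge> N0 \<Longrightarrow> E \<inter> range Pt \<subseteq> D N" by blast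
    have "\<psi> N f = (\<integral>x. f (coding A x) \<partial>M)" if "N \<ge> N0" for N
    proof -
      have "coding A x \<inter> D N \<inter> E = coding A x \<inter> E" for x using N0[OF that] by (auto simp: coding_def)
      then have "f (coding A x \<inter> D N) = f (coding A x)" for x
        using E(2)[of "coding A x \<inter> D N"] E(2)[of "coding A x"] by simp
      then show ?thesis by (simp add: \<psi>_def)
    qed
    then have "eventually (\<lambda>N. \<psi> N f = (\<integral>x. f (coding A x) \<partial>M)) sequentially"
      using eventually_sequentially by auto
    then have "eventually (\<lambda>N. \<psi> N f = (\<integral>x. f (coding A x) \<partial>M)) F" by (rule filter_leD[OF F(2)])
    then have "((\<lambda>N. \<psi> N f) \<longlongrightarrow> (\<integral>x. f (coding A x) \<partial>M)) F" by (rule tendsto_eventually)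
    then show ?thesis using tendsto_unique[OF F(1) L[OF cyl_bddf[OF f]]] by blast
  qed
  \<comment> \<open>\<phi> is known to be invariant only on cylinder functions. Averaging over boxes
    and a second limit make it invariant on all bounded functions and leave its values at cylinder
    functions unchanged.\<close>
  define P where "P f p = \<phi> (\<lambda>\<omega>. f (tau p \<omega>))" for f and p
  define \<Theta> where "\<Theta> n f = (\<Sum>p\<in>grid (Suc n). P f p) / (real (Suc n))\<^sup>2" for n f
  have \<Theta>m: "mean (\<Theta> n)" for n
  proof -
    have "mean (\<lambda>f. (\<Sum>p\<in>grid (Suc n). P f p) / real (card (grid (Suc n))))"
      by (rule mean_average) (simp_all add: P_def mean_pushforward[OF F(3)] grid_nonempty)
    then show ?thesis by (simp add: \<Theta>_def[abs_def])
  qed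
  have \<Theta>_inv: "(\<lambda>n. \<Theta> n (\<lambda>\<omega>. f (tau e \<omega>)) - \<Theta> n f) \<longlonglongrightarrow> 0" if f: "bddf f" for f e
  proof -
    obtain C where C: "\<And>\<omega>. \<bar>f \<omega>\<bar> \<le> C" using bddfE[OF f] by blast
    have b: "\<bar>P f p\<bar> \<le> C" for p unfolding P_def by (rule mean_bound[OF F(3) C])
    have "\<Theta> n (\<lambda>\<omega>. f (tau e \<omega>)) - \<Theta> n f = ((\<Sum>p\<in>grid (Suc n). P f (p + e)) - (\<Sum>p\<in>grid (Suc n). P f p)) / (real (Suc n))\<^sup>2" for n
      by (simp add: \<Theta>_def P_def diff_divide_distrib add.commute)
    then show ?thesis
      using shifted_grid_average_tendsto[of "\<lambda>_. P f" C Suc, OF b] by simp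
  qed
  obtain F' \<theta> where F': "F' \<noteq> bot" "F' \<le> sequentially" and \<theta>: "imean \<theta>"
    and L': "\<And>f. bddf f \<Longrightarrow> ((\<lambda>n. \<Theta> n f) \<longlongrightarrow> \<theta> f) F'"
    using imean_cluster[of \<Theta>, OF \<Theta>m \<Theta>_inv] by blast
  show thesis
  proof (rule that[OF \<theta>])
    fix m f assume f: "cyl m (f :: site set \<Rightarrow> real)"
    have "P f p = (\<integral>x. f (coding A x) \<partial>M)" for p
    proof -
      have "P f p = (\<integral>x. f (tau p (coding A x)) \<partial>M)" unfolding P_def by (rule \<phi>[OF cyl_tau[OF f]])
      also have "\<dots> = (\<integral>x. f (coding A (ac p x)) \<partial>M)"
        by (rule Bochner_Integration.integral_cong) (simp_all add: tau_coding)
      also have "\<dots> = (\<integral>x. f (coding A x) \<partial>M)" by (rule integral_ac[OF cyl_coding(1)[OF A f]])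
      finally show ?thesis .
    qed
    then have "\<Theta> n f = (\<integral>x. f (coding A x) \<partial>M)" for n by (simp add: \<Theta>_def)
    then have "((\<lambda>n. (\<integral>x. f (coding A x) \<partial>M)) \<longlongrightarrow> \<theta> f) F'" using L'[OF cyl_bddf[OF f]] by simp
    then show "\<theta> f = (\<integral>x. f (coding A x) \<partial>M)" using tendsto_unique[OF F'(1)] tendsto_const by blast
  qed
qed

lemma coding_erg:
  assumes A: "A \<in> sets M" and \<psi>: "\<And>m f. cyl m f \<Longrightarrow> \<psi> f = (\<integral>x. f (coding A x) \<partial>M)"
  shows "erg \<psi>"
  unfolding erg_def
proof (intro allI impI)
  fix m and f v :: "site set \<Rightarrow> real" and \<epsilon> :: real assume f: "cyl m f" and v: "cyl m v" and \<epsilon>: "\<epsilon> > 0"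
  obtain C where C: "\<And>\<omega>. \<bar>v \<omega>\<bar> \<le> C" using bddfE[OF cyl_bddf[OF v]] by blast
  have bv: "bddf (\<lambda>x. v (coding A x))" by (rule bddfI[of _ C]) (rule C)
  have fv: "\<psi> (\<lambda>\<omega>. f \<omega> * v (tau e \<omega>)) = (\<integral>x. f (coding A x) * v (coding A (ac e x)) \<partial>M)" for e
  proof -
    have "\<psi> (\<lambda>\<omega>. f \<omega> * v (tau e \<omega>)) = (\<integral>x. f (coding A x) * v (tau e (coding A x)) \<partial>M)"
      by (rule \<psi>[OF cyl_mult[OF f cyl_tau[OF v]]])
    also have "\<dots> = (\<integral>x. f (coding A x) * v (coding A (ac e x)) \<partial>M)"
      by (rule Bochner_Integration.integral_cong) (simp_all add: tau_coding)
    finally show ?thesis .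
  qed
  show "\<exists>K0>0. \<forall>K\<ge>K0. \<forall>s. \<bar>(\<Sum>j\<in>grid K. \<psi> (\<lambda>\<omega>. f \<omega> * v (tau (s + j) \<omega>))) / (real K)\<^sup>2 - \<psi> f * \<psi> v\<bar> \<le> \<epsilon>"
    unfolding fv \<psi>[OF f] \<psi>[OF v]
    by (rule mean_ergodic[OF cyl_coding[OF A f] cyl_coding(1)[OF A v] bv \<epsilon>])
qed

theorem corner_syndetic:
  assumes A: "A \<in> sets M" and pos: "measure M A > 0" and \<epsilon>: "\<epsilon> > 0"
  shows "\<exists>N>0. \<forall>K. \<exists>n\<in>{K..<K + int N}.
    measure M {x \<in> space M. x \<in> A \<and> ac (- n, 0) x \<in> A \<and> ac (0, - n) x \<in> A} > measure M A ^ 4 - \<epsilon>"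
proof -
  obtain \<psi> where \<psi>: "imean \<psi>" and \<psi>M: "\<And>m f. cyl m f \<Longrightarrow> \<psi> f = (\<integral>x. f (coding A x) \<partial>M)"
    by (rule coding_mean[OF A]) blast
  have erg: "erg \<psi>" by (rule coding_erg[OF A \<psi>M])
  have base: "base (tau e (coding A x)) = indicator A (ac e x)" for e x
    by (simp add: base_def indicator_def)
  have "\<psi> base = (\<integral>x. indicator A x \<partial>M)"
    unfolding \<psi>M[OF cyl_base[of 0]]
    by (rule Bochner_Integration.integral_cong[OF refl]) (use base[of 0] in \<open>simp add: ac_zero\<close>)
  then have \<psi>A: "\<psi> base = measure M A" using A by simp
  have corner: "corner \<psi> (\<lambda>_. base) n = measure M {x \<in> space M. x \<in> A \<and> ac (- n, 0) x \<in> A \<and> ac (0, - n) x \<in> A}" (is "_ = measure M ?S") for n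
  proof -
    have [measurable]: "A \<in> sets M" by (rule A)
    have S: "?S \<in> sets M" by measurable
    have v: "vt 0 (\<lambda>k. if k = 2 then n else 0) = (- n, 0)" "vt 1 (\<lambda>k. if k = 2 then n else 0) = (0, - n)"
      "vt 2 (\<lambda>k. if k = 2 then n else 0) = 0"
      by (simp_all add: vt_def zero_prod_def)
    have "corner \<psi> (\<lambda>_. base) n = (\<integral>x. base (tau (- n, 0) (coding A x)) * base (tau (0, - n) (coding A x)) * base (tau 0 (coding A x)) \<partial>M)"
      unfolding corner_def trip_def v by (rule \<psi>M[of 0]) (intro cyl_mult cyl_tau[OF cyl_base])
    also have "\<dots> = (\<integral>x. indicator ?S x \<partial>M)"
      unfolding base by (rule Bochner_Integration.integral_cong[OF refl]) (auto simp: indicator_def ac_zero)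
    also have "\<dots> = measure M ?S" using S by simp
    finally show ?thesis .
  qed
  show ?thesis
  proof (rule corner_return_times[OF \<psi> erg _ \<epsilon>])
    show "0 < \<psi> base" using pos \<psi>A by simp
    fix N :: nat assume "N > 0" "\<And>K. \<exists>n\<in>{K..<K + int N}. corner \<psi> (\<lambda>_. base) n > \<psi> base ^ 4 - \<epsilon>"
    then show ?thesis unfolding corner \<psi>A by blast
  qed
qed

end

section \<open>Integer iterates and the passage to an action of pairs of integers\<close>

lemma int_iterate_add_one:
  assumes T: "bij_betw T X X" and x: "x \<in> X"
  shows "int_iterate X T n x \<in> X" "int_iterate X T (n + 1) x = T (int_iterate X T n x)"
proof -
  let ?S = "inv_into X T"
  have TX: "T y \<in> X" if "y \<in> X" for y using T that by (auto simp: bij_betw_def)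
  have SX: "?S y \<in> X" and TS: "T (?S y) = y" if "y \<in> X" for y
    using T that by (auto simp: bij_betw_def inv_into_into f_inv_into_f)
  have T_pow: "(T ^^ k) x \<in> X" for k by (induction k) (auto simp: x TX)
  have S_pow: "(?S ^^ k) x \<in> X" for k by (induction k) (auto simp: x SX)
  show "int_iterate X T n x \<in> X" by (simp add: int_iterate_def T_pow S_pow)
  show "int_iterate X T (n + 1) x = T (int_iterate X T n x)"
  proof (cases "0 \<le> n")
    case True
    then show ?thesis by (simp add: int_iterate_def nat_add_distrib)
  next
    case False
    define k where "k = nat (- n) - 1"
    have k: "n = - int (Suc k)" using False by (simp add: k_def)
    have "int_iterate X T (n + 1) x = (?S ^^ k) x"
      by (cases k) (simp_all add: int_iterate_def k nat_add_distrib)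
    moreover have "int_iterate X T n x = ?S ((?S ^^ k) x)"
      by (simp add: int_iterate_def k nat_add_distrib)
    ultimately show ?thesis by (simp add: TS S_pow)
  qed
qed

lemma int_iterate_add:
  assumes T: "bij_betw T X X" and x: "x \<in> X"
  shows "int_iterate X T (n + k) x = int_iterate X T n (int_iterate X T k x)"
proof (induction n rule: int_induct[where k = 0])
  case base
  then show ?case by (simp add: int_iterate_def)
next
  case (step1 i)
  have "int_iterate X T (i + 1 + k) x = T (int_iterate X T (i + k) x)"
    using int_iterate_add_one(2)[OF T x, of "i + k"] by (simp add: add_ac)
  also have "\<dots> = int_iterate X T (i + 1) (int_iterate X T k x)"
    unfolding step1 using int_iterate_add_one[OF T] x by simp
  finally show ?case .
next
  case (step2 i)
  have y: "int_iterate X T k x \<in> X" by (rule int_iterate_add_one(1)[OF T x])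
  have "T (int_iterate X T (i - 1 + k) x) = int_iterate X T (i + k) x"
    using int_iterate_add_one(2)[OF T x, of "i - 1 + k"] by (simp add: add_ac)
  also have "\<dots> = T (int_iterate X T (i - 1) (int_iterate X T k x))"
    unfolding step2 using int_iterate_add_one(2)[OF T y, of "i - 1"] by simp
  finally show ?case
    using T int_iterate_add_one(1)[OF T x] int_iterate_add_one(1)[OF T y] by (auto simp: bij_betw_def inj_on_def)
qed

text \<open>Two inductions: first one map commutes with all iterates of the other, then all iterates
  do. A step towards negative exponents applies the bijection to both sides and cancels it by
  injectivity.\<close>

lemma int_iterate_commute:
  assumes S: "bij_betw S X X" and T: "bij_betw T X X" and c: "commuting_on X S T" and x: "x \<in> X"
  shows "int_iterate X S n (int_iterate X T k x) = int_iterate X T k (int_iterate X S n x)"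
proof -
  have one: "U (int_iterate X V k y) = int_iterate X V k (U y)"
    if U: "bij_betw U X X" and V: "bij_betw V X X" and UV: "\<And>y. y \<in> X \<Longrightarrow> U (V y) = V (U y)" and y: "y \<in> X"
    for U V k y
  proof (induction k rule: int_induct[where k = 0])
    case base
    then show ?case by (simp add: int_iterate_def)
  next
    case (step1 i)
    have Uy: "U y \<in> X" using U y by (auto simp: bij_betw_def)
    then show ?case
      using step1 UV int_iterate_add_one[OF V y, of i] int_iterate_add_one(2)[OF V Uy, of i] by simp
  next
    case (step2 i)
    have Uy: "U y \<in> X" using U y by (auto simp: bij_betw_def)
    note a = int_iterate_add_one[OF V y, of "i - 1"] int_iterate_add_one[OF V Uy, of "i - 1"]
    have "V (U (int_iterate X V (i - 1) y)) = V (int_iterate X V (i - 1) (U y))"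
      using step2(2) UV[OF a(1)] a by simp
    moreover have "U (int_iterate X V (i - 1) y) \<in> X" using U a(1) by (auto simp: bij_betw_def)
    ultimately show ?case using V a(3) by (auto simp: bij_betw_def inj_on_def)
  qed
  have TX: "int_iterate X T k x \<in> X" by (rule int_iterate_add_one(1)[OF T x])
  have ST: "S (int_iterate X T k y) = int_iterate X T k (S y)" if "y \<in> X" for y
    using c that by (intro one[OF S T]) (auto simp: commuting_on_def)
  show ?thesis
  proof (induction n rule: int_induct[where k = 0])
    case base
    then show ?case by (simp add: int_iterate_def)
  next
    case (step1 i)
    then show ?case
      using int_iterate_add_one[OF S TX, of i] int_iterate_add_one[OF S x, of i] ST by simp
  next
    case (step2 i)
    note a = int_iterate_add_one[OF S TX, of "i - 1"] int_iterate_add_one[OF S x, of "i - 1"]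
    have "S (int_iterate X S (i - 1) (int_iterate X T k x)) = S (int_iterate X T k (int_iterate X S (i - 1) x))"
      using step2(2) ST[OF a(3)] a by simp
    moreover have "int_iterate X T k (int_iterate X S (i - 1) x) \<in> X"
      by (rule int_iterate_add_one(1)[OF T a(3)])
    ultimately show ?case using S a(1) by (auto simp: bij_betw_def inj_on_def)
  qed
qed

text \<open>The theorem speaks of images of \<open>A\<close>, the coding of orbits that hit
  \<open>A\<close>; the passage between them explains the sign in the corner vertices
  \<open>(- n, 0)\<close> and \<open>(0, - n)\<close>.\<close>

lemma int_iterate_image:
  assumes T: "bij_betw T X X" and A: "A \<subseteq> X"
  shows "int_iterate X T n ` A = {x \<in> X. int_iterate X T (- n) x \<in> A}"
proof -
  have cancel: "int_iterate X T n (int_iterate X T (- n) x) = x" "int_iterate X T (- n) (int_iterate X T n x) = x"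
    if "x \<in> X" for x
    using int_iterate_add[OF T that, of n "- n"] int_iterate_add[OF T that, of "- n" n]
    by (simp_all add: int_iterate_def)
  show ?thesis
  proof (intro set_eqI iffI)
    fix x assume "x \<in> int_iterate X T n ` A"
    then obtain a where "a \<in> A" "x = int_iterate X T n a" by blast
    then show "x \<in> {x \<in> X. int_iterate X T (- n) x \<in> A}"
      using A cancel(2)[of a] int_iterate_add_one(1)[OF T, of a n] by auto
  next
    fix x assume "x \<in> {x \<in> X. int_iterate X T (- n) x \<in> A}"
    then show "x \<in> int_iterate X T n ` A" using cancel(1)[of x] by (metis (no_types, lifting) image_eqI mem_Collect_eq)
  qed
qed

lemma int_iterate_measure_preserving:
  assumes T: "invertible_mpt M T"
  shows "int_iterate (space M) T n \<in> M \<rightarrow>\<^sub>M M"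
    and "B \<in> sets M \<Longrightarrow> emeasure M (int_iterate (space M) T n -` B \<inter> space M) = emeasure M B"
proof -
  let ?X = "space M"
  let ?S = "inv_into ?X T"
  have bij: "bij_betw T ?X ?X" and Tm [measurable]: "T \<in> M \<rightarrow>\<^sub>M M" and Sm [measurable]: "?S \<in> M \<rightarrow>\<^sub>M M"
    and pres: "\<And>B. B \<in> sets M \<Longrightarrow> emeasure M (T -` B \<inter> ?X) = emeasure M B"
    using T by (auto simp: invertible_mpt_def)
  have S_pres: "emeasure M (?S -` B \<inter> ?X) = emeasure M B" if B: "B \<in> sets M" for B
  proof -
    have "T -` (?S -` B \<inter> ?X) \<inter> ?X = B"
      using bij sets.sets_into_space[OF B] by (auto simp: bij_betw_def inv_into_f_f)
    moreover have "?S -` B \<inter> ?X \<in> sets M" using Sm B by (rule measurable_sets)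
    ultimately show ?thesis using pres by metis
  qed
  have pow: "U ^^ k \<in> M \<rightarrow>\<^sub>M M \<and> (\<forall>B\<in>sets M. emeasure M ((U ^^ k) -` B \<inter> ?X) = emeasure M B)"
    if Um: "U \<in> M \<rightarrow>\<^sub>M M" and Up: "\<And>B. B \<in> sets M \<Longrightarrow> emeasure M (U -` B \<inter> ?X) = emeasure M B" for U k
  proof (induction k)
    case 0
    then show ?case using sets.sets_into_space by (auto simp: Int_absorb2)
  next
    case (Suc k)
    have 1: "U ^^ Suc k \<in> M \<rightarrow>\<^sub>M M" using Suc Um by (auto intro: measurable_comp)
    have "emeasure M ((U ^^ Suc k) -` B \<inter> ?X) = emeasure M B" if B: "B \<in> sets M" for B
    proof -
      have "(U ^^ Suc k) -` B \<inter> ?X = (U ^^ k) -` (U -` B \<inter> ?X) \<inter> ?X"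
        using measurable_space[of "U ^^ k" M M] Suc by auto
      moreover have "emeasure M ((U ^^ k) -` (U -` B \<inter> ?X) \<inter> ?X) = emeasure M (U -` B \<inter> ?X)"
        using Suc measurable_sets[OF Um B] by blast
      ultimately show ?thesis using Up[OF B] by (simp only:)
    qed
    then show ?case using 1 by blast
  qed
  show "int_iterate ?X T n \<in> M \<rightarrow>\<^sub>M M"
    using pow[OF Tm pres, of "nat n"] pow[OF Sm S_pres, of "nat (- n)"]
    by (simp add: int_iterate_def)
  show "B \<in> sets M \<Longrightarrow> emeasure M (int_iterate ?X T n -` B \<inter> ?X) = emeasure M B"
    using pow[OF Tm pres, of "nat n"] pow[OF Sm S_pres, of "nat (- n)"]
    by (simp add: int_iterate_def)
qed

theorem theorem1p1:
  fixes M :: "'a measure" and T1 T2 :: "'a \<Rightarrow> 'a" and A :: "'a set" and \<epsilon> :: real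
  assumes "prob_space M"
    and "invertible_mpt M T1" and "invertible_mpt M T2"
    and "commuting_on (space M) T1 T2"
    and "jointly_ergodic M T1 T2"
    and "A \<in> sets M" and "measure M A > 0"
    and "\<epsilon> > 0"
  shows "syndetic {n :: int.
    measure M (A \<inter> int_iterate (space M) T1 n ` A \<inter> int_iterate (space M) T2 n ` A)
      > measure M A ^ 4 - \<epsilon>}"
proof -
  interpret prob_space M by fact
  let ?X = "space M"
  let ?I = "int_iterate (space M)"
  define ac where "ac e x = ?I T1 (fst e) (?I T2 (snd e) x)" for e x
  have T1: "bij_betw T1 ?X ?X" and T2: "bij_betw T2 ?X ?X"
    using assms(2,3) by (auto simp: invertible_mpt_def)
  have ac1: "ac (n, 0) x = ?I T1 n x" and ac2: "ac (0, n) x = ?I T2 n x" for n x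
    by (simp_all add: ac_def int_iterate_def)
  interpret z2_action M ac
  proof
    show "ac e \<in> M \<rightarrow>\<^sub>M M" for e
      unfolding ac_def
      using measurable_comp[OF int_iterate_measure_preserving(1)[OF assms(3)] int_iterate_measure_preserving(1)[OF assms(2)]]
      by (simp add: o_def)
    show "ac 0 x = x" for x by (simp add: ac_def int_iterate_def)
    show "ac (e + e') x = ac e (ac e' x)" if x: "x \<in> ?X" for x e e'
    proof -
      note X1 = int_iterate_add_one(1)[OF T1] and X2 = int_iterate_add_one(1)[OF T2]
      have "ac (e + e') x = ?I T1 (fst e) (?I T1 (fst e') (?I T2 (snd e) (?I T2 (snd e') x)))"
        by (simp add: ac_def int_iterate_add[OF T2 x] int_iterate_add[OF T1 X2[OF X2[OF x]]])
      also have "?I T1 (fst e') (?I T2 (snd e) (?I T2 (snd e') x)) = ?I T2 (snd e) (?I T1 (fst e') (?I T2 (snd e') x))"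
        by (rule int_iterate_commute[OF T1 T2 assms(4) X2[OF x]])
      finally show ?thesis by (simp add: ac_def)
    qed
    show "emeasure M (ac e -` B \<inter> ?X) = emeasure M B" if B: "B \<in> sets M" for e B
    proof -
      let ?B = "?I T1 (fst e) -` B \<inter> ?X"
      have "?B \<in> sets M" using int_iterate_measure_preserving(1)[OF assms(2)] B by (rule measurable_sets)
      then have "emeasure M (?I T2 (snd e) -` ?B \<inter> ?X) = emeasure M ?B"
        by (rule int_iterate_measure_preserving(2)[OF assms(3)])
      moreover have "ac e -` B \<inter> ?X = ?I T2 (snd e) -` ?B \<inter> ?X"
        using int_iterate_add_one(1)[OF T2] by (auto simp: ac_def)
      ultimately show ?thesis
        using int_iterate_measure_preserving(2)[OF assms(2) B] by (simp only:)
    qed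
    show "measure M B = 0 \<or> measure M B = 1" if B: "B \<in> sets M" and inv: "\<And>e. ac e -` B \<inter> ?X = B" for B
    proof -
      have "?I T1 1 = T1" "?I T2 1 = T2" by (auto simp: int_iterate_def)
      then have "ac (1, 0) = T1" "ac (0, 1) = T2" by (simp_all add: fun_eq_iff ac1 ac2)
      then have "T1 -` B \<inter> ?X = B" "T2 -` B \<inter> ?X = B" using inv[of "(1, 0)"] inv[of "(0, 1)"] by simp_all
      then show ?thesis using assms(5) B by (auto simp: jointly_ergodic_def)
    qed
  qed
  have AX: "A \<subseteq> ?X" using assms(6) by (rule sets.sets_into_space)
  have eq: "A \<inter> ?I T1 n ` A \<inter> ?I T2 n ` A = {x \<in> ?X. x \<in> A \<and> ac (- n, 0) x \<in> A \<and> ac (0, - n) x \<in> A}" for n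
    unfolding int_iterate_image[OF T1 AX] int_iterate_image[OF T2 AX] ac1 ac2 using AX by auto
  obtain N :: nat where "N > 0" and N: "\<And>K. \<exists>n\<in>{K..<K + int N}.
    measure M {x \<in> ?X. x \<in> A \<and> ac (- n, 0) x \<in> A \<and> ac (0, - n) x \<in> A} > measure M A ^ 4 - \<epsilon>"
    using corner_syndetic[OF assms(6-8)] by blast
  show ?thesis
    unfolding syndetic_def eq
  proof (intro exI[of _ "int N"] conjI allI)
    show "{n. measure M {x \<in> ?X. x \<in> A \<and> ac (- n, 0) x \<in> A \<and> ac (0, - n) x \<in> A} > measure M A ^ 4 - \<epsilon>}
        \<inter> {K..<K + int N} \<noteq> {}" for K
      using N[of K] by blast
  qed (use \<open>N > 0\<close> in simp)
qed

end
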